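(* There are exactly $30264$ isomorphism classes of BH-designs with parameters $2$-$(64,24,46)$; that is, the maximum number of pairwise nonisomorphic $2$-$(64,24,46)$ BH-designs is exactly $30264$.
   Context: Let $AG(3,4)$ be the 3-dimensional affine geometry over the field $\mathbb{F}_4$: its points are the 64 vectors of $\mathbb{F}_4^3$ and its lines are the cosets of the 1-dimensional subspaces. The lines split into 21 parallel classes, one for each 1-dimensional subspace $\ell$; the parallel class $P_\ell$ consists of the 16 cosets of $\ell$, which are identified with the points of the quotient affine plane $\mathbb{F}_4^3/\ell\cong AG(2,4)$. A maximal arc (of degree 2) in $AG(2,4)$ is a set of 6 points meeting every line of $AG(2,4)$ in 0 or 2 points. The 16 translates of such a maximal arc are the blocks of a symmetric $2$-$(16,6,2)$ design, invariant under the translation group of $AG(2,4)$. A $2$-$(64,24,46)$ BH-design (a design obtained via the Blokhuis–Haemers construction with $q=4$) is an incidence structure obtained as follows. For each of the 21 one-dimensional subspaces $\ell$, choose (independently) a maximal arc $A_\ell$ in the quotient plane $\mathbb{F}_4^3/\ell$. The points of the design are the 64 points of $AG(3,4)$, and the blocks are the $21\cdot 16=336$ point sets of size 24 which are, for each $\ell$ and each of the 16 translates $A_\ell+t$ ($t\in\mathbb{F}_4^3/\ell$), the union of the six lines of $P_\ell$ corresponding to the points of $A_\ell+t$. Such a structure is a quasi-symmetric $2$-$(64,24,46)$ design with block intersection numbers 8 and 12. Two designs are isomorphic if there is a bijection between their point sets mapping the set of blocks of one onto the set of blocks of the other. *)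

theory Defs
  imports "HOL-Analysis.Analysis"
begin

text \<open>
  The field with four elements is represented by an arbitrary type \<open>'q\<close> of class \<open>field\<close>
  with \<open>CARD('q) = 4\<close>; that cardinality is an assumption wherever it is needed, not a part of
  the definitions below.
\<close>

type_synonym 'p design = "'p set \<times> 'p set set"

definition isomorphic_designs :: "'p design \<Rightarrow> 'r design \<Rightarrow> bool" where
  "isomorphic_designs D E \<longleftrightarrow>
     (\<exists>f. bij_betw f (fst D) (fst E) \<and> (\<lambda>B. f ` B) ` snd D = snd E)"

definition directions :: "('q::field ^ 3) set set" where
  "directions = {l. vec.subspace l \<and> vec.dim l = 1}"

definition coset :: "('q::field ^ 3) set \<Rightarrow> 'q ^ 3 \<Rightarrow> ('q ^ 3) set" where
  "coset l v = (\<lambda>x. v + x) ` l"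

definition parallel_class :: "('q::field ^ 3) set \<Rightarrow> ('q ^ 3) set set" where
  "parallel_class l = range (coset l)"

text \<open>
  The points of the quotient plane by \<open>l\<close> are the elements of \<open>parallel_class l\<close>. Its lines are
  the cosets of its one-dimensional subspaces, that is, the sets of all
  \<open>(p + l) + c \<cdot> (d + l) = coset l (p + c *s d)\<close> with \<open>c\<close> ranging over the field, where
  \<open>d + l\<close> is nonzero in the quotient, i.e. \<open>d \<notin> l\<close>.
\<close>

definition quotient_lines :: "('q::field ^ 3) set \<Rightarrow> ('q ^ 3) set set set" where
  "quotient_lines l = {range (\<lambda>c. coset l (p + c *s d)) | p d. d \<notin> l}"

definition maximal_arc :: "('q::field ^ 3) set \<Rightarrow> ('q ^ 3) set set \<Rightarrow> bool" where
  "maximal_arc l A \<longleftrightarrow>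
     A \<subseteq> parallel_class l \<and> card A = 6 \<and>
     (\<forall>m \<in> quotient_lines l. card (A \<inter> m) = 0 \<or> card (A \<inter> m) = 2)"

text \<open>Translation by \<open>t + l\<close> in the quotient sends the coset \<open>C\<close> of \<open>l\<close> to \<open>t + C\<close>.\<close>

definition translate :: "'q::field ^ 3 \<Rightarrow> ('q ^ 3) set set \<Rightarrow> ('q ^ 3) set set" where
  "translate t A = (\<lambda>C. (\<lambda>x. t + x) ` C) ` A"

definition bh_design :: "(('q::field ^ 3) set \<Rightarrow> ('q ^ 3) set set) \<Rightarrow> ('q ^ 3) design" where
  "bh_design A = (UNIV, {\<Union> (translate t (A l)) | l t. l \<in> directions})"

definition bh_designs :: "('q::field ^ 3) design set" where
  "bh_designs = {bh_design A | A. \<forall>l \<in> directions. maximal_arc l (A l)}"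

definition bh_isomorphism :: "(('q::field ^ 3) design \<times> ('q ^ 3) design) set" where
  "bh_isomorphism = {(D, E). D \<in> bh_designs \<and> E \<in> bh_designs \<and> isomorphic_designs D E}"

end

theory Submission
  imports Defs
begin

text \<open>
  Let \<open>V\<close> be the three-dimensional space over the field with four elements, and \<open>tr\<close> the trace
  to the prime field. The count rests on a change of viewpoint: translation classes of
  maximal arcs are alternating forms. Let \<open>A\<close> be a maximal arc in \<open>V / l\<close> and \<open>B\<close> the union of its
  points. Every line of \<open>V\<close> meets \<open>B\<close> in an even number of points, which forces the indicator of
  \<open>B\<close> to be a quadratic function over the prime field with second derivative
  \<open>tr (det (v, x, y))\<close> for exactly one nonzero \<open>v \<in> l\<close> (\<open>plane_normal_form\<close>, \<open>arc_block\<close>). Conversely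
  each nonzero \<open>v\<close> arises, and the sets of size 24 with this second derivative are exactly the
  16 translates of \<open>B\<close> (\<open>ex_arc\<close>, \<open>block_translate\<close>). A BH-design therefore is the same thing as a
  transversal: a set \<open>S\<close> with one nonzero vector on each of the 21 one-dimensional subspaces
  (\<open>bh_designs_eq\<close>).

  Next, two designs are isomorphic iff a semilinear bijection carries one transversal to the
  other (\<open>isomorphic_design_of_iff\<close>). A semilinear \<open>g\<close> maps the blocks of \<open>v\<close> to those of \<open>g v\<close>
  divided by the determinant of \<open>g\<close>, and every semilinear bijection has the shape \<open>g / det g\<close>,
  because \<open>d ^ 3 = 1\<close> for all nonzero \<open>d\<close>. For the converse, an isomorphism preserves the
  quadruples of points that meet every block evenly. They are the planes
  \<open>{a, a + x, a + y, a + x + y}\<close> over the prime field for which \<open>x \<times> y\<close> is orthogonal to \<open>S\<close> with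
  respect to the trace form (\<open>even4_iff\<close>). Only one nonzero vector can be orthogonal to \<open>S\<close>
  (\<open>annih_unique\<close>). So apart from the lines of \<open>V\<close> the only even quadruples lie in the cosets of
  one plane, if there are any; the lines outside these cosets are recognizable, and they
  determine the lines inside (\<open>thin_line\<close>, \<open>thick_line\<close>). An isomorphism hence maps lines to
  lines and is semilinear up to a translation (\<open>line_preserving_linear\<close>).

  It remains to count the orbits of the semilinear group, of order 362880, on transversals.
  By Burnside's lemma this needs the sum over all \<open>g\<close> of the number of fixed transversals,
  which is a class function. If \<open>v\<close>, \<open>g v\<close>, \<open>g (g v)\<close> is a basis for some \<open>v\<close>, then \<open>g\<close> is a companion
  matrix in that basis; counting pairs of \<open>g\<close> and such a \<open>v\<close> replaces the sum by one over 48
  companion matrices for each field automorphism, weighted by the number of possible \<open>v\<close>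
  (\<open>sum_cyclic\<close>). If there is no such \<open>v\<close>, but \<open>v\<close> and \<open>g v\<close> are independent for some \<open>v\<close>, they span
  an invariant plane and a similar list of normal forms does (\<open>sum_planar\<close>). Otherwise \<open>g\<close> is a
  homothety and fixes no transversal unless it is the identity, which fixes all \<open>3 ^ 21\<close> of
  them (\<open>homothety_fixed\<close>). For each normal form the fixed transversals are counted orbit by
  orbit (\<open>fixed_on_split\<close>), and the resulting finite tables are evaluated by rewriting. They
  add up to \<open>30264 * 362880\<close>.
\<close>

section \<open>Coordinates over the field with four elements\<close>

text \<open>The parameter is there only to name the type of the field.\<close>
locale gf4 =
  fixes ty :: "'q::{field,finite} itself"
  assumes card4: "CARD('q) = 4"

text \<open>
  Both elements outside the prime field are roots of \<open>z * z = z + 1\<close> and are interchanged by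
  \<open>frob\<close>, so the choice is immaterial.
\<close>
definition omega :: "'a::field" where
  "omega = (SOME z. z \<noteq> 0 \<and> z \<noteq> 1)"

text \<open>For a field with four elements this is the trace to the prime field.\<close>
definition abs_tr :: "'a::field \<Rightarrow> 'a" where
  "abs_tr z = z + z * z"

definition frob :: "'a::field \<Rightarrow> 'a" where
  "frob z = z * z"

context gf4
begin

text \<open>
  Adding 1 permutes the field, so the sum of all elements does not change when \<open>4 = 2 * 2\<close> is
  added to it.
\<close>
lemma two0: "(1::'q) + 1 = 0"
proof -
  have "(\<Sum>x\<in>(UNIV::'q set). x + 1) = (\<Sum>x\<in>UNIV. x)"
    by (rule sum.reindex_bij_witness[where i="\<lambda>x. x - 1" and j="\<lambda>x. x + 1"]) auto
  then have "of_nat CARD('q) * (1::'q) = 0"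
    by (simp add: sum.distrib)
  then have "(2::'q) * 2 = 0"
    using card4 by simp
  then have "(2::'q) = 0" by (simp only: mult_eq_0_iff disj_absorb)
  then show ?thesis by simp
qed

lemma two_eq_0 [simp]: "(2::'q) = 0"
  using two0 by simp

lemma add_self [simp]: "(x::'q) + x = 0"
proof -
  have "x + x = x * (1 + 1)" by (simp only: distrib_left mult_1_right)
  then show ?thesis by (simp only: two0 mult_zero_right)
qed

lemma add_self_left [simp]: "(x::'q) + (x + y) = y"
  by (simp add: add.assoc[symmetric])

lemma minus_eq [simp]: "- (x::'q) = x"
  using add_self[of x] by (simp only: add_eq_0_iff)

lemma diff_eq [simp]: "(x::'q) - y = x + y"
  by (simp only: diff_conv_add_uminus minus_eq)

lemma omega_ne: "(omega::'q) \<noteq> 0" "(omega::'q) \<noteq> 1"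
proof -
  have "\<not> (UNIV::'q set) \<subseteq> {0, 1}"
  proof
    assume "(UNIV::'q set) \<subseteq> {0, 1}"
    then have "CARD('q) \<le> card {0, 1::'q}" by (intro card_mono) auto
    then show False using card4 by simp
  qed
  then have "\<exists>z::'q. z \<noteq> 0 \<and> z \<noteq> 1" by auto
  from someI_ex[OF this] show "(omega::'q) \<noteq> 0" "(omega::'q) \<noteq> 1"
    unfolding omega_def by auto
qed

lemma UNIV4: "(UNIV::'q set) = {0, 1, omega, omega + 1}"
proof -
  have "card {0, 1, omega, omega + 1 :: 'q} = 4"
    using omega_ne by (auto simp: card_insert_if add_eq_0_iff)
  then show ?thesis
    using card4 by (intro card_subset_eq[symmetric]) auto
qed

lemma cases4: "(z::'q) = 0 \<or> z = 1 \<or> z = omega \<or> z = omega + 1"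
  using UNIV4 by auto

lemma omega_sq [simp]: "omega * omega = (omega::'q) + 1"
proof -
  have "(omega + 1) * (omega + 1) = omega * omega + (1::'q)"
    by (simp add: algebra_simps)
  moreover have "omega + 1 \<noteq> (0::'q)" using omega_ne by (simp add: add_eq_0_iff)
  ultimately have "omega * omega \<noteq> (1::'q)" by auto
  moreover have "omega * omega \<noteq> (0::'q)" "omega * omega \<noteq> (omega::'q)" using omega_ne by auto
  ultimately show ?thesis using cases4[of "omega * omega"] by auto
qed

lemma omega_sq_left [simp]: "omega * (omega * x) = omega * x + (x::'q)"
  by (simp only: mult.assoc[symmetric] omega_sq distrib_right mult_1_left)

lemma omega_ne_simps [simp]:
  "(omega::'q) + 1 \<noteq> 0" "(omega::'q) \<noteq> 0" "(omega::'q) \<noteq> 1"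
  "1 \<noteq> (omega::'q)" "omega + 1 \<noteq> (omega::'q)" "omega + 1 \<noteq> (1::'q)"
  using omega_ne by (simp_all add: add_eq_0_iff)

lemma all4: "(\<forall>z::'q. P z) \<longleftrightarrow> P 0 \<and> P 1 \<and> P omega \<and> P (omega + 1)"
  using cases4 by metis

lemma ex4: "(\<exists>z::'q. P z) \<longleftrightarrow> P 0 \<or> P 1 \<or> P omega \<or> P (omega + 1)"
  using cases4 by metis

lemma sum4: "(\<Sum>z\<in>(UNIV::'q set). f z) = f 0 + (f 1 + (f omega + f (omega + 1)))"
  unfolding UNIV4 by (subst sum.insert, simp, simp)+ simp

lemma cube1: "(z::'q) \<noteq> 0 \<Longrightarrow> z * (z * z) = 1"
  using cases4[of z] by (auto simp: algebra_simps)

lemma pow4 [simp]: "(z::'q) * (z * (z * z)) = z"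
  using cube1[of z] by (cases "z = 0") auto

lemma abs_tr_01: "abs_tr z = 0 \<or> abs_tr z = (1::'q)"
  using cases4[of z] by (auto simp: abs_tr_def algebra_simps)

lemma abs_tr_add: "abs_tr (x + y) = abs_tr x + (abs_tr y::'q)"
  by (simp add: abs_tr_def algebra_simps)

lemma abs_tr_simps [simp]: "abs_tr 0 = (0::'q)" "abs_tr 1 = (0::'q)" "abs_tr omega = (1::'q)" "abs_tr (omega + 1) = (1::'q)"
    "abs_tr (1 + omega) = (1::'q)"
  by (simp_all add: abs_tr_def algebra_simps)

lemma abs_tr_frob: "abs_tr (frob z) = (abs_tr z::'q)"
  by (simp add: abs_tr_def frob_def mult.assoc)

lemma frob_add: "frob (x + y) = frob x + (frob y::'q)"
  by (simp add: frob_def algebra_simps)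

lemma frob_mult: "frob (x * y) = frob x * (frob y::'q)"
  by (simp add: frob_def algebra_simps)

lemma frob_frob [simp]: "frob (frob x) = (x::'q)"
  by (simp add: frob_def algebra_simps)

lemma frob_simps [simp]: "frob 0 = (0::'q)" "frob 1 = (1::'q)" "frob omega = (omega + 1::'q)"
    "frob (omega + 1) = (omega::'q)"
  by (simp_all add: frob_def algebra_simps)

text \<open>The trace form is nondegenerate.\<close>
lemma abs_tr_all0:
  assumes "\<And>c. abs_tr (c * z) = (0::'q)"
  shows "z = 0"
  using assms[of 1] assms[of omega] cases4[of z] by (auto simp: algebra_simps simp del: add.commute)

end

definition dotp :: "'a::field ^ 3 \<Rightarrow> 'a ^ 3 \<Rightarrow> 'a" where
  "dotp x y = x$1 * y$1 + x$2 * y$2 + x$3 * y$3"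

definition cross :: "'a::field ^ 3 \<Rightarrow> 'a ^ 3 \<Rightarrow> 'a ^ 3" where
  "cross x y = vector [x$2 * y$3 - x$3 * y$2, x$3 * y$1 - x$1 * y$3, x$1 * y$2 - x$2 * y$1]"

definition det3 :: "'a::field ^ 3 \<Rightarrow> 'a ^ 3 \<Rightarrow> 'a ^ 3 \<Rightarrow> 'a" where
  "det3 v x y = dotp v (cross x y)"

lemma cross_nth [simp]:
  "cross x y $ 1 = x$2 * y$3 - x$3 * y$2"
  "cross x y $ 2 = x$3 * y$1 - x$1 * y$3"
  "cross x y $ 3 = x$1 * y$2 - x$2 * y$1"
  by (simp_all add: cross_def)

lemmas vec3_eq = vec_eq_iff forall_3

lemma dotp_add: "dotp (x + y) z = dotp x z + dotp y z" "dotp z (x + y) = dotp z x + dotp z y"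
  by (simp_all add: dotp_def algebra_simps)

lemma dotp_smult: "dotp (c *s x) z = c * dotp x z" "dotp z (c *s x) = c * dotp z x"
  by (simp_all add: dotp_def algebra_simps)

lemma dotp_0 [simp]: "dotp 0 z = 0" "dotp z 0 = 0"
  by (simp_all add: dotp_def)

lemma cross_self [simp]: "cross x x = 0"
  by (simp add: vec3_eq)

lemma cross_0 [simp]: "cross 0 x = 0" "cross x 0 = 0"
  by (simp_all add: vec3_eq)

lemma cross_add: "cross (x + y) z = cross x z + cross y z" "cross z (x + y) = cross z x + cross z y"
  by (simp_all add: vec3_eq algebra_simps)

lemma cross_smult: "cross (c *s x) z = c *s cross x z" "cross z (c *s x) = c *s cross z x"
  by (simp_all add: vec3_eq algebra_simps)

lemma cross_commute: "cross x y = - cross y x"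
  by (simp add: vec3_eq)

lemma det3_add: "det3 (x + y) z w = det3 x z w + det3 y z w"
  "det3 z (x + y) w = det3 z x w + det3 z y w"
  "det3 z w (x + y) = det3 z w x + det3 z w y"
  by (simp_all add: det3_def dotp_add cross_add)

lemma det3_smult: "det3 (c *s x) z w = c * det3 x z w"
  "det3 z (c *s x) w = c * det3 z x w"
  "det3 z w (c *s x) = c * det3 z w x"
  by (simp_all add: det3_def dotp_smult cross_smult)

lemma det3_eq [simp]: "det3 x x y = 0" "det3 x y x = 0" "det3 x y y = 0"
  by (simp_all add: det3_def dotp_def algebra_simps)

lemma det3_0 [simp]: "det3 0 x y = 0" "det3 x 0 y = 0" "det3 x y 0 = 0"
  by (simp_all add: det3_def)

lemma det3_perm: "det3 y x z = - det3 x y z" "det3 x z y = - det3 x y z" "det3 z y x = - det3 x y z"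
  by (simp_all add: det3_def dotp_def algebra_simps)

lemma cramer: "det3 v x y *s z = det3 z x y *s v + det3 v z y *s x + det3 v x z *s (y::'a::field^3)"
  unfolding vec3_eq det3_def dotp_def by (auto simp: algebra_simps)

lemma ex_dotp1:
  assumes "w \<noteq> 0" shows "\<exists>z. dotp z w = (1::'a::field)"
proof -
  from assms consider "w$1 \<noteq> 0" | "w$2 \<noteq> 0" | "w$3 \<noteq> 0" by (auto simp: vec3_eq)
  then show ?thesis
  proof cases
    case 1 then show ?thesis by (intro exI[of _ "vector [inverse (w$1), 0, 0]"]) (simp add: dotp_def)
  next
    case 2 then show ?thesis by (intro exI[of _ "vector [0, inverse (w$2), 0]"]) (simp add: dotp_def)
  next
    case 3 then show ?thesis by (intro exI[of _ "vector [0, 0, inverse (w$3)]"]) (simp add: dotp_def)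
  qed
qed

lemma cross_eq_0:
  assumes "cross x y = 0" "x \<noteq> 0" shows "\<exists>c. y = c *s (x::'a::field^3)"
proof -
  from assms consider "x$1 \<noteq> 0" | "x$2 \<noteq> 0" | "x$3 \<noteq> 0" by (auto simp: vec3_eq)
  then show ?thesis
  proof cases
    case 1 with assms(1) show ?thesis
      by (intro exI[of _ "y$1 / x$1"]) (auto simp: vec3_eq field_simps)
  next
    case 2 with assms(1) show ?thesis
      by (intro exI[of _ "y$2 / x$2"]) (auto simp: vec3_eq field_simps)
  next
    case 3 with assms(1) show ?thesis
      by (intro exI[of _ "y$3 / x$3"]) (auto simp: vec3_eq field_simps)
  qed
qed

lemma ex_cross_ne:
  assumes "x \<noteq> 0" shows "\<exists>y. cross x y \<noteq> (0::'a::field^3)"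
proof (rule ccontr)
  assume "\<not> ?thesis"
  then have "cross x (vector [1,0,0]) = 0" "cross x (vector [0,1,0]) = 0" by blast+
  then show False using assms by (auto simp: vec3_eq)
qed

lemma ex_cross_dotp1:
  assumes "cross x y \<noteq> 0" shows "\<exists>z. det3 z x (y::'a::field^3) = 1"
  using ex_dotp1[OF assms] by (simp add: det3_def)

lemma ex_det1:
  assumes "v \<noteq> (0::'a::field^3)" shows "\<exists>x y. det3 v x y = 1"
proof -
  obtain x where "cross v x \<noteq> 0" using ex_cross_ne[OF assms] by blast
  then obtain z where "det3 z v x = 1" using ex_cross_dotp1 by blast
  then have "det3 v x z = 1" by (simp add: det3_def dotp_def algebra_simps)
  then show ?thesis by blast
qed

context gf4
begin

lemma vadd_self [simp]: "(x::'q^3) + x = 0"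
  by (simp add: vec3_eq)
lemma vadd_self_left [simp]: "(x::'q^3) + (x + y) = y"
  by (simp add: vec3_eq)
lemma vminus_eq [simp]: "- (x::'q^3) = x"
  by (simp add: vec3_eq)
lemma vdiff_eq [simp]: "(x::'q^3) - y = x + y"
  by (simp add: vec3_eq)

lemma vadd_eq_0: "(x::'q^3) + y = 0 \<longleftrightarrow> x = y"
  by (metis add.right_neutral vadd_self vadd_self_left)

lemma add_eq_0: "(x::'q) + y = 0 \<longleftrightarrow> x = y"
  by (metis add.right_neutral add_self add_self_left)

lemma abs_tr_det_all0:
  assumes "\<And>x y. abs_tr (det3 v x y) = (0::'q)"
  shows "v = 0"
proof (rule ccontr)
  assume "v \<noteq> 0"
  then obtain x y where 1: "det3 v x y = 1" using ex_det1 by blast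
  have "abs_tr (c * det3 v x y) = 0" for c using assms[of "c *s x" y] by (simp add: det3_smult)
  then have "det3 v x y = 0" by (rule abs_tr_all0)
  then show False using 1 by simp
qed

end

section \<open>Semilinear maps and blocks with a given alternating form\<close>

definition E1 :: "'a::field ^ 3" where "E1 = vector [1, 0, 0]"
definition E2 :: "'a::field ^ 3" where "E2 = vector [0, 1, 0]"
definition E3 :: "'a::field ^ 3" where "E3 = vector [0, 0, 1]"

lemma E_nth [simp]:
  "E1 $ 1 = 1" "E1 $ 2 = 0" "E1 $ 3 = 0"
  "E2 $ 1 = 0" "E2 $ 2 = 1" "E2 $ 3 = 0"
  "E3 $ 1 = 0" "E3 $ 2 = 0" "E3 $ 3 = 1"
  by (simp_all add: E1_def E2_def E3_def)

lemma det3_E [simp]: "det3 E1 E2 E3 = 1"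
  by (simp add: det3_def dotp_def)

lemma vec_expand: "x = x$1 *s E1 + x$2 *s E2 + x$3 *s (E3 :: 'a::field ^ 3)"
  by (simp add: vec3_eq)

definition auts :: "('a::field \<Rightarrow> 'a) set" where
  "auts = {id, frob}"

definition semilinear :: "('a::field \<Rightarrow> 'a) \<Rightarrow> ('a ^ 3 \<Rightarrow> 'a ^ 3) \<Rightarrow> bool" where
  "semilinear t g \<longleftrightarrow> (\<forall>x y. g (x + y) = g x + g y) \<and> (\<forall>c x. g (c *s x) = t c *s g x)"

definition GammaL :: "('a::field ^ 3 \<Rightarrow> 'a ^ 3) set" where
  "GammaL = {g. bij g \<and> (\<exists>t \<in> auts. semilinear t g)}"

definition det_map :: "('a::field ^ 3 \<Rightarrow> 'a ^ 3) \<Rightarrow> 'a" where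
  "det_map g = det3 (g E1) (g E2) (g E3)"

lemma semilinear_add: "semilinear t g \<Longrightarrow> g (x + y) = g x + g y"
  by (simp add: semilinear_def)

lemma semilinear_smult: "semilinear t g \<Longrightarrow> g (c *s x) = t c *s g x"
  by (simp add: semilinear_def)

lemma semilinear_0: "semilinear t g \<Longrightarrow> g 0 = 0"
  using semilinear_add[of t g 0 0] by simp

lemma semilinear_expand:
  assumes "semilinear t g"
  shows "g x = t (x$1) *s g E1 + t (x$2) *s g E2 + t (x$3) *s g E3"
  by (subst vec_expand[of x]) (simp only: semilinear_add[OF assms] semilinear_smult[OF assms])

text \<open>
  The values lie in the field itself. The prime field thus plays the role of the integers
  modulo 2, and statements about parity become equations in \<open>'a\<close>.
\<close>
definition indic :: "('a::field ^ 3) set \<Rightarrow> 'a ^ 3 \<Rightarrow> 'a" where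
  "indic B x = (if x \<in> B then 1 else 0)"

text \<open>
  The sets of size 24 whose indicator is quadratic over the prime field with polar form
  \<open>abs_tr (det3 v x y)\<close>. The radical of this form is \<open>ray v\<close>, unless \<open>v = 0\<close>.
\<close>
definition blocks :: "'a::field ^ 3 \<Rightarrow> ('a ^ 3) set set" where
  "blocks v = {B. card B = 24 \<and>
     (\<forall>a x y. indic B a + indic B (a + x) + indic B (a + y) + indic B (a + x + y) = abs_tr (det3 v x y))}"

definition ray :: "'a::field ^ 3 \<Rightarrow> ('a ^ 3) set" where
  "ray v = range (\<lambda>c. c *s v)"

lemma ray_eq:
  assumes "w \<in> ray v" "w \<noteq> 0" shows "ray w = ray (v :: 'a::field ^ 3)"
proof -
  from assms obtain c where w: "w = c *s v" by (auto simp: ray_def)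
  with assms have c: "c \<noteq> 0" by auto
  have "k *s v \<in> ray w" for k
    unfolding ray_def w using c by (intro image_eqI[of _ _ "k / c"]) auto
  then show ?thesis unfolding w by (auto simp: ray_def)
qed

lemma directions_ray: "directions = {ray v | v :: 'a::field ^ 3. v \<noteq> 0}"
proof -
  have 1: "\<exists>v. v \<noteq> 0 \<and> l = ray v" if s: "vec.subspace l" and d: "vec.dim l = 1" for l :: "('a^3) set"
  proof -
    have "l \<noteq> {0}" using d by (auto simp: vec.dim_singleton)
    moreover have "0 \<in> l" using s by (simp add: vec.subspace_0)
    ultimately obtain v where v: "v \<in> l" "v \<noteq> 0" by blast
    have "ray v = vec.span {v}" by (simp add: ray_def vec.span_singleton)
    moreover have "vec.span {v} \<subseteq> l" using v s by (intro vec.span_minimal) auto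
    moreover have "vec.span {v} = l"
    proof (rule vec.subspace_dim_equal[OF vec.subspace_span s calculation(2)])
      show "vec.dim l \<le> vec.dim (vec.span {v})" using v d by (simp add: vec.dim_singleton)
    qed
    ultimately show ?thesis using v by auto
  qed
  have 2: "vec.subspace (ray v) \<and> vec.dim (ray v) = 1" if "v \<noteq> 0" for v :: "'a^3"
  proof -
    have "ray v = vec.span {v}" by (simp add: ray_def vec.span_singleton)
    then show ?thesis using that by (simp only: vec.subspace_span vec.dim_span vec.dim_singleton) simp
  qed
  show ?thesis unfolding directions_def using 1 2 by (intro Collect_cong iffI; elim exE conjE) (metis, simp)
qed

context gf4
begin

lemma auts_rules:
  assumes "t \<in> (auts :: ('q \<Rightarrow> 'q) set)"
  shows "t (x + y) = t x + t y" "t (x * y) = t x * t y" "t 0 = 0" "t 1 = 1" "abs_tr (t x) = abs_tr x"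
    "t (t x) = x" "t x = 0 \<longleftrightarrow> x = 0"
  using assms by (auto simp: auts_def frob_add frob_mult abs_tr_frob) (simp_all add: frob_def)

lemma det3_swap: "det3 y x z = (det3 x y z :: 'q)" "det3 x z y = (det3 x y z :: 'q)"
  by (metis det3_perm(1) minus_eq) (metis det3_perm(2) minus_eq)

text \<open>
  Up to the automorphism and the constant \<open>det_map g\<close>, semilinear maps preserve determinants:
  expand all three vectors in the unit vectors.
\<close>
lemma semilinear_det:
  assumes "semilinear t g" "t \<in> (auts :: ('q \<Rightarrow> 'q) set)"
  shows "det3 (g x) (g y) (g z) = det_map g * t (det3 x y z)"
proof -
  have "det3 (g x) (g y) (g z) = det_map g * det3 (\<chi> i. t (x$i)) (\<chi> i. t (y$i)) (\<chi> i. t (z$i))"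
    unfolding det_map_def
    apply (subst (1) semilinear_expand[OF assms(1), of x])
    apply (subst (1) semilinear_expand[OF assms(1), of y])
    apply (subst (1) semilinear_expand[OF assms(1), of z])
    apply (simp only: det3_add det3_smult det3_eq mult_zero_right add_0_left add_0_right)
    apply (simp add: det3_swap)
    apply (simp add: det3_def dotp_def algebra_simps)
    done
  also have "det3 (\<chi> i. t (x$i)) (\<chi> i. t (y$i)) (\<chi> i. t (z$i)) = t (det3 x y z)"
    by (simp add: det3_def dotp_def auts_rules[OF assms(2)])
  finally show ?thesis .
qed

lemma GammaL_det_map:
  assumes "g \<in> GammaL" shows "det_map (g :: 'q^3 \<Rightarrow> 'q^3) \<noteq> 0"
proof
  assume d: "det_map g = 0"
  obtain t where t: "t \<in> auts" "semilinear t g" and b: "bij g" using assms by (auto simp: GammaL_def)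
  obtain a b c where "g a = E1" "g b = E2" "g c = E3" using b by (metis bij_def surjD)
  then have "det3 E1 E2 (E3::'q^3) = det_map g * t (det3 a b c)"
    using semilinear_det[OF t(2,1), of a b c] by simp
  with d show False by simp
qed

lemma semilinear_bij:
  assumes t: "t \<in> auts" "semilinear t g" and d: "det_map (g :: 'q^3 \<Rightarrow> 'q^3) \<noteq> 0"
  shows "bij g"
proof -
  have "inj g"
  proof (rule injI)
    fix x y assume e: "g x = g y"
    show "x = y"
    proof (rule ccontr)
      assume "x \<noteq> y"
      then have "x + y \<noteq> 0" by (simp add: vadd_eq_0)
      then obtain u w where "det3 (x + y) u w = 1" using ex_det1 by blast
      then have "det3 (g (x + y)) (g u) (g w) = det_map g" using semilinear_det[OF t(2,1)]
        by (simp add: auts_rules[OF t(1)])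
      moreover have "g (x + y) = 0" using e by (simp add: semilinear_add[OF t(2)])
      ultimately show False using d by simp
    qed
  qed
  then show ?thesis by (simp add: bij_def finite_UNIV_inj_surj)
qed

lemma GammaL_iff: "g \<in> GammaL \<longleftrightarrow> det_map (g :: 'q^3 \<Rightarrow> 'q^3) \<noteq> 0 \<and> (\<exists>t \<in> auts. semilinear t g)"
  using GammaL_det_map semilinear_bij by (auto simp: GammaL_def)

text \<open>
  The action of \<open>g\<close> on vectors that corresponds to its action on the forms
  \<open>abs_tr (det3 v x y)\<close>.
\<close>
definition twist :: "('q ^ 3 \<Rightarrow> 'q ^ 3) \<Rightarrow> 'q ^ 3 \<Rightarrow> 'q ^ 3" where
  "twist g v = inverse (det_map g) *s g v"

lemma det_map_smult: "det_map (\<lambda>v. c *s g v) = c * (c * (c * det_map (g :: 'q^3 \<Rightarrow> 'q^3)))"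
  by (simp add: det_map_def det3_smult algebra_simps)

lemma smult_GammaL:
  assumes "g \<in> GammaL" "c \<noteq> 0" shows "(\<lambda>v. c *s (g v :: 'q^3)) \<in> GammaL"
proof -
  obtain t where t: "t \<in> auts" "semilinear t g" using assms by (auto simp: GammaL_def)
  have "semilinear t (\<lambda>v. c *s g v)"
    using t(2) by (auto simp: semilinear_def vec.scale_right_distrib mult.commute)
  moreover have "det_map (\<lambda>v. c *s g v) \<noteq> 0" using assms GammaL_det_map by (simp add: det_map_smult)
  ultimately show ?thesis using t by (auto simp: GammaL_iff)
qed

lemma twist_GammaL: "g \<in> GammaL \<Longrightarrow> twist g \<in> GammaL"
  unfolding twist_def by (rule smult_GammaL) (auto simp: GammaL_det_map)

text \<open>
  Multiplying \<open>h\<close> by its determinant \<open>d\<close> does not change the determinant, since \<open>d ^ 4 = d\<close>;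
  dividing by it again gives back \<open>h\<close>.
\<close>
lemma ex_twist:
  assumes h: "h \<in> GammaL" shows "\<exists>g \<in> GammaL. twist g = (h :: 'q^3 \<Rightarrow> 'q^3)"
proof (intro bexI[of _ "\<lambda>v. det_map h *s h v"])
  have "det_map h * (det_map h * (det_map h * det_map h)) = det_map h" by simp
  then have "det_map (\<lambda>v. det_map h *s h v) = det_map h" by (simp only: det_map_smult)
  then show "twist (\<lambda>v. det_map h *s h v) = h"
    using GammaL_det_map[OF h] by (simp add: twist_def fun_eq_iff)
  show "(\<lambda>v. det_map h *s h v) \<in> GammaL" using h by (intro smult_GammaL) (auto simp: GammaL_det_map)
qed

lemma indic_01: "indic B x = 0 \<or> indic B x = (1::'q)"
  by (simp add: indic_def)

lemma indic_image: "inj g \<Longrightarrow> indic (g ` B) (g x) = indic B x"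
  by (simp add: indic_def inj_image_mem_iff)

lemma blocksD:
  "B \<in> blocks v \<Longrightarrow> indic B a + indic B (a + x) + indic B (a + y) + indic B (a + x + y) = abs_tr (det3 v x y)"
  by (simp add: blocks_def)

text \<open>
  Determinants change by \<open>det_map g\<close>, which \<open>twist\<close> divides out, and by a field automorphism,
  which the trace does not see.
\<close>
lemma image_blocks_iff:
  assumes "g \<in> GammaL" shows "g ` B \<in> blocks (twist g v) \<longleftrightarrow> B \<in> blocks (v :: 'q^3)"
proof -
  obtain t where t: "t \<in> auts" "semilinear t g" and b: "bij g" using assms by (auto simp: GammaL_def)
  have i: "inj g" using b by (simp add: bij_def)
  have *: "(\<forall>x. P x) \<longleftrightarrow> (\<forall>x. P (g x))" for P using b by (metis bij_pointE)
  have "abs_tr (det3 (twist g v) (g x) (g y)) = abs_tr (det3 v x y)" for x y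
    using GammaL_det_map[OF assms]
    by (simp add: twist_def det3_smult semilinear_det[OF t(2,1)] mult.assoc[symmetric] auts_rules[OF t(1)])
  then show ?thesis
    unfolding blocks_def mem_Collect_eq
    by (subst *, subst (2) *, subst (3) *)
      (simp add: card_image[OF inj_on_subset[OF i subset_UNIV]] indic_image[OF i] flip: semilinear_add[OF t(2)])
qed

lemma image_blocks:
  assumes "g \<in> GammaL" shows "(\<lambda>B. g ` B) ` blocks v = blocks (twist g (v :: 'q^3))"
proof
  show "(\<lambda>B. g ` B) ` blocks v \<subseteq> blocks (twist g v)" using image_blocks_iff[OF assms] by auto
  show "blocks (twist g v) \<subseteq> (\<lambda>B. g ` B) ` blocks v"
  proof
    fix B' assume B': "B' \<in> blocks (twist g v)"
    have "B' = g ` (g -` B')" using assms by (simp add: GammaL_def bij_def surj_image_vimage_eq)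
    with B' show "B' \<in> (\<lambda>B. g ` B) ` blocks v" using image_blocks_iff[OF assms] by (metis image_eqI)
  qed
qed

lemma translate_blocks_iff: "(+) t ` B \<in> blocks v \<longleftrightarrow> B \<in> blocks (v :: 'q^3)"
proof -
  have i: "inj ((+) t)" by simp
  have s: "(\<forall>a. P a) \<longleftrightarrow> (\<forall>a. P (t + a))" for P by (metis vadd_self_left)
  show ?thesis unfolding blocks_def mem_Collect_eq
    by (subst s) (simp add: card_image add.assoc indic_image[OF i])
qed

lemma card_V: "CARD('q ^ 3) = 64"
  by (simp add: card4)

lemma card_compl: "card (- B) = 64 - card (B :: ('q^3) set)"
  unfolding Compl_eq_Diff_UNIV by (subst card_Diff_subset) (auto simp: card4)

lemma card_half:
  assumes "\<And>x. x + u \<in> B \<longleftrightarrow> x \<notin> (B :: ('q^3) set)" shows "card B = 32"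
proof -
  have "(\<lambda>x. x + u) ` B = - B"
  proof
    show "(\<lambda>x. x + u) ` B \<subseteq> - B" using assms by auto
    show "- B \<subseteq> (\<lambda>x. x + u) ` B"
    proof
      fix x assume "x \<in> - B"
      then have "x + u \<in> B" using assms by auto
      then show "x \<in> (\<lambda>x. x + u) ` B" by (intro image_eqI[of _ _ "x + u"]) (auto simp: add.assoc)
    qed
  qed
  moreover have "card ((\<lambda>x. x + u) ` B) = card B" by (intro card_image inj_onI) simp
  ultimately show ?thesis using card_compl[of B] card_mono[of UNIV B] card_V by auto
qed

lemma indic_eq_1: "indic B x = 1 \<longleftrightarrow> x \<in> (B :: ('q^3) set)"
  by (simp add: indic_def)

text \<open>
  The derivative of the indicator in a direction of the radical is constant. If it were 1,
  then a translation would interchange \<open>B\<close> with its complement, and \<open>B\<close> would have 32 elements.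
\<close>
lemma block_const:
  assumes B: "B \<in> blocks (v :: 'q^3)" shows "indic B (x + c *s v) = indic B x"
proof -
  let ?u = "c *s v"
  have *: "indic B (x + ?u) + indic B x = indic B ?u + indic B 0" for x
    using blocksD[OF B, of 0 x ?u] by (simp add: det3_smult add_eq_0 algebra_simps)
  have "indic B ?u + indic B 0 = 0"
  proof (rule ccontr)
    assume "indic B ?u + indic B 0 \<noteq> 0"
    then have "indic B ?u + indic B 0 = 1" using indic_01[of B ?u] indic_01[of B 0] by auto
    with * have "indic B (x + ?u) + indic B x = 1" for x by simp
    then have "x + ?u \<in> B \<longleftrightarrow> x \<notin> B" for x
      by (metis add_self indic_01 indic_eq_1 one_neq_zero add_0_right)
    then have "card B = 32" by (rule card_half)
    then show False using B by (simp add: blocks_def)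
  qed
  with *[of x] show ?thesis by (simp add: add_eq_0)
qed

lemma additive_abs_tr:
  assumes F: "\<And>s t. F (s + t) = F s + F (t::'q)" and F01: "\<And>s. F s = 0 \<or> F s = (1::'q)"
  shows "\<exists>\<alpha>. \<forall>s. F s = abs_tr (\<alpha> * s)"
proof -
  have 0: "F 0 = 0" using F[of 0 0] by simp
  have 3: "F (omega + 1) = F omega + F 1" by (rule F)
  have "\<exists>\<alpha>. F 1 = abs_tr \<alpha> \<and> F omega = abs_tr (\<alpha> * omega)"
    unfolding ex4 using F01[of 1] F01[of omega] by (auto simp: algebra_simps)
  then obtain \<alpha> where a: "F 1 = abs_tr \<alpha>" "F omega = abs_tr (\<alpha> * omega)" by blast
  have "F s = abs_tr (\<alpha> * s)" for s
    using cases4[of s] by (auto simp: 0 3 a distrib_left abs_tr_add)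
  then show ?thesis by blast
qed

text \<open>
  Every additive functional that vanishes on the radical of the alternating form is
  represented by it.
\<close>
lemma additive_abs_tr_det:
  assumes v: "v \<noteq> (0::'q^3)"
    and L: "\<And>x y. L (x + y) = L x + L y" and L01: "\<And>x. L x = 0 \<or> L x = (1::'q)"
    and Lv: "\<And>c. L (c *s v) = 0"
  shows "\<exists>w. \<forall>z. L z = abs_tr (det3 v w z)"
proof -
  obtain x y where d: "det3 v x y = 1" using ex_det1[OF v] by blast
  obtain \<alpha> where \<alpha>: "\<And>s. L (s *s x) = abs_tr (\<alpha> * s)"
    using additive_abs_tr[of "\<lambda>s. L (s *s x)"] L L01 by (auto simp: vec.scale_left_distrib)
  obtain \<beta> where \<beta>: "\<And>s. L (s *s y) = abs_tr (\<beta> * s)"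
    using additive_abs_tr[of "\<lambda>s. L (s *s y)"] L L01 by (auto simp: vec.scale_left_distrib)
  have "L z = abs_tr (det3 v (\<beta> *s x + \<alpha> *s y) z)" for z
  proof -
    have "z = det3 z x y *s v + det3 v z y *s x + det3 v x z *s y"
      using cramer[of v x y z] d by simp
    then have "L z = L (det3 z x y *s v + det3 v z y *s x + det3 v x z *s y)" by simp
    also have "\<dots> = abs_tr (\<alpha> * det3 v z y) + abs_tr (\<beta> * det3 v x z)"
      by (simp add: L Lv \<alpha> \<beta>)
    also have "\<dots> = abs_tr (det3 v (\<beta> *s x + \<alpha> *s y) z)"
      by (simp add: det3_add det3_smult det3_swap(2)[of v z y] abs_tr_add add.commute)
    finally show ?thesis .
  qed
  then show ?thesis by blast
qed

lemma indic_polar: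
  assumes "B \<in> blocks (v :: 'q^3)"
  shows "indic B (x + y) = indic B x + indic B y + indic B 0 + abs_tr (det3 v x y)"
  unfolding blocksD[OF assms, of 0 x y, symmetric] by (simp add: algebra_simps)

text \<open>
  The indicators have the same polar form, so they differ by an affine function. Its linear
  part vanishes on the radical and is therefore the effect of a translation. The constant
  that is left over would replace a set of size 24 by one of size 40.
\<close>
lemma block_translate:
  assumes v: "v \<noteq> (0::'q^3)" and B: "B \<in> blocks v" and C: "C \<in> blocks v"
  shows "\<exists>t. C = (+) t ` B"
proof -
  define L where "L x = indic B x + indic C x + (indic B 0 + indic C 0)" for x
  have 1: "L (x + y) = L x + L y" for x y
    by (simp add: L_def indic_polar[OF B] indic_polar[OF C] algebra_simps)
  have 2: "L x = 0 \<or> L x = 1" for x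
    using indic_01[of B x] indic_01[of C x] indic_01[of B 0] indic_01[of C 0] by (auto simp: L_def)
  have 3: "L (c *s v) = 0" for c
    using block_const[OF B, of 0 c] block_const[OF C, of 0 c] by (simp add: L_def)
  obtain w where w: "\<And>z. L z = abs_tr (det3 v w z)" using additive_abs_tr_det[OF v 1 2 3] by blast
  define k where "k = indic B w + indic C 0"
  have *: "indic C z = indic B (w + z) + k" for z
  proof -
    have "indic C z = L z + indic B z + indic B 0 + indic C 0"
      by (simp add: L_def algebra_simps)
    also have "\<dots> = indic B (w + z) + k"
      by (simp add: w indic_polar[OF B, of w z] k_def algebra_simps)
    finally show ?thesis .
  qed
  have cB: "card B = 24" "card C = 24" using B C by (auto simp: blocks_def)
  have mem: "z \<in> (+) w ` X \<longleftrightarrow> w + z \<in> X" for z X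
    by (metis (no_types) image_iff vadd_self_left)
  have "k = 0"
  proof (rule ccontr)
    assume "k \<noteq> 0"
    then have "k = 1" unfolding k_def using indic_01[of B w] indic_01[of C 0] by auto
    with * have "indic C z = indic B (w + z) + 1" for z by simp
    then have "z \<in> C \<longleftrightarrow> w + z \<notin> B" for z
      by (metis add_self indic_01 indic_eq_1 one_neq_zero add_0_left)
    then have "C = - ((+) w ` B)" by (auto simp: mem)
    then have "card C = 64 - card ((+) w ` B)" by (simp only: card_compl)
    then show False using cB by (simp add: card_image)
  qed
  with * have "z \<in> C \<longleftrightarrow> z \<in> (+) w ` B" for z
    by (metis add_0_right indic_eq_1 mem)
  then show ?thesis by blast
qed

end

section \<open>Maximal arcs and alternating forms\<close>

lemma Union_translate: "\<Union> (translate t A) = (+) t ` \<Union> A"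
  by (auto simp: translate_def)

context gf4
begin

lemma pow4_left: "(z::'q) * (z * (z * (z * x))) = z * x"
  by (metis mult.assoc pow4)

lemma abs_tr_eq_01: "abs_tr z = (0::'q) \<longleftrightarrow> z = 0 \<or> z = 1" "abs_tr z = (1::'q) \<longleftrightarrow> z = omega \<or> z = omega + 1"
    "1 + abs_tr z = 0 \<longleftrightarrow> z = omega \<or> z = omega + 1" "1 + abs_tr z = 1 \<longleftrightarrow> z = 0 \<or> z = 1"
  using cases4[of z] by auto

lemma vadd_shift: "x + y = (z::'q^3) \<longleftrightarrow> x = z + y"
  by (auto simp: add.assoc)

lemma ray_add: "x \<in> ray v \<Longrightarrow> y \<in> ray v \<Longrightarrow> x + y \<in> ray (v :: 'q^3)"
proof -
  assume "x \<in> ray v" "y \<in> ray v"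
  then obtain a b where "x = a *s v" "y = b *s v" by (auto simp: ray_def)
  then have "x + y = (a + b) *s v" by (simp add: vec.scale_left_distrib)
  then show ?thesis unfolding ray_def by blast
qed

lemma ray_smult: "x \<in> ray v \<Longrightarrow> c *s x \<in> ray (v :: 'q^3)"
  by (auto simp: ray_def)

lemma ray_0 [simp]: "0 \<in> ray (v :: 'q^3)"
  unfolding ray_def by (rule image_eqI[of _ _ 0]) auto

lemma ray_self [simp]: "v \<in> ray (v :: 'q^3)"
  unfolding ray_def by (rule image_eqI[of _ _ 1]) auto

lemma mem_coset: "x \<in> coset (ray v) p \<longleftrightarrow> p + x \<in> ray (v :: 'q^3)"
  unfolding coset_def by (metis (no_types) image_iff vadd_self_left)

lemma coset_eq: "coset (ray v) p = coset (ray v) q \<longleftrightarrow> p + q \<in> ray (v :: 'q^3)"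
proof
  assume e: "coset (ray v) p = coset (ray v) q"
  have "q \<in> coset (ray v) q" by (simp add: mem_coset)
  then show "p + q \<in> ray v" unfolding e[symmetric] mem_coset .
next
  assume a: "p + q \<in> ray v"
  have "q + x = (p + q) + (p + x)" "p + x = (p + q) + (q + x)" for x by (simp_all add: algebra_simps)
  then show "coset (ray v) p = coset (ray v) q" using a ray_add by (metis mem_coset set_eqI)
qed

lemma coset_line_inj:
  assumes d: "d \<notin> ray (v :: 'q^3)" shows "inj (\<lambda>c. coset (ray v) (p + c *s d))"
proof (rule injI)
  fix a b assume "coset (ray v) (p + a *s d) = coset (ray v) (p + b *s d)"
  then have 1: "(a + b) *s d \<in> ray v"
    by (simp add: coset_eq vec.scale_left_distrib algebra_simps)
  have "a + b = 0"
  proof (rule ccontr)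
    assume "a + b \<noteq> 0"
    then have "d = inverse (a + b) *s ((a + b) *s d)"
      by (simp only: vec.scale_scale left_inverse vec.scale_one not_False_eq_True)
    then have "d \<in> ray v" by (rule ssubst) (rule ray_smult[OF 1])
    with d show False by contradiction
  qed
  then show "a = b" by (simp add: add_eq_0)
qed

lemma mem_Union_class:
  assumes "A \<subseteq> parallel_class (ray (v :: 'q^3))"
  shows "x \<in> \<Union> A \<longleftrightarrow> coset (ray v) x \<in> A"
proof
  assume "x \<in> \<Union> A"
  then obtain p where "coset (ray v) p \<in> A" "x \<in> coset (ray v) p"
    using assms by (auto simp: parallel_class_def)
  then show "coset (ray v) x \<in> A" by (metis coset_eq mem_coset)
next
  assume "coset (ray v) x \<in> A"
  moreover have "x \<in> coset (ray v) x" by (simp add: mem_coset)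
  ultimately show "x \<in> \<Union> A" by blast
qed

lemma card_coset: "v \<noteq> 0 \<Longrightarrow> card (coset (ray v) (p :: 'q^3)) = 4"
proof -
  assume "v \<noteq> 0"
  then have "inj (\<lambda>c. c *s v)" by (auto intro!: injI simp: vec.scale_right_imp_eq)
  then have "card (ray v) = 4" unfolding ray_def by (simp add: card_image card4)
  then show ?thesis unfolding coset_def by (subst card_image) auto
qed

lemma card_Union_class:
  assumes "A \<subseteq> parallel_class (ray (v :: 'q^3))" "v \<noteq> 0"
  shows "card (\<Union> A) = 4 * card A"
proof -
  have "pairwise disjnt A"
  proof (rule pairwiseI)
    fix C D assume "C \<in> A" "D \<in> A" "C \<noteq> D"
    then have "C \<in> parallel_class (ray v)" "D \<in> parallel_class (ray v)" using assms by auto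
    then obtain p q where pq: "C = coset (ray v) p" "D = coset (ray v) q"
      unfolding parallel_class_def by blast
    show "disjnt C D"
    proof (rule ccontr)
      assume "\<not> disjnt C D"
      then obtain x where "x \<in> C" "x \<in> D" by (auto simp: disjnt_iff)
      then have "coset (ray v) p = coset (ray v) x" "coset (ray v) q = coset (ray v) x"
        by (simp_all add: pq coset_eq mem_coset)
      then show False using \<open>C \<noteq> D\<close> pq by simp
    qed
  qed
  then have "card (\<Union> A) = sum card A" by (intro card_Union_disjoint) auto
  also have "\<dots> = (\<Sum>C\<in>A. 4)"
    using assms by (intro sum.cong) (auto simp: parallel_class_def card_coset)
  finally show ?thesis by simp
qed

text \<open>
  On four points there is one linear condition for being affine over the prime field, namely
  even parity.
\<close>
lemma line4_affine:
  assumes G: "\<And>t. G t = 0 \<or> G t = (1::'q)" and s: "G 0 + (G 1 + (G omega + G (omega + 1))) = 0"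
  shows "\<exists>\<beta>. \<forall>t. G t = G 0 + abs_tr (\<beta> * t)"
proof -
  have "\<exists>\<beta>. G 1 = G 0 + abs_tr \<beta> \<and> G omega = G 0 + abs_tr (\<beta> * omega)"
    unfolding ex4 using G[of 0] G[of 1] G[of omega] by (auto simp: algebra_simps)
  then obtain \<beta> where b: "G 1 = G 0 + abs_tr \<beta>" "G omega = G 0 + abs_tr (\<beta> * omega)" by blast
  have "G (omega + 1) = G 0 + (G 1 + G omega)" using s
    by (metis add.assoc add_eq_0)
  then have "G t = G 0 + abs_tr (\<beta> * t)" for t
    using cases4[of t] by (auto simp: b distrib_left abs_tr_add add.assoc add.commute add.left_commute)
  then show ?thesis by blast
qed

text \<open>
  Functions on the affine plane with even sum on every line are quadratic of a special
  shape. The vertical lines make \<open>F s\<close> affine with some slope \<open>b s\<close>. The other lines say that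
  \<open>b s\<close> and \<open>b s * s\<close> sum to 0, which kills the coefficients of \<open>s ^ 3\<close> and \<open>s ^ 2\<close> in \<open>b\<close>, regarded
  as a polynomial.
\<close>
lemma plane_normal_form:
  fixes F :: "'q \<Rightarrow> 'q \<Rightarrow> 'q"
  assumes F01: "\<And>s t. F s t = 0 \<or> F s t = 1"
    and lines: "\<And>s t a b. (\<Sum>c\<in>UNIV. F (s + c * a) (t + c * b)) = 0"
  shows "\<exists>k \<alpha> \<beta> \<kappa>. \<forall>s t. F s t = k + abs_tr (\<alpha> * s) + abs_tr (\<beta> * t) + abs_tr (\<kappa> * (s * t))"
proof -
  have "\<exists>\<beta>. \<forall>t. F s t = F s 0 + abs_tr (\<beta> * t)" for s
    using lines[of s 0 0 1] F01 by (intro line4_affine) (auto simp: sum4)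
  then obtain b where b: "\<And>s t. F s t = F s 0 + abs_tr (b s * t)" by metis
  have L: "(\<Sum>s\<in>UNIV. F s 0) + (\<Sum>s\<in>UNIV. abs_tr (b s * (n + s * m))) = 0" for m n
  proof -
    have "(\<Sum>c\<in>UNIV. F (0 + c * 1) (n + c * m)) = 0" by (rule lines)
    also have "(\<Sum>c\<in>UNIV. F (0 + c * 1) (n + c * m)) = (\<Sum>c\<in>UNIV. F c 0 + abs_tr (b c * (n + c * m)))"
      by (intro sum.cong refl) (simp only: add_0_left mult_1_right b[of _ "n + _ * m"])
    finally show ?thesis by (simp add: sum.distrib)
  qed
  have L0: "(\<Sum>s\<in>UNIV. F s 0) = 0" using L[of 0 0] by simp
  then have "\<exists>\<alpha>. \<forall>s. F s 0 = F 0 0 + abs_tr (\<alpha> * s)"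
    using F01 by (intro line4_affine) (auto simp: sum4)
  then obtain \<alpha> where \<alpha>: "\<And>s. F s 0 = F 0 0 + abs_tr (\<alpha> * s)" by blast
  have abs_tr_sum: "abs_tr (\<Sum>s\<in>(UNIV::'q set). f s) = (\<Sum>s\<in>UNIV. abs_tr (f s))" for f :: "'q \<Rightarrow> 'q"
    by (simp add: sum4 abs_tr_add)
  have "abs_tr (n * (\<Sum>s\<in>UNIV. b s)) = 0" for n
    using L[where n=n and m=0] L0 by (simp add: abs_tr_sum sum_distrib_left mult.commute)
  then have S1: "(\<Sum>s\<in>UNIV. b s) = 0" by (rule abs_tr_all0)
  have "abs_tr (m * (\<Sum>s\<in>UNIV. b s * s)) = 0" for m
    using L[where n=0 and m=m] L0 by (simp add: abs_tr_sum sum_distrib_left mult.commute mult.left_commute)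
  then have S2: "(\<Sum>s\<in>UNIV. b s * s) = 0" by (rule abs_tr_all0)
  define \<kappa> where "\<kappa> = b 0 + b 1"
  have e2: "b (omega + 1) = b 0 + b 1 + b omega" using S1
    by (simp add: sum4) (metis add.assoc add_eq_0)
  have "b omega = b 0 + omega * \<kappa>"
  proof -
    have "b 1 + (b omega * omega + (b 0 + b 1 + b omega) * (omega + 1)) = 0"
      using S2 unfolding sum4 e2 by simp
    then have "b omega + (b 0 + omega * \<kappa>) = 0"
      by (simp add: \<kappa>_def algebra_simps)
    then show ?thesis by (simp only: add_eq_0)
  qed
  then have bs: "b s = b 0 + \<kappa> * s" for s
    using cases4[of s] e2 by (auto simp: \<kappa>_def algebra_simps)
  have "F s t = F 0 0 + abs_tr (\<alpha> * s) + abs_tr (b 0 * t) + abs_tr (\<kappa> * (s * t))" for s t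
    by (subst b, subst \<alpha>, subst bs) (simp add: algebra_simps abs_tr_add)
  then show ?thesis by blast
qed

text \<open>
  With respect to a unimodular basis \<open>v\<close>, \<open>p\<close>, \<open>q\<close>, the coordinates modulo \<open>v\<close> are \<open>det3 v z q\<close> and
  \<open>det3 v p z\<close>.
\<close>
lemma coord:
  assumes "det3 v p q = (1::'q)"
  shows "z + (det3 v z q *s p + det3 v p z *s q) = det3 z p q *s v"
proof -
  have "z = det3 z p q *s v + (det3 v z q *s p + det3 v p z *s q)"
    using cramer[of v p q z] assms by (simp add: add.assoc)
  then have "z + (det3 v z q *s p + det3 v p z *s q) =
      (det3 z p q *s v + (det3 v z q *s p + det3 v p z *s q)) + (det3 v z q *s p + det3 v p z *s q)"
    by simp
  then show ?thesis by (simp only: add.assoc vadd_self add_0_right)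
qed

lemma abs_tr_eq_coord:
  assumes d: "det3 v p q = (1::'q)"
  shows "det3 v x y = det3 v x q * det3 v p y + det3 v y q * det3 v p x"
proof -
  have "x = det3 x p q *s v + det3 v x q *s p + det3 v p x *s q"
    using cramer[of v p q x] d by simp
  then have "det3 v x y = det3 v (det3 x p q *s v + det3 v x q *s p + det3 v p x *s q) y" by simp
  also have "\<dots> = det3 v x q * det3 v p y + det3 v p x * det3 v q y"
    by (simp add: det3_add det3_smult)
  finally show ?thesis by (simp add: det3_swap(2)[of v q y] mult.commute)
qed

text \<open>
  Lines of the quotient meet the arc in 0 or 2 points; lines in the direction \<open>v\<close> lie inside
  or outside of the union altogether.
\<close>
lemma line_sums:
  assumes m: "maximal_arc (ray v) A"
  shows "(\<Sum>c\<in>UNIV. indic (\<Union> A) (p + c *s d)) = (0::'q)"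
proof -
  have A: "A \<subseteq> parallel_class (ray v)" using m by (simp add: maximal_arc_def)
  show ?thesis
  proof (cases "d \<in> ray v")
    case True
    have "indic (\<Union> A) (p + c *s d) = indic (\<Union> A) p" for c
    proof -
      have "coset (ray v) (p + c *s d) = coset (ray v) p"
        using ray_smult[OF True, of c] by (simp add: coset_eq algebra_simps)
      then show ?thesis by (simp add: indic_def mem_Union_class[OF A] del: Union_iff)
    qed
    then have "(\<Sum>c\<in>UNIV. indic (\<Union> A) (p + c *s d)) = (\<Sum>c\<in>(UNIV::'q set). indic (\<Union> A) p)"
      by (intro sum.cong refl)
    then show ?thesis by (simp only: sum4 add_self add_self_left)
  next
    case False
    define L where "L = (\<lambda>c. coset (ray v) (p + c *s d))"
    have inj: "inj L" unfolding L_def by (rule coset_line_inj[OF False])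
    have "range L \<in> quotient_lines (ray v)" using False by (auto simp: quotient_lines_def L_def)
    then have c: "card (A \<inter> range L) = 0 \<or> card (A \<inter> range L) = 2"
      using m by (simp add: maximal_arc_def)
    have "A \<inter> range L = L ` {c. L c \<in> A}" by auto
    then have "card (A \<inter> range L) = card {c. L c \<in> A}"
      using inj by (metis card_image inj_on_subset subset_UNIV)
    moreover have "(\<Sum>c\<in>UNIV. indic (\<Union> A) (p + c *s d)) = (\<Sum>c\<in>UNIV. if L c \<in> A then 1 else 0)"
      by (simp add: indic_def mem_Union_class[OF A] L_def del: Union_iff)
    moreover have "\<dots> = of_nat (card {c. L c \<in> A})"
      by (subst sum.inter_filter[symmetric]) auto
    ultimately show ?thesis using c by (auto simp del: of_nat_eq_0_iff)
  qed
qed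

text \<open>An affine function over the prime field has 0, 32 or 64 ones.\<close>
lemma no_affine_block: "blocks (0 :: 'q^3) = {}"
proof (rule ccontr)
  assume "blocks (0 :: 'q^3) \<noteq> {}"
  then obtain B :: "('q^3) set" where B: "B \<in> blocks 0" by blast
  then have c: "card B = 24" by (simp add: blocks_def)
  have p: "indic B (x + y) = indic B x + indic B y + indic B 0" for x y
    using indic_polar[OF B] by simp
  show False
  proof (cases "\<exists>u. indic B u + indic B 0 = 1")
    case True
    then obtain u where "indic B u + indic B 0 = 1" by blast
    then have "indic B (x + u) = indic B x + 1" for x using p[of x u] by (simp add: add.assoc)
    then have "x + u \<in> B \<longleftrightarrow> x \<notin> B" for x
      by (metis add_self add_0_left indic_01 indic_eq_1 one_neq_zero)
    then show False using card_half[of u B] c by simp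
  next
    case False
    then have "indic B u = indic B 0" for u
      using indic_01[of B u] indic_01[of B 0] by auto
    then have "B = {} \<or> B = UNIV" by (metis (no_types) indic_eq_1 UNIV_eq_I equals0I)
    then show False using c by (auto simp: card4)
  qed
qed

text \<open>
  The normal form of the indicator in coordinates modulo \<open>v\<close> has polar form
  \<open>abs_tr (\<kappa> * (s * t' + s' * t))\<close>, and \<open>s * t' + s' * t\<close> is the determinant with \<open>v\<close>.
\<close>
lemma arc_block:
  assumes v: "v \<noteq> 0" and m: "maximal_arc (ray v) A"
  shows "\<exists>w. w \<in> ray v \<and> w \<noteq> 0 \<and> \<Union> A \<in> blocks (w :: 'q^3)"
proof -
  have A: "A \<subseteq> parallel_class (ray v)" "card A = 6" using m by (auto simp: maximal_arc_def)
  let ?B = "\<Union> A"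
  obtain p q where d: "det3 v p q = 1" using ex_det1[OF v] by blast
  define F where "F s t = indic ?B (s *s p + t *s q)" for s t
  have "(\<Sum>c\<in>UNIV. F (s + c * a) (t + c * b)) = 0" for s t a b
  proof -
    have "(s + c * a) *s p + (t + c * b) *s q = (s *s p + t *s q) + c *s (a *s p + b *s q)" for c
      by (simp add: vec.scale_left_distrib vec.scale_right_distrib algebra_simps)
    then show ?thesis unfolding F_def by (simp only: line_sums[OF m])
  qed
  moreover have "F s t = 0 \<or> F s t = 1" for s t by (simp add: F_def indic_01)
  ultimately obtain k \<alpha> \<beta> \<kappa>
    where F: "\<And>s t. F s t = k + abs_tr (\<alpha> * s) + abs_tr (\<beta> * t) + abs_tr (\<kappa> * (s * t))"
    using plane_normal_form[of F] by blast
  have iB: "indic ?B z = F (det3 v z q) (det3 v p z)" for z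
  proof -
    have "z + (det3 v z q *s p + det3 v p z *s q) = det3 z p q *s v"
      by (rule coord[OF d])
    then have "coset (ray v) z = coset (ray v) (det3 v z q *s p + det3 v p z *s q)"
      by (simp add: coset_eq ray_smult)
    then show ?thesis by (simp add: F_def indic_def mem_Union_class[OF A(1)] del: Union_iff)
  qed
  have "?B \<in> blocks (\<kappa> *s v)"
    unfolding blocks_def
  proof (intro CollectI conjI allI)
    show "card ?B = 24" using card_Union_class[OF A(1) v] A(2) by simp
    show "indic ?B a + indic ?B (a + x) + indic ?B (a + y) + indic ?B (a + x + y) = abs_tr (det3 (\<kappa> *s v) x y)"
      for a x y
      unfolding iB F det3_smult abs_tr_eq_coord[OF d, of x y]
      by (simp add: det3_add algebra_simps abs_tr_add)
  qed
  moreover have "\<kappa> *s v \<noteq> 0" using calculation no_affine_block by (metis empty_iff)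
  ultimately show ?thesis by (metis ray_self ray_smult)
qed

lemma arc_translates:
  assumes "w \<noteq> 0" "\<Union> A \<in> blocks (w :: 'q^3)"
  shows "range (\<lambda>t. \<Union> (translate t A)) = blocks w"
proof
  show "range (\<lambda>t. \<Union> (translate t A)) \<subseteq> blocks w"
    using assms(2) by (auto simp del: Union_iff simp: Union_translate translate_blocks_iff)
  show "blocks w \<subseteq> range (\<lambda>t. \<Union> (translate t A))"
    using block_translate[OF assms] unfolding Union_translate by blast
qed

lemma arc_points:
  "{(s, t). abs_tr (s * t) = (1::'q)} = {(1,omega),(1,omega+1),(omega,1),(omega,omega),(omega+1,1),(omega+1,omega+1)}"
proof -
  have "abs_tr (s * t) = (1::'q) \<longleftrightarrow> (s, t) \<in> {(1,omega),(1,omega+1),(omega,1),(omega,omega),(omega+1,1),(omega+1,omega+1)}" for s t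
    using cases4[of s] cases4[of t]
    by (elim disjE; simp add: distrib_left distrib_right add.assoc)
  then show ?thesis by auto
qed

text \<open>
  In coordinates modulo \<open>w\<close> the arc is given by \<open>abs_tr (s * t) = 1\<close>. Along a line with
  parameter \<open>c\<close> the left-hand side becomes \<open>abs_tr (s * t) + abs_tr (c * \<mu>)\<close>. This is 1 for two
  values of \<open>c\<close> if \<open>\<mu> \<noteq> 0\<close>; otherwise \<open>s * t\<close> has the form \<open>u * u + u\<close> and the trace is 0 on the whole
  line.
\<close>
lemma ex_arc:
  assumes w: "w \<noteq> (0 :: 'q^3)"
  shows "\<exists>A. maximal_arc (ray w) A \<and> \<Union> A \<in> blocks w"
proof -
  obtain p q where d: "det3 w p q = 1" using ex_det1[OF w] by blast
  define B where "B = {z. abs_tr (det3 w z q * det3 w p z) = 1}"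
  define A where "A = coset (ray w) ` B"
  have A: "A \<subseteq> parallel_class (ray w)" by (auto simp: A_def parallel_class_def)
  have Bc: "z + z' \<in> ray w \<Longrightarrow> z \<in> B \<Longrightarrow> z' \<in> B" for z z'
  proof -
    assume "z + z' \<in> ray w" "z \<in> B"
    then obtain c where "z + z' = c *s w" by (auto simp: ray_def)
    then have "z' = z + c *s w" by (metis vadd_self_left)
    then show "z' \<in> B" using \<open>z \<in> B\<close> by (simp add: B_def det3_add det3_smult)
  qed
  have memA: "coset (ray w) z \<in> A \<longleftrightarrow> z \<in> B" for z
    unfolding A_def using Bc by (auto simp: coset_eq add.commute)
  then have UA: "\<Union> A = B" using mem_Union_class[OF A] by blast
  have dq: "det3 w (s *s p + t *s q) q = s" "det3 w p (s *s p + t *s q) = t" for s t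
    using d by (simp_all add: det3_add det3_smult)
  have "A = (\<lambda>(s, t). coset (ray w) (s *s p + t *s q)) ` {(s, t). abs_tr (s * t) = 1}"
  proof
    show "A \<subseteq> (\<lambda>(s, t). coset (ray w) (s *s p + t *s q)) ` {(s, t). abs_tr (s * t) = 1}"
    proof
      fix C assume "C \<in> A"
      then obtain z where z: "z \<in> B" "C = coset (ray w) z" by (auto simp: A_def)
      have "z + (det3 w z q *s p + det3 w p z *s q) = det3 z p q *s w"
        by (rule coord[OF d])
      then have "C = coset (ray w) (det3 w z q *s p + det3 w p z *s q)"
        using z by (simp add: coset_eq ray_smult)
      then show "C \<in> (\<lambda>(s, t). coset (ray w) (s *s p + t *s q)) ` {(s, t). abs_tr (s * t) = 1}"
        using z by (intro image_eqI[of _ _ "(det3 w z q, det3 w p z)"]) (auto simp: B_def)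
    qed
    show "(\<lambda>(s, t). coset (ray w) (s *s p + t *s q)) ` {(s, t). abs_tr (s * t) = 1} \<subseteq> A"
      by (auto simp: memA B_def dq)
  qed
  moreover have "inj_on (\<lambda>(s, t). coset (ray w) (s *s p + t *s q)) X" for X
  proof (rule inj_onI, clarify)
    fix s t s' t'
    assume "coset (ray w) (s *s p + t *s q) = coset (ray w) (s' *s p + t' *s q)"
    then have "(s *s p + t *s q) + (s' *s p + t' *s q) \<in> ray w" by (simp only: coset_eq)
    then obtain c where "(s *s p + t *s q) + (s' *s p + t' *s q) = c *s w"
      unfolding ray_def by blast
    then have "s *s p + t *s q = c *s w + (s' *s p + t' *s q)" by (rule vadd_shift[THEN iffD1])
    then have "det3 w (s *s p + t *s q) q = det3 w (c *s w + (s' *s p + t' *s q)) q"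
      "det3 w p (s *s p + t *s q) = det3 w p (c *s w + (s' *s p + t' *s q))" by simp_all
    then show "s = s' \<and> t = t'" using d by (simp add: det3_add det3_smult)
  qed
  ultimately have c6: "card A = 6"
    by (simp add: card_image) (simp add: arc_points)
  have "B \<in> blocks w"
    unfolding blocks_def
  proof (intro CollectI conjI allI)
    show "card B = 24" using card_Union_class[OF A w] c6 UA by simp
    have i: "indic B z = abs_tr (det3 w z q * det3 w p z)" for z
      using abs_tr_01[of "det3 w z q * det3 w p z"] by (auto simp: indic_def B_def)
    show "indic B a + indic B (a + x) + indic B (a + y) + indic B (a + x + y) = abs_tr (det3 w x y)" for a x y
      unfolding i abs_tr_eq_coord[OF d, of x y]
      by (simp add: det3_add algebra_simps abs_tr_add)
  qed
  moreover have "maximal_arc (ray w) A"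
    unfolding maximal_arc_def
  proof (intro conjI ballI A c6)
    fix m assume "m \<in> quotient_lines (ray w)"
    then obtain r e where m: "m = range (\<lambda>c. coset (ray w) (r + c *s e))" and e: "e \<notin> ray w"
      by (auto simp: quotient_lines_def)
    define s t a b where "s = det3 w r q" and "t = det3 w p r"
      and "a = det3 w e q" and "b = det3 w p e"
    have "\<not> (a = 0 \<and> b = 0)"
    proof
      assume "a = 0 \<and> b = 0"
      then have "e = det3 e p q *s w" using cramer[of w p q e] d by (simp add: a_def b_def)
      then show False using e by (metis ray_self ray_smult)
    qed
    then have ne: "a \<noteq> 0 \<or> b \<noteq> 0" by blast
    \<comment> \<open>The coefficient of \<open>c\<close> under the trace, which does not distinguish \<open>c * c * (a * b)\<close> from its square.\<close>
    define \<mu> where "\<mu> = a * t + b * s + (a * b) * (a * b)"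
    have K: "abs_tr ((s + c * a) * (t + c * b)) = abs_tr (s * t) + abs_tr (c * \<mu>)" for c
    proof -
      have "abs_tr ((c * c) * (a * b)) = abs_tr (frob ((c * c) * (a * b)))" by (simp only: abs_tr_frob)
      also have "frob ((c * c) * (a * b)) = c * ((a * b) * (a * b))"
      proof -
        have "(c * c) * (c * c) = c" using pow4[of c] by (simp only: mult.assoc)
        then show ?thesis by (simp only: frob_mult[of "c * c" "a * b"]) (simp only: frob_def)
      qed
      finally show ?thesis by (simp add: \<mu>_def algebra_simps abs_tr_add)
    qed
    have "A \<inter> m = (\<lambda>c. coset (ray w) (r + c *s e)) ` {c. r + c *s e \<in> B}"
      unfolding m using memA by auto
    moreover have "inj (\<lambda>c. coset (ray w) (r + c *s e))" by (rule coset_line_inj[OF e])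
    ultimately have "card (A \<inter> m) = card {c. r + c *s e \<in> B}"
      by (metis card_image inj_on_subset subset_UNIV)
    also have "{c. r + c *s e \<in> B} = {c. abs_tr ((s + c * a) * (t + c * b)) = 1}"
      by (simp add: B_def det3_add det3_smult s_def t_def a_def b_def)
    also have "{c. abs_tr ((s + c * a) * (t + c * b)) = 1} = {c. abs_tr (s * t) + abs_tr (c * \<mu>) = 1}"
      unfolding K ..
    also have "card \<dots> = 0 \<or> card \<dots> = 2"
    proof (cases "\<mu> = 0")
      case True
      then have "abs_tr (s * t) = 0"
        using ne unfolding \<mu>_def
      proof (elim disjE)
        assume h: "a * t + b * s + (a * b) * (a * b) = 0" and "a \<noteq> 0"
        then have "s * t = a * (a * a) * (s * t)" using cube1[of a] by simp
        also have "\<dots> = a * a * s * (a * t)" by (simp only: ac_simps)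
        also have "a * t = b * s + (a * b) * (a * b)" using h by (simp only: add.assoc add_eq_0)
        also have "a * a * s * \<dots> = frob (a * b * b * s) + a * b * b * s"
          by (simp add: frob_def algebra_simps pow4_left)
        finally show ?thesis by (simp only: abs_tr_add abs_tr_frob add_self)
      next
        assume h: "a * t + b * s + (a * b) * (a * b) = 0" and "b \<noteq> 0"
        then have "s * t = b * (b * b) * (s * t)" using cube1[of b] by simp
        also have "\<dots> = b * b * t * (b * s)" by (simp only: ac_simps)
        also have "b * s = a * t + (a * b) * (a * b)"
          using h by (simp only: add.commute[of "a * t"] add.assoc add_eq_0)
        also have "b * b * t * \<dots> = frob (a * a * b * t) + a * a * b * t"
          by (simp add: frob_def algebra_simps pow4_left)
        finally show ?thesis by (simp only: abs_tr_add abs_tr_frob add_self)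
      qed
      then show ?thesis using True by simp
    next
      case False
      have "{c. abs_tr (s * t) + abs_tr (c * \<mu>) = 1} = (\<lambda>c. c * inverse \<mu>) ` {c. abs_tr (s * t) + abs_tr c = 1}"
      proof (intro set_eqI iffI)
        fix c assume "c \<in> {c. abs_tr (s * t) + abs_tr (c * \<mu>) = 1}"
        then show "c \<in> (\<lambda>c. c * inverse \<mu>) ` {c. abs_tr (s * t) + abs_tr c = 1}"
          using False by (intro image_eqI[of _ _ "c * \<mu>"]) auto
      qed (use False in \<open>auto simp: mult.assoc\<close>)
      moreover have "card ((\<lambda>c. c * inverse \<mu>) ` {c. abs_tr (s * t) + abs_tr c = 1}) = card {c. abs_tr (s * t) + abs_tr c = 1}"
        using False by (intro card_image inj_onI) simp
      moreover have "{c. abs_tr (s * t) + abs_tr c = 1} = (if abs_tr (s * t) = 0 then {omega, omega + 1} else {0, 1})"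
        using abs_tr_01[of "s * t"] by (auto simp: abs_tr_eq_01)
      ultimately show ?thesis by simp
    qed
    finally show "card (A \<inter> m) = 0 \<or> card (A \<inter> m) = 2" .
  qed
  ultimately show ?thesis using UA by auto
qed

end

section \<open>Transversals, designs and even quadruples\<close>

text \<open>
  A transversal chooses one of the three nonzero vectors on each one-dimensional subspace,
  that is, one of the three translation classes of maximal arcs for each direction.
\<close>
definition transversal :: "('a::field ^ 3) set \<Rightarrow> bool" where
  "transversal S \<longleftrightarrow> 0 \<notin> S \<and> (\<forall>x. x \<noteq> 0 \<longrightarrow> (\<exists>!c. c \<noteq> 0 \<and> c *s x \<in> S))"

definition blocks_over :: "('a::field ^ 3) set \<Rightarrow> ('a ^ 3) set set" where
  "blocks_over S = (\<Union>v\<in>S. blocks v)"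

definition design_of :: "('a::field ^ 3) set \<Rightarrow> ('a ^ 3) design" where
  "design_of S = (UNIV, blocks_over S)"

text \<open>Orthogonality with respect to the trace form.\<close>
definition annih :: "('a::field ^ 3) set \<Rightarrow> 'a ^ 3 \<Rightarrow> bool" where
  "annih S w \<longleftrightarrow> (\<forall>v\<in>S. abs_tr (dotp v w) = 0)"

definition even4 :: "('a::field ^ 3) set \<Rightarrow> 'a ^ 3 \<Rightarrow> 'a ^ 3 \<Rightarrow> 'a ^ 3 \<Rightarrow> 'a ^ 3 \<Rightarrow> bool" where
  "even4 S p q r s \<longleftrightarrow> (\<forall>B \<in> blocks_over S. indic B p + indic B q + indic B r + indic B s = 0)"

text \<open>
  The pair \<open>p\<close>, \<open>q\<close> lies in at least two even quadruples. The condition on \<open>r\<close> and \<open>r'\<close> excludes the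
  degenerate quadruples \<open>p, q, p, q\<close>.
\<close>
definition thick :: "('a::field ^ 3) set \<Rightarrow> 'a ^ 3 \<Rightarrow> 'a ^ 3 \<Rightarrow> bool" where
  "thick S p q \<longleftrightarrow> (\<exists>r s r' s'. even4 S p q r s \<and> even4 S p q r' s' \<and>
     r \<notin> {p, q} \<and> r' \<notin> {p, q} \<and> r' \<noteq> r \<and> r' \<noteq> s)"

text \<open>
  In characteristic 2 the point \<open>p + c *s (p + q)\<close> runs through the line joining \<open>p\<close> and \<open>q\<close>.
\<close>
definition line_preserving :: "('a::field ^ 3 \<Rightarrow> 'a ^ 3) \<Rightarrow> bool" where
  "line_preserving f \<longleftrightarrow> (\<forall>p q c. \<exists>c'. f (p + c *s (p + q)) + f p = c' *s (f p + f q))"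

context gf4
begin

lemma ray_smult_eq: "c \<noteq> 0 \<Longrightarrow> x \<noteq> 0 \<Longrightarrow> ray (c *s x) = ray (x :: 'q^3)"
  by (rule ray_eq) (simp_all add: ray_smult)

lemma transversalE:
  assumes "transversal S" "x \<noteq> (0 :: 'q^3)"
  obtains c where "c \<noteq> 0" "c *s x \<in> S" "\<And>d. d \<noteq> 0 \<Longrightarrow> d *s x \<in> S \<Longrightarrow> d = c"
proof -
  have "\<exists>!c. c \<noteq> 0 \<and> c *s x \<in> S" using assms by (simp add: transversal_def)
  then show ?thesis using that by blast
qed

lemma transversal_ex1:
  assumes S: "transversal S" and l: "l \<in> (directions :: ('q^3) set set)"
  shows "\<exists>!v. v \<in> S \<and> ray v = l"
proof -
  obtain x where x: "x \<noteq> 0" "l = ray x" using l by (auto simp: directions_ray)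
  then obtain c where c: "c \<noteq> 0" "c *s x \<in> S" and u: "\<And>d. d \<noteq> 0 \<Longrightarrow> d *s x \<in> S \<Longrightarrow> d = c"
    using transversalE[OF S x(1)] by blast
  show ?thesis
  proof (intro ex1I[of _ "c *s x"] conjI)
    show "c *s x \<in> S" by fact
    show "ray (c *s x) = l" using c x by (simp add: ray_smult_eq)
    fix v assume v: "v \<in> S \<and> ray v = l"
    then have "v \<in> ray x" using x ray_self[of v] by simp
    then obtain d where d: "v = d *s x" by (auto simp: ray_def)
    have "v \<noteq> 0" using v S by (auto simp: transversal_def)
    then show "v = c *s x" using u[of d] v d by auto
  qed
qed

lemma ray_in_directions: "v \<noteq> 0 \<Longrightarrow> ray v \<in> (directions :: ('q^3) set set)"
  by (auto simp: directions_ray)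

text \<open>
  By \<open>arc_block\<close> and \<open>arc_translates\<close> the arc chosen for a direction \<open>l\<close> contributes the blocks of
  one nonzero vector on \<open>l\<close>, and \<open>ex_arc\<close> realizes every choice.
\<close>
lemma bh_designs_eq: "bh_designs = design_of ` {S :: ('q^3) set. transversal S}"
proof (intro equalityI subsetI)
  fix D assume "D \<in> (bh_designs :: ('q^3) design set)"
  then obtain A where D: "D = bh_design A" and A: "\<forall>l \<in> directions. maximal_arc l (A l :: ('q^3) set set)"
    by (auto simp: bh_designs_def)
  have "\<exists>w. w \<noteq> 0 \<and> ray w = l \<and> range (\<lambda>t. \<Union> (translate t (A l))) = blocks w"
    if l: "l \<in> directions" for l
  proof -
    obtain v where v: "v \<noteq> 0" "l = ray v" using l by (auto simp: directions_ray)
    with A l obtain w where w: "w \<in> ray v" "w \<noteq> 0" "\<Union> (A l) \<in> blocks w" using arc_block[of v "A l"] by auto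
    then show ?thesis using arc_translates ray_eq v by metis
  qed
  then obtain w where w: "\<And>l. l \<in> directions \<Longrightarrow>
      w l \<noteq> 0 \<and> ray (w l) = l \<and> range (\<lambda>t. \<Union> (translate t (A l))) = blocks (w l)" by metis
  have "transversal (w ` directions)"
    unfolding transversal_def
  proof (intro conjI allI impI)
    show "0 \<notin> w ` directions" using w by auto
    fix x :: "'q^3" assume x: "x \<noteq> 0"
    then have d: "ray x \<in> directions" by (rule ray_in_directions)
    then have "w (ray x) \<in> ray x" using w ray_self by metis
    then obtain c where c: "w (ray x) = c *s x" by (auto simp: ray_def)
    show "\<exists>!c. c \<noteq> 0 \<and> c *s x \<in> w ` directions"
    proof (intro ex1I[of _ c] conjI)
      show "c \<noteq> 0" using c w[OF d] by auto
      show "c *s x \<in> w ` directions" using c d by (metis image_eqI)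
      fix e assume e: "e \<noteq> 0 \<and> e *s x \<in> w ` directions"
      then obtain l where l: "l \<in> directions" "e *s x = w l" by blast
      have "ray (e *s x) = ray x" using e x by (simp add: ray_smult_eq)
      then have "l = ray x" using l w by metis
      then have "e *s x = c *s x" using l c by simp
      then show "e = c" using x by simp
    qed
  qed
  moreover have "D = design_of (w ` directions)"
  proof -
    have "{\<Union> (translate t (A l)) | l t. l \<in> directions} = (\<Union>l\<in>directions. range (\<lambda>t. \<Union> (translate t (A l))))"
      by auto
    also have "\<dots> = (\<Union>l\<in>directions. blocks (w l))" using w by (intro SUP_cong) auto
    finally show ?thesis by (simp add: D bh_design_def design_of_def blocks_over_def)
  qed
  ultimately show "D \<in> design_of ` {S. transversal S}" by blast
next
  fix D assume "D \<in> design_of ` {S :: ('q^3) set. transversal S}"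
  then obtain S :: "('q^3) set" where S: "transversal S" and D: "D = design_of S" by blast
  have "\<forall>l. \<exists>v. l \<in> directions \<longrightarrow> v \<in> S \<and> ray v = l" using transversal_ex1[OF S] by blast
  then obtain sel where sel: "\<And>l. l \<in> directions \<Longrightarrow> sel l \<in> S \<and> ray (sel l) = l" by metis
  have nz: "v \<in> S \<Longrightarrow> v \<noteq> 0" for v using S by (auto simp: transversal_def)
  have sel2: "sel (ray v) = v" if "v \<in> S" for v
    using transversal_ex1[OF S ray_in_directions[OF nz[OF that]]] sel[OF ray_in_directions[OF nz[OF that]]] that
    by blast
  have "\<forall>l. \<exists>A. l \<in> directions \<longrightarrow> maximal_arc l A \<and> \<Union> A \<in> blocks (sel l)"
    using ex_arc sel nz by metis
  then obtain A where A: "\<And>l. l \<in> directions \<Longrightarrow> maximal_arc l (A l) \<and> \<Union> (A l) \<in> blocks (sel l)" by metis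
  have "{\<Union> (translate t (A l)) | l t. l \<in> directions} = (\<Union>l\<in>directions. range (\<lambda>t. \<Union> (translate t (A l))))"
    by auto
  also have "\<dots> = (\<Union>l\<in>directions. blocks (sel l))"
  proof (intro SUP_cong refl)
    fix l assume l: "l \<in> (directions :: ('q^3) set set)"
    show "range (\<lambda>t. \<Union> (translate t (A l))) = blocks (sel l)"
      using arc_translates[of "sel l" "A l"] A[OF l] nz sel[OF l] by simp
  qed
  also have "\<dots> = blocks_over S"
    unfolding blocks_over_def
  proof (intro equalityI subsetI)
    fix B assume "B \<in> (\<Union>l\<in>directions. blocks (sel l))"
    then show "B \<in> (\<Union>v\<in>S. blocks v)" using sel by blast
  next
    fix B assume "B \<in> (\<Union>v\<in>S. blocks v)"
    then obtain v where "v \<in> S" "B \<in> blocks v" by blast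
    then show "B \<in> (\<Union>l\<in>directions. blocks (sel l))"
      using sel2 ray_in_directions nz by (intro UN_I[of "ray v"]) auto
  qed
  finally have "D = bh_design A" by (simp add: D design_of_def bh_design_def)
  then show "D \<in> bh_designs" using A by (auto simp: bh_designs_def)
qed

text \<open>A block remembers its polar form, and the polar form remembers the vector.\<close>
lemma blocks_disjoint:
  assumes "B \<in> blocks v" "B \<in> blocks w" shows "v = (w :: 'q^3)"
proof -
  have "abs_tr (det3 (v + w) x y) = 0" for x y
    using blocksD[OF assms(1), of 0 x y] blocksD[OF assms(2), of 0 x y] by (simp add: det3_add abs_tr_add)
  then have "v + w = 0" by (rule abs_tr_det_all0)
  then show ?thesis by (simp only: vadd_eq_0)
qed

lemma blocks_nonempty: "v \<noteq> 0 \<Longrightarrow> \<exists>B. B \<in> blocks (v :: 'q^3)"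
  using ex_arc by blast

lemma blocks_over_subset:
  assumes "transversal S" "transversal S'" "blocks_over S \<subseteq> blocks_over (S' :: ('q^3) set)" shows "S \<subseteq> S'"
proof
  fix v assume v: "v \<in> S"
  then have "v \<noteq> 0" using assms by (auto simp: transversal_def)
  then obtain B where B: "B \<in> blocks v" using blocks_nonempty by blast
  then have "B \<in> blocks_over S'" using assms v by (auto simp: blocks_over_def)
  then obtain w where "w \<in> S'" "B \<in> blocks w" by (auto simp: blocks_over_def)
  then show "v \<in> S'" using blocks_disjoint B by metis
qed

lemma blocks_over_inj: "transversal S \<Longrightarrow> transversal S' \<Longrightarrow> blocks_over S = blocks_over (S' :: ('q^3) set) \<Longrightarrow> S = S'"
  using blocks_over_subset by (intro equalityI) auto

lemma design_of_inj: "inj_on design_of {S :: ('q^3) set. transversal S}"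
  by (rule inj_onI) (simp add: design_of_def blocks_over_inj)

lemma transversal_image:
  assumes h: "h \<in> GammaL" and S: "transversal (S :: ('q^3) set)" shows "transversal (h ` S)"
proof -
  obtain t where t: "t \<in> auts" "semilinear t h" and b: "bij h" using h by (auto simp: GammaL_def)
  have i: "inj h" using b by (simp add: bij_def)
  have h0: "h x = 0 \<longleftrightarrow> x = 0" for x using semilinear_0[OF t(2)] i by (metis injD)
  show ?thesis
    unfolding transversal_def
  proof (intro conjI allI impI)
    show "0 \<notin> h ` S" using S by (auto simp: transversal_def h0)
    fix x :: "'q^3" assume x: "x \<noteq> 0"
    obtain y where y: "x = h y" using b by (metis bij_def surjD)
    with x have "y \<noteq> 0" by (simp add: h0)
    then obtain c where c: "c \<noteq> 0" "c *s y \<in> S" and u: "\<And>d. d \<noteq> 0 \<Longrightarrow> d *s y \<in> S \<Longrightarrow> d = c"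
      using transversalE[OF S \<open>y \<noteq> 0\<close>] by blast
    have *: "d *s x \<in> h ` S \<longleftrightarrow> t d *s y \<in> S" for d
    proof -
      have "d *s x = h (t d *s y)" by (simp add: y semilinear_smult[OF t(2)] auts_rules[OF t(1)])
      then show ?thesis using i by (simp add: inj_image_mem_iff)
    qed
    show "\<exists>!c. c \<noteq> 0 \<and> c *s x \<in> h ` S"
    proof (intro ex1I[of _ "t c"] conjI)
      show "t c \<noteq> 0" "t c *s x \<in> h ` S" using c by (simp_all add: * auts_rules[OF t(1)])
      fix d assume d: "d \<noteq> 0 \<and> d *s x \<in> h ` S"
      then have "t d = c" using u[of "t d"] by (simp add: * auts_rules[OF t(1)])
      then show "d = t c" by (metis auts_rules(6)[OF t(1)])
    qed
  qed
qed

lemma transversal_not_ray: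
  assumes S: "transversal S" and X: "X \<noteq> (0::'q^3)" shows "\<exists>v\<in>S. cross X v \<noteq> 0"
proof -
  obtain y where y: "cross X y \<noteq> 0" using ex_cross_ne[OF X] by blast
  then have "y \<noteq> 0" by auto
  then obtain c where c: "c \<noteq> 0" "c *s y \<in> S" by (rule transversalE[OF S])
  then show ?thesis using y by (intro bexI[of _ "c *s y"]) (auto simp: cross_smult)
qed

text \<open>
  For an even quadruple, compare the parity of a block and of its translate by \<open>t\<close>: they
  differ by \<open>abs_tr (det3 v t X)\<close>, where \<open>X\<close> is the sum of the four points. So \<open>X\<close> is a multiple
  of every \<open>v \<in> S\<close>, hence 0. The parity is then the second derivative of the indicator.
\<close>
lemma even4_iff:
  assumes S: "transversal S"
  shows "even4 S p q r s \<longleftrightarrow> s = p + q + (r::'q^3) \<and> annih S (cross (p + q) (p + r))"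
proof
  assume E: "even4 S p q r s"
  let ?X = "p + q + r + s"
  have X: "?X = 0"
  proof (rule ccontr)
    assume "?X \<noteq> 0"
    then obtain v where v: "v \<in> S" "cross ?X v \<noteq> 0" using transversal_not_ray[OF S] by blast
    then have "v \<noteq> 0" by auto
    then obtain B where B: "B \<in> blocks v" using blocks_nonempty by blast
    have "abs_tr (det3 v t ?X) = 0" for t
    proof -
      have "B \<in> blocks_over S" "(+) t ` B \<in> blocks_over S" using B v translate_blocks_iff by (auto simp: blocks_over_def)
      then have 1: "indic B p + indic B q + indic B r + indic B s = 0"
        and 2: "indic ((+) t ` B) p + indic ((+) t ` B) q + indic ((+) t ` B) r + indic ((+) t ` B) s = 0"
        using E by (auto simp: even4_def)
      have "indic ((+) t ` B) x = indic B (t + x)" for x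
        using indic_image[of "(+) t" B "t + x"] by simp
      with 2 have "indic B (t + p) + indic B (t + q) + indic B (t + r) + indic B (t + s) = 0" by simp
      then have "(indic B p + indic B q + indic B r + indic B s) + abs_tr (det3 v t ?X) = 0"
        by (simp add: indic_polar[OF B] det3_add abs_tr_add algebra_simps det3_swap(2))
      then show ?thesis by (simp add: 1)
    qed
    then have "abs_tr (c * det3 v t ?X) = 0" for c t using det3_smult(2)[of v c t ?X] by metis
    then have "det3 v t ?X = 0" for t by (rule abs_tr_all0)
    then have "dotp t (cross ?X v) = 0" for t
      by (metis det3_def det3_swap(1,2))
    then show False using ex_dotp1[OF v(2)] by auto
  qed
  then have s: "s = p + q + r" by (simp only: vadd_eq_0[of "p + q + r" s])
  have "abs_tr (dotp v (cross (p + q) (p + r))) = 0" if v: "v \<in> S" for v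
  proof -
    have "v \<noteq> 0" using v S by (auto simp: transversal_def)
    then obtain B where B: "B \<in> blocks v" using blocks_nonempty by blast
    have "indic B p + indic B q + indic B r + indic B s = 0" using E B v by (auto simp: even4_def blocks_over_def)
    then show ?thesis using blocksD[OF B, of p "p + q" "p + r"] s by (simp add: det3_def ac_simps)
  qed
  with s show "s = p + q + r \<and> annih S (cross (p + q) (p + r))" by (simp add: annih_def)
next
  assume a: "s = p + q + r \<and> annih S (cross (p + q) (p + r))"
  show "even4 S p q r s"
    unfolding even4_def
  proof
    fix B assume "B \<in> blocks_over S"
    then obtain v where v: "v \<in> S" "B \<in> blocks v" by (auto simp: blocks_over_def)
    have "indic B p + indic B q + indic B r + indic B s = abs_tr (dotp v (cross (p + q) (p + r)))"
      using blocksD[OF v(2), of p "p + q" "p + r"] a by (simp add: det3_def ac_simps)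
    then show "indic B p + indic B q + indic B r + indic B s = 0" using a v by (simp add: annih_def)
  qed
qed

text \<open>
  Choose \<open>v\<close> with \<open>dotp v w = 1\<close> and \<open>dotp v w'\<close> outside of the prime field. No nonzero multiple
  of \<open>v\<close> is orthogonal to both \<open>w\<close> and \<open>w'\<close>, but one of them belongs to \<open>S\<close>.
\<close>
lemma annih_unique:
  assumes S: "transversal S" and w: "annih S w" "w \<noteq> 0" and w': "annih S w'" "w' \<noteq> (0::'q^3)"
  shows "w = w'"
proof (rule ccontr)
  assume ne: "w \<noteq> w'"
  have "\<exists>v. dotp v w = 1 \<and> (dotp v w' = omega \<or> dotp v w' = omega + 1)"
  proof (cases "cross w w' = 0")
    case True
    then obtain k where k: "w' = k *s w" using cross_eq_0 w by blast
    then have "k \<noteq> 0" "k \<noteq> 1" using ne w' by auto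
    then have k2: "k = omega \<or> k = omega + 1" using cases4[of k] by blast
    obtain v where "dotp v w = 1" using ex_dotp1[OF w(2)] by blast
    then show ?thesis using k k2 by (auto simp: dotp_smult)
  next
    case False
    then obtain z where z: "det3 z w w' = 1" using ex_cross_dotp1 by blast
    have "dotp (cross w' z) w = 1" "dotp (cross w' z) w' = 0" "dotp (cross z w) w' = 1" "dotp (cross z w) w = 0"
      using z by (auto simp: det3_def dotp_def algebra_simps)
    then show ?thesis by (intro exI[of _ "cross w' z + omega *s cross z w"]) (simp add: dotp_add dotp_smult)
  qed
  then obtain v where v: "dotp v w = 1" "dotp v w' = omega \<or> dotp v w' = omega + 1" by blast
  then have "v \<noteq> 0" by auto
  then obtain c where c: "c \<noteq> 0" "c *s v \<in> S" by (rule transversalE[OF S])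
  then have "abs_tr c = 0" "abs_tr (c * dotp v w') = 0"
    using w w' v unfolding annih_def by (auto simp: dotp_smult dest!: bspec)
  then have "c = 1" using c by (simp add: abs_tr_eq_01)
  then show False using \<open>abs_tr (c * dotp v w') = 0\<close> v by auto
qed

lemma ex_cross:
  assumes "x \<noteq> (0::'q^3)" "dotp x w = 0" shows "\<exists>y. cross x y = w"
proof -
  obtain z where z: "dotp z x = 1" using ex_dotp1[OF assms(1)] by blast
  have "cross x (cross w z) = dotp z x *s w - dotp x w *s z"
    unfolding vec3_eq by (simp add: dotp_def algebra_simps)
  then show ?thesis using z assms by auto
qed

text \<open>
  The line through \<open>p\<close> and \<open>q\<close> is always an even quadruple; a second one supplies a nonzero
  vector \<open>w = (p + q) \<times> (p + r)\<close> orthogonal to \<open>S\<close>.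
\<close>
lemma thick_iff:
  assumes S: "transversal S" and pq: "p \<noteq> (q::'q^3)"
  shows "thick S p q \<longleftrightarrow> (\<exists>w. w \<noteq> 0 \<and> annih S w \<and> dotp (p + q) w = 0)"
proof
  assume "thick S p q"
  then obtain r s r' s' where E: "even4 S p q r s" "even4 S p q r' s'"
    and ne: "r \<notin> {p, q}" "r' \<notin> {p, q}" "r' \<noteq> r" "r' \<noteq> s"
    unfolding thick_def by blast
  have x: "p + q \<noteq> 0" using pq by (simp add: vadd_eq_0)
  have s: "s = p + q + r" and P: "annih S (cross (p + q) (p + r))" "annih S (cross (p + q) (p + r'))"
    using E by (simp_all add: even4_iff[OF S])
  have dt0: "dotp (p + q) (cross (p + q) z) = 0" for z using det3_eq(1)[of "p + q" z] by (simp only: det3_def)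
  have "cross (p + q) (p + r) \<noteq> 0 \<or> cross (p + q) (p + r') \<noteq> 0"
  proof (rule ccontr)
    assume "\<not> ?thesis"
    then obtain c c' where c: "p + r = c *s (p + q)" "p + r' = c' *s (p + q)"
      using cross_eq_0 x by blast
    have "c \<noteq> 0" "c' \<noteq> 0" "c \<noteq> 1" "c' \<noteq> 1"
      using c ne by (auto simp: vadd_eq_0)
    then have "c \<in> {omega, omega + 1}" "c' \<in> {omega, omega + 1}" using cases4[of c] cases4[of c'] by auto
    moreover have "c \<noteq> c'" using c ne by (metis add_left_cancel)
    ultimately have "c + c' = 1" by auto
    then have "(p + r) + (p + r') = p + q" unfolding c vec.scale_left_distrib[symmetric] by simp
    then have "r' = s" unfolding s by (metis add.assoc add.commute vadd_self_left)
    then show False using ne by simp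
  qed
  then show "\<exists>w. w \<noteq> 0 \<and> annih S w \<and> dotp (p + q) w = 0" using P dt0 by blast
next
  assume "\<exists>w. w \<noteq> 0 \<and> annih S w \<and> dotp (p + q) w = 0"
  then obtain w where w: "w \<noteq> 0" "annih S w" "dotp (p + q) w = 0" by blast
  have x: "p + q \<noteq> 0" using pq by (simp add: vadd_eq_0)
  obtain y where y: "cross (p + q) y = w" using ex_cross[OF x w(3)] by blast
  define r r' where "r = p + y" and "r' = p + omega *s (p + q)"
  have r': "p + r' = omega *s (p + q)" by (simp only: r'_def vadd_self_left)
  have cross: "cross (p + q) (p + r) = w" "cross (p + q) (p + r') = 0"
    unfolding r' using y by (simp add: r_def) (simp only: cross_smult cross_self vec.scale_zero_right)
  have E: "even4 S p q r (p + q + r)" "even4 S p q r' (p + q + r')"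
    using w by (simp_all only: even4_iff[OF S] cross) (simp add: annih_def)
  have "cross (p + q) (p + (p + q + r)) = cross (p + q) ((p + q) + (p + r))" by (simp only: ac_simps)
  also have "\<dots> = w" by (simp only: cross_add(2)[of "p + q" "p + q" "p + r"] cross cross_self add_0_left)
  finally have "r' \<noteq> p + q + r" "r' \<noteq> r" using cross w by metis+
  moreover have "r \<notin> {p, q}" using cross w by auto
  moreover have "r' \<notin> {p, q}"
  proof -
    note 1 = r'
    have "p + r' \<noteq> 0" using x unfolding 1 by (simp only: vec.scale_eq_0_iff) simp
    moreover have "p + r' \<noteq> p + q"
    proof
      assume "p + r' = p + q"
      then have "(omega + 1) *s (p + q) = 0" using 1 by (simp only: vec.scale_left_distrib) simp
      then show False using x by (simp only: vec.scale_eq_0_iff) simp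
    qed
    ultimately show ?thesis by (auto simp: vadd_eq_0)
  qed
  ultimately show "thick S p q" unfolding thick_def using E by blast
qed

end

section \<open>Isomorphisms are semilinear up to translation\<close>

context gf4
begin

lemma vtwo_eq_0 [simp]: "(2::'q^3) = 0"
  by (metis one_add_one vadd_self)

lemma even4_image:
  fixes S S' :: "('q^3) set"
  assumes f: "bij f" and im: "(\<lambda>B. f ` B) ` blocks_over S = blocks_over S'" and E: "even4 S p q r s"
  shows "even4 S' (f p) (f q) (f r) (f s)"
  unfolding even4_def
proof
  fix B' assume "B' \<in> blocks_over S'"
  then obtain B where B: "B \<in> blocks_over S" "B' = f ` B" using im by blast
  have i: "inj f" using f by (simp add: bij_def)
  show "indic B' (f p) + indic B' (f q) + indic B' (f r) + indic B' (f s) = 0"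
    using E B by (simp add: even4_def indic_image[OF i])
qed

lemma thick_image:
  fixes S S' :: "('q^3) set"
  assumes f: "bij f" and im: "(\<lambda>B. f ` B) ` blocks_over S = blocks_over S'" and T: "thick S p q"
  shows "thick S' (f p) (f q)"
proof -
  obtain r s r' s' where *: "even4 S p q r s" "even4 S p q r' s'"
     "r \<notin> {p, q}" "r' \<notin> {p, q}" "r' \<noteq> r" "r' \<noteq> s" using T unfolding thick_def by blast
  have i: "f x = f y \<longleftrightarrow> x = y" for x y using f by (simp add: bij_def inj_eq)
  show ?thesis unfolding thick_def
    using * even4_image[OF f im *(1)] even4_image[OF f im *(2)]
    by (intro exI[of _ "f r"] exI[of _ "f s"] exI[of _ "f r'"] exI[of _ "f s'"]) (simp add: i)
qed

lemma image_inv: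
  assumes f: "bij f" and im: "(\<lambda>B. f ` B) ` X = Y" shows "(\<lambda>B. inv f ` B) ` Y = X"
  using f unfolding im[symmetric] by (simp add: image_image bij_def image_inv_f_f)

lemma thick_image_iff:
  fixes S S' :: "('q^3) set"
  assumes f: "bij f" and im: "(\<lambda>B. f ` B) ` blocks_over S = blocks_over S'"
  shows "thick S' (f p) (f q) \<longleftrightarrow> thick S p q"
proof
  assume "thick S' (f p) (f q)"
  then have "thick S (inv f (f p)) (inv f (f q))"
    by (rule thick_image[OF bij_imp_bij_inv[OF f] image_inv[OF f im]])
  then show "thick S p q" using f by (simp add: bij_def)
qed (rule thick_image[OF f im])

lemma line_even4:
  assumes S: "transversal (S :: ('q^3) set)"
  shows "even4 S p q (p + c *s (p + q)) (q + c *s (p + q))"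
proof -
  have "p + (p + c *s (p + q)) = c *s (p + q)" by (simp only: vadd_self_left)
  then have "cross (p + q) (p + (p + c *s (p + q))) = 0" by (simp only: cross_smult cross_self vec.scale_zero_right)
  moreover have "p + q + (p + c *s (p + q)) = q + c *s (p + q)"
    by (metis add.commute add.left_commute vadd_self_left)
  ultimately show ?thesis unfolding even4_iff[OF S] by (simp only: annih_def dotp_0 abs_tr_simps) simp
qed

text \<open>
  If \<open>p\<close>, \<open>q\<close> is not thick, then the line through both is the only even quadruple that contains
  them, and this property is invariant.
\<close>
lemma thin_line:
  fixes S S' :: "('q^3) set"
  assumes f: "bij f" and im: "(\<lambda>B. f ` B) ` blocks_over S = blocks_over S'"
    and S: "transversal S" and S': "transversal S'" and thin: "\<not> thick S p q" and pq: "p \<noteq> q"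
  shows "\<exists>c'. f (p + c *s (p + q)) + f p = c' *s (f p + f q)"
proof -
  let ?r = "p + c *s (p + q)"
  have ne: "f p \<noteq> f q" using pq f by (simp add: bij_def inj_eq)
  then have x: "f p + f q \<noteq> 0" by (simp add: vadd_eq_0)
  have "even4 S' (f p) (f q) (f ?r) (f (q + c *s (p + q)))"
    by (rule even4_image[OF f im line_even4[OF S]])
  then have P: "annih S' (cross (f p + f q) (f p + f ?r))" by (simp only: even4_iff[OF S'])
  have "dotp (f p + f q) (cross (f p + f q) z) = 0" for z
    using det3_eq(1)[of "f p + f q" z] by (simp only: det3_def)
  moreover have "\<not> thick S' (f p) (f q)" using thin thick_image_iff[OF f im] by blast
  ultimately have "cross (f p + f q) (f p + f ?r) = 0" using P thick_iff[OF S' ne] by blast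
  then obtain c' where "f p + f ?r = c' *s (f p + f q)" using cross_eq_0[OF _ x] by blast
  then show ?thesis by (metis add.commute)
qed

text \<open>
  Lines joining a thick pair lie in a plane \<open>dotp _ w = const\<close>. Choose \<open>s\<close> outside of this plane
  and join it to the three points \<open>p\<close>, \<open>q\<close>, \<open>r\<close>. A suitable further line meets the joining lines
  in \<open>p\<close>, \<open>q'\<close>, \<open>r'\<close>. All lines of the configuration are thin, so its image is again such a
  configuration. Since the images of \<open>p\<close>, \<open>q\<close>, \<open>r\<close> lie in a plane \<open>dotp _ w' = const\<close> that avoids
  the image of \<open>s\<close>, the linear relation between them that the configuration provides has
  coefficient sum 0, which means that they are collinear.
\<close>
lemma thick_line:
  fixes S S' :: "('q^3) set"
  assumes f: "bij f" and im: "(\<lambda>B. f ` B) ` blocks_over S = blocks_over S'"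
    and S: "transversal S" and S': "transversal S'" and T: "thick S p q" and pq: "p \<noteq> q"
    and c: "c \<noteq> 0" "c \<noteq> 1"
  shows "\<exists>c'. f (p + c *s (p + q)) + f p = c' *s (f p + f q)"
proof -
  have i: "f x = f y \<longleftrightarrow> x = y" for x y using f by (simp add: bij_def inj_eq)
  obtain w where w: "w \<noteq> 0" "annih S w" "dotp (p + q) w = 0" using T thick_iff[OF S pq] by blast
  have thin: "\<not> thick S a b" if "dotp (a + b) w \<noteq> 0" for a b
  proof
    assume t: "thick S a b"
    have "a \<noteq> b" using that by auto
    then obtain w' where "w' \<noteq> 0" "annih S w'" "dotp (a + b) w' = 0" using t thick_iff[OF S] by blast
    then show False using annih_unique[OF S] w that by blast
  qed
  obtain x where x: "dotp x w = 1" using ex_dotp1[OF w(1)] by blast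
  have c2: "c = omega \<or> c = omega + 1" using c cases4[of c] by blast
  have cc: "c * c = c + 1" "c * (c + 1) = 1"
    using c2 by (auto simp: distrib_left distrib_right add.assoc)
  have cc4: "c + 1 \<noteq> 0" using c by (simp add: add_eq_0)
  define u where "u = p + q"
  define s where "s = p + x"
  define r where "r = p + c *s u"
  \<comment> \<open>The multipliers \<open>c\<close> and \<open>c + 1\<close> are chosen so that \<open>p\<close>, \<open>q'\<close>, \<open>r'\<close> are collinear, see \<open>r'eq\<close>.\<close>
  define q' where "q' = s + c *s (s + q)"
  define r' where "r' = s + (c + 1) *s (s + r)"
  have sp: "s + p = x" by (simp add: s_def algebra_simps)
  have sq: "s + q = x + u" by (simp add: s_def u_def algebra_simps)
  have sr: "s + r = x + c *s u" by (simp add: s_def r_def algebra_simps)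
  have pq': "p + q' = (c + 1) *s x + c *s u"
    unfolding q'_def sq by (simp add: s_def vec.scale_left_distrib vec.scale_right_distrib algebra_simps)
  have pr': "p + r' = c *s x + u"
  proof -
    have "p + r' = x + (c + 1) *s (x + c *s u)" unfolding r'_def sr by (simp add: s_def add.assoc)
    also have "\<dots> = x + (c + 1) *s x + ((c + 1) * c) *s u"
      by (simp only: vec.scale_right_distrib vec.scale_scale add.assoc)
    also have "(c + 1) * c = 1" using cc(2) by (simp only: mult.commute)
    also have "x + (c + 1) *s x = c *s x" by (simp add: vec.scale_left_distrib algebra_simps)
    finally show ?thesis by simp
  qed
  have r'eq: "r' = p + (c + 1) *s (p + q')"
  proof -
    have "(c + 1) *s (p + q') = ((c + 1) * (c + 1)) *s x + ((c + 1) * c) *s u"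
      unfolding pq' by (simp only: vec.scale_right_distrib vec.scale_scale)
    also have "(c + 1) * c = 1" using cc(2) by (simp only: mult.commute)
    also have "(c + 1) * (c + 1) = c" using cc(1) by (simp add: algebra_simps)
    finally have "(c + 1) *s (p + q') = p + r'" using pr' by simp
    then show ?thesis by simp
  qed
  have u0: "u \<noteq> 0" using pq by (simp add: u_def vadd_eq_0)
  have dts: "dotp (s + p) w \<noteq> 0" "dotp (s + q) w \<noteq> 0" "dotp (s + r) w \<noteq> 0" "dotp (p + q') w \<noteq> 0"
    unfolding sp sq sr pq' using x cc4 w(3)[folded u_def] by (simp_all add: dotp_add dotp_smult)
  have nes: "s \<noteq> p" "s \<noteq> q" "s \<noteq> r" "p \<noteq> q'"
    using dts by auto
  obtain b where b: "f q' + f s = b *s (f s + f q)"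
    using thin_line[OF f im S S' thin[OF dts(2)] nes(2), of c] unfolding q'_def by blast
  obtain d where d: "f r' + f s = d *s (f s + f r)"
    using thin_line[OF f im S S' thin[OF dts(3)] nes(3), of "c + 1"] unfolding r'_def by blast
  obtain e where e: "f r' + f p = e *s (f p + f q')"
    using thin_line[OF f im S S' thin[OF dts(4)] nes(4), of "c + 1"] unfolding r'eq[symmetric] by blast
  have pr: "p + r = c *s u" by (simp add: r_def)
  have pner: "p \<noteq> r"
  proof
    assume "p = r"
    then have "c *s u = 0" using pr by simp
    then show False using c u0 by (simp only: vec.scale_eq_0_iff) simp
  qed
  have "dotp (p + r) w = 0" unfolding pr using w(3) by (simp only: dotp_smult u_def mult_zero_right)
  then have "thick S p r" using thick_iff[OF S pner] w by blast
  then have T2: "thick S' (f p) (f r)" by (simp only: thick_image_iff[OF f im])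
  have T1: "thick S' (f p) (f q)" using T by (simp only: thick_image_iff[OF f im])
  have T0: "\<not> thick S' (f s) (f p)" using thin[OF dts(1)] by (simp only: thick_image_iff[OF f im]) simp
  have ne': "f p \<noteq> f q" "f p \<noteq> f r" "f s \<noteq> f p" using pq pner nes i by simp_all
  obtain w' where w': "w' \<noteq> 0" "annih S' w'" "dotp (f p + f q) w' = 0"
    using T1 thick_iff[OF S' ne'(1)] by blast
  obtain w2 where w2: "w2 \<noteq> 0" "annih S' w2" "dotp (f p + f r) w2 = 0"
    using T2 thick_iff[OF S' ne'(2)] by blast
  have "w2 = w'" by (rule annih_unique[OF S' w2(2,1) w'(2,1)])
  with w2 have w2': "dotp (f p + f r) w' = 0" by simp
  define P Q R where "P = f s + f p" and "Q = f s + f q" and "R = f s + f r"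
  have k: "dotp P w' \<noteq> 0" unfolding P_def using T0 thick_iff[OF S' ne'(3)] w' by blast
  have PQ: "P + Q = f p + f q" "P + R = f p + f r" by (simp_all add: P_def Q_def R_def ac_simps)
  have kQ: "dotp Q w' = dotp P w'"
    using w'(3) unfolding PQ[symmetric] dotp_add by (simp only: add_eq_0)
  have kR: "dotp R w' = dotp P w'"
    using w2' unfolding PQ[symmetric] dotp_add by (simp only: add_eq_0)
  have fq': "f q' = f s + b *s Q" using b by (metis Q_def add.commute vadd_self_left)
  have fr': "f r' = f s + d *s R" using d by (metis R_def add.commute vadd_self_left)
  have e1: "P + d *s R = e *s (P + b *s Q)"
    using e unfolding fq' fr' P_def by (simp only: ac_simps)
  then have "dotp (P + d *s R) w' = dotp (e *s (P + b *s Q)) w'" by simp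
  then have "(1 + d) * dotp P w' = (e * (1 + b)) * dotp P w'"
    by (simp add: dotp_add dotp_smult kQ kR algebra_simps)
  \<comment> \<open>Applying \<open>dotp _ w'\<close> to the relation compares its coefficient sums.\<close>
  then have e2: "1 + d = e * (1 + b)" using k by simp
  have d0: "d \<noteq> 0"
  proof
    assume "d = 0"
    then have "r' = s" using fr' i by simp
    then have "(c + 1) *s (s + r) = 0" unfolding r'_def by (metis vadd_self vadd_self_left)
    then show False using cc4 nes(3) by (simp only: vec.scale_eq_0_iff vadd_eq_0) simp
  qed
  have "d *s (P + R) = d *s P + (P + (P + d *s R))" by (simp add: vec.scale_right_distrib)
  also have "\<dots> = d *s P + (P + e *s (P + b *s Q))" unfolding e1 ..
  also have "\<dots> = (1 + d + e) *s P + (e * b) *s Q"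
    by (simp add: vec.scale_left_distrib vec.scale_right_distrib ac_simps)
  also have "1 + d + e = e * b" unfolding e2 by (simp add: algebra_simps)
  finally have "d *s (P + R) = (e * b) *s (P + Q)" by (simp only: vec.scale_right_distrib)
  then have "inverse d *s (d *s (P + R)) = (inverse d * (e * b)) *s (P + Q)"
    by (simp only: vec.scale_scale)
  then have "P + R = (inverse d * (e * b)) *s (P + Q)"
    using d0 by (simp only: vec.scale_scale left_inverse vec.scale_one not_False_eq_True)
  then show ?thesis unfolding PQ r_def u_def by (metis add.commute)
qed

lemma isomorphism_line_preserving:
  fixes S S' :: "('q^3) set"
  assumes f: "bij f" and im: "(\<lambda>B. f ` B) ` blocks_over S = blocks_over S'" and S: "transversal S" and S': "transversal S'"
  shows "line_preserving f"
  unfolding line_preserving_def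
proof (intro allI)
  fix p q :: "'q^3" and c :: 'q
  consider "p = q \<or> c = 0" | "c = 1" | "p \<noteq> q" "\<not> thick S p q" | "p \<noteq> q" "thick S p q" "c \<noteq> 0" "c \<noteq> 1" by blast
  then show "\<exists>c'. f (p + c *s (p + q)) + f p = c' *s (f p + f q)"
  proof cases
    case 1 then show ?thesis by (intro exI[of _ 0]) auto
  next
    case 2 then show ?thesis by (intro exI[of _ 1]) (simp add: add.commute)
  next
    case 3 then show ?thesis by (intro thin_line[OF f im S S'])
  next
    case 4 then show ?thesis by (intro thick_line[OF f im S S'])
  qed
qed

text \<open>
  The fundamental theorem of affine geometry in this special case. For independent \<open>x\<close>, \<open>y\<close>, the
  image of \<open>x + y\<close> lies in the span of \<open>g x\<close> and \<open>g y\<close>; the line through \<open>x\<close> and \<open>x + y\<close> misses the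
  line through 0 and \<open>y\<close>, so its image is parallel to \<open>g y\<close>. By symmetry \<open>g (x + y) = g x + g y\<close>.
  Additivity for dependent vectors and the independence of the scalar function of \<open>x\<close> follow
  with the help of a further vector. A permutation of the field that fixes 0 and 1 is the
  identity or \<open>frob\<close>.
\<close>
lemma line_preserving_linear:
  assumes lp: "line_preserving g" and g0: "g 0 = (0::'q^3)" and i: "inj g"
  shows "\<exists>t \<in> auts. semilinear t g"
proof -
  have ge: "g x = g y \<longleftrightarrow> x = y" for x y using i by (simp add: inj_eq)
  have g0': "g x = 0 \<longleftrightarrow> x = 0" for x using ge[of x 0] g0 by simp
  have scal: "\<exists>c'. g (c *s x) = c' *s g x" for c x
  proof -
    obtain c' where "g (0 + c *s (0 + x)) + g 0 = c' *s (g 0 + g x)"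
      using lp unfolding line_preserving_def by blast
    then have "g (c *s x) = c' *s g x" by (simp add: g0)
    then show ?thesis ..
  qed
  then have "\<forall>x c. \<exists>c'. g (c *s x) = c' *s g x" by blast
  then obtain \<sigma> where \<sigma>: "\<And>c x. g (c *s x) = \<sigma> x c *s g x" by metis
  have onto: "\<exists>c. g (p + c *s (p + q)) + g p = k *s (g p + g q)" if pq: "p \<noteq> q" for p q k
  proof -
    have "\<exists>h. \<forall>c. g (p + c *s (p + q)) + g p = h c *s (g p + g q)"
      using lp unfolding line_preserving_def by metis
    then obtain h where h: "\<And>c. g (p + c *s (p + q)) + g p = h c *s (g p + g q)" by blast
    have "inj h"
    proof (rule injI)
      fix c c' assume "h c = h c'"
      then have "g (p + c *s (p + q)) + g p = g (p + c' *s (p + q)) + g p" by (simp only: h)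
      then have "p + c *s (p + q) = p + c' *s (p + q)" by (simp only: add_right_cancel ge)
      then have "(c = c') \<or> p + q = 0" by (simp only: add_left_cancel vec.scale_right_imp_eq vec.scale_cancel_right)
      then show "c = c'" using pq by (simp add: vadd_eq_0)
    qed
    then have "surj h" by (simp add: finite_UNIV_inj_surj)
    then obtain c where "k = h c" by (metis surjD)
    then show ?thesis using h by blast
  qed
  have ray_onto: "\<exists>c. k *s g x = g (c *s x)" for k x
  proof (cases "x = 0")
    case True then show ?thesis by (simp add: g0)
  next
    case False
    obtain c where "g (0 + c *s (0 + x)) + g 0 = k *s (g 0 + g x)" using onto[of 0 x k] False by auto
    then have "k *s g x = g (c *s x)" by (simp add: g0)
    then show ?thesis ..
  qed
  have indep: "cross (g x) (g y) \<noteq> 0" if xy: "cross x y \<noteq> 0" for x y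
  proof
    assume "cross (g x) (g y) = 0"
    moreover have "x \<noteq> 0" using xy by auto
    ultimately obtain k where "g y = k *s g x" using cross_eq_0[of "g x" "g y"] g0' by blast
    then obtain c where "g y = g (c *s x)" using ray_onto by metis
    then have "y = c *s x" by (simp only: ge)
    then have "cross x y = 0" by (simp only: cross_smult cross_self vec.scale_zero_right)
    with xy show False ..
  qed
  have span: "\<exists>a b. g (x + y) = a *s g x + b *s g y" for x y
  proof -
    \<comment> \<open>The point \<open>x + y\<close> lies on the line through suitable multiples of \<open>x\<close> and \<open>y\<close>.\<close>
    define p q where "p = inverse (omega + 1) *s x" and "q = inverse omega *s y"
    have "p + omega *s (p + q) = (omega + 1) *s p + omega *s q"
      by (simp add: vec.scale_left_distrib vec.scale_right_distrib ac_simps)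
    also have "\<dots> = x + y" unfolding p_def q_def
      by (simp only: vec.scale_scale right_inverse vec.scale_one omega_ne_simps not_False_eq_True)
    finally have "p + omega *s (p + q) = x + y" .
    moreover obtain c' where "g (p + omega *s (p + q)) + g p = c' *s (g p + g q)"
      using lp unfolding line_preserving_def by blast
    ultimately have "g (x + y) = c' *s (g p + g q) + g p" by (metis vadd_shift)
    also have "\<dots> = (c' + 1) *s g p + c' *s g q"
      by (simp add: vec.scale_left_distrib vec.scale_right_distrib ac_simps)
    also have "\<dots> = ((c' + 1) * \<sigma> x (inverse (omega + 1))) *s g x + (c' * \<sigma> y (inverse omega)) *s g y"
      unfolding p_def q_def \<sigma> vec.scale_scale ..
    finally show ?thesis by blast
  qed
  have half: "\<exists>b. g (x + y) = g x + b *s g y" if xy: "cross x y \<noteq> 0" for x y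
  proof -
    obtain a b where ab: "g x + g (x + y) = a *s g x + b *s g y"
    proof -
      obtain a b where "g (x + y) = a *s g x + b *s g y" using span by blast
      then have "g x + g (x + y) = (1 + a) *s g x + b *s g y"
        by (simp add: vec.scale_left_distrib add.assoc)
      then show ?thesis by (rule that)
    qed
    have y0: "y \<noteq> 0" using xy by auto
    have "a = 0"
    proof (rule ccontr)
      assume a: "a \<noteq> 0"
      have "x \<noteq> x + y" using y0 by simp
      then obtain c where c: "g (x + c *s (x + (x + y))) + g x = inverse a *s (g x + g (x + y))"
        using onto by blast
      have "inverse a *s (g x + g (x + y)) = g x + (inverse a * b) *s g y"
        unfolding ab vec.scale_right_distrib vec.scale_scale
        using a by (simp only: left_inverse vec.scale_one not_False_eq_True)
      with c have "g (x + c *s y) = (inverse a * b) *s g y"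
        by (simp only: vadd_self_left vadd_shift) (simp add: ac_simps)
      then obtain c' where "g (x + c *s y) = g (c' *s y)" using ray_onto by metis
      then have "x + c *s y = c' *s y" by (simp only: ge)
      then have "x = c' *s y + c *s y" by (rule vadd_shift[THEN iffD1])
      then have "x = (c' + c) *s y" by (simp only: vec.scale_left_distrib)
      then have "cross x y = 0" by (simp only: cross_smult cross_self vec.scale_zero_right)
      with xy show False ..
    qed
    with ab have "g x + g (x + y) = b *s g y" by simp
    then have "g (x + y) = g x + b *s g y" by (metis vadd_self_left)
    then show ?thesis ..
  qed
  have add_indep: "g (x + y) = g x + g y" if xy: "cross x y \<noteq> 0" for x y
  proof -
    obtain b where b: "g (x + y) = g x + b *s g y" using half[OF xy] by blast
    have yx: "cross y x \<noteq> 0" using xy cross_commute[of x y] by simp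
    obtain b' where b': "g (y + x) = g y + b' *s g x" using half[OF yx] by blast
    have "g x + b *s g y = g y + b' *s g x" using b b' by (simp add: add.commute)
    then have "cross (g x) (g x + b *s g y) = cross (g x) (g y + b' *s g x)" by simp
    then have "b *s cross (g x) (g y) = 1 *s cross (g x) (g y)" by (simp add: cross_add cross_smult)
    then have "b = 1" using indep[OF xy] by (simp only: vec.scale_cancel_right) simp
    then show ?thesis using b by simp
  qed
  have add: "g (x + y) = g x + g y" for x y
  proof (cases "x = 0 \<or> cross x y \<noteq> 0")
    case True then show ?thesis using add_indep by (auto simp: g0)
  next
    case False
    then have x0: "x \<noteq> 0" by simp
    obtain k where k: "y = k *s x" using False cross_eq_0 by blast
    show ?thesis
    proof (cases "k = 0 \<or> k = 1")
      case True then show ?thesis using k by (auto simp: g0)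
    next
      case k1: False
      obtain z where z: "cross x z \<noteq> 0" using ex_cross_ne[OF x0] by blast
      have zx: "cross z x \<noteq> 0" using z cross_commute[of x z] by simp
      have yz: "cross y z \<noteq> 0" using z k1 unfolding k cross_smult by (simp only: vec.scale_eq_0_iff) simp
      have "cross (x + z) (y + z) = (1 + k) *s cross x z"
        unfolding k cross_add cross_smult using cross_commute[of x z]
        by (simp add: vec.scale_left_distrib)
      moreover have "1 + k \<noteq> 0" using k1 by (simp add: add_eq_0)
      ultimately have n: "cross (x + z) (y + z) \<noteq> 0" using z by (simp only: vec.scale_eq_0_iff) simp
      have "x + y = (x + z) + (y + z)" by (simp add: ac_simps)
      then have "g (x + y) = g (x + z) + g (y + z)" using add_indep[OF n] by simp
      also have "\<dots> = g x + g y" by (simp add: add_indep[OF z] add_indep[OF yz] ac_simps)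
      finally show ?thesis .
    qed
  qed
  have \<sigma>_indep: "\<sigma> x c = \<sigma> y c" if xy: "cross x y \<noteq> 0" for x y c
  proof -
    have "\<sigma> (x + y) c *s (g x + g y) = \<sigma> x c *s g x + \<sigma> y c *s g y"
      using \<sigma>[of c "x + y"] by (simp only: vec.scale_right_distrib[of c x y] add \<sigma>)
    then have "cross (g x) (\<sigma> (x + y) c *s (g x + g y)) = cross (g x) (\<sigma> x c *s g x + \<sigma> y c *s g y)"
      "cross (\<sigma> (x + y) c *s (g x + g y)) (g y) = cross (\<sigma> x c *s g x + \<sigma> y c *s g y) (g y)" by simp_all
    then have "\<sigma> (x + y) c *s cross (g x) (g y) = \<sigma> y c *s cross (g x) (g y)"
      "\<sigma> (x + y) c *s cross (g x) (g y) = \<sigma> x c *s cross (g x) (g y)"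
      by (simp_all only: cross_smult cross_add cross_self add_0_left add_0_right vec.scale_zero_right)
    then show ?thesis using indep[OF xy] by (simp only: vec.scale_cancel_right) auto
  qed
  have E1: "E1 \<noteq> (0::'q^3)" by (simp add: vec3_eq)
  have \<sigma>_const: "\<sigma> x c = \<sigma> E1 c" if "x \<noteq> 0" for x c
  proof (cases "cross E1 x = 0")
    case False then show ?thesis using \<sigma>_indep by metis
  next
    case True
    then obtain k where k: "x = k *s E1" using cross_eq_0 E1 by blast
    obtain z where z: "cross (E1::'q^3) z \<noteq> 0" using ex_cross_ne[OF E1] by blast
    have "cross x z \<noteq> 0" using z that unfolding k cross_smult by (simp only: vec.scale_eq_0_iff) simp
    then show ?thesis using \<sigma>_indep z by metis
  qed
  define t where "t = \<sigma> E1"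
  have "g (c *s x) = t c *s g x" for c x
    using \<sigma>[of c x] \<sigma>_const[of x c] g0 by (cases "x = 0") (auto simp: t_def)
  then have sl: "semilinear t g" by (simp add: semilinear_def add)
  have "inj t"
  proof (rule injI)
    fix a b assume "t a = t b"
    then have "g (a *s E1) = g (b *s E1)" by (simp add: \<sigma> t_def)
    then have "a *s E1 = b *s (E1::'q^3)" by (simp only: ge)
    then show "a = b" using E1 by (simp only: vec.scale_cancel_right) simp
  qed
  have t0: "t 0 = 0" using semilinear_smult[OF sl, of 0 E1] g0 g0' E1 by simp
  have t1: "t 1 = 1"
  proof -
    have "t 1 *s g E1 = 1 *s g E1" using semilinear_smult[OF sl, of 1 E1] by simp
    then show ?thesis using g0' E1 by (simp only: vec.scale_cancel_right) simp
  qed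
  have ne: "t omega \<noteq> 0" "t omega \<noteq> 1" "t (omega + 1) \<noteq> 0" "t (omega + 1) \<noteq> 1" "t omega \<noteq> t (omega + 1)"
    using inj_eq[OF \<open>inj t\<close>, of omega 0] inj_eq[OF \<open>inj t\<close>, of omega 1] inj_eq[OF \<open>inj t\<close>, of "omega + 1" 0]
      inj_eq[OF \<open>inj t\<close>, of "omega + 1" 1] inj_eq[OF \<open>inj t\<close>, of omega "omega + 1"] t0 t1
    by (simp_all del: add_cancel_left_right)
  then have "t omega = omega \<and> t (omega + 1) = omega + 1 \<or> t omega = omega + 1 \<and> t (omega + 1) = omega"
    using cases4[of "t omega"] cases4[of "t (omega + 1)"] by auto
  then have "t = id \<or> t = frob"
    using t0 t1 by (auto simp: fun_eq_iff all4)
  then show ?thesis using sl by (auto simp: auts_def)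
qed

text \<open>
  The linear part \<open>g\<close> of an isomorphism acts on blocks through \<open>twist g\<close>, and translations leave
  every set \<open>blocks v\<close> invariant.
\<close>
lemma isomorphic_design_of_iff:
  fixes S S' :: "('q^3) set"
  assumes S: "transversal S" and S': "transversal S'"
  shows "isomorphic_designs (design_of S) (design_of S') \<longleftrightarrow> (\<exists>h \<in> GammaL. S' = h ` S)"
proof
  assume "isomorphic_designs (design_of S) (design_of S')"
  then obtain f :: "'q^3 \<Rightarrow> 'q^3" where f: "bij f" and im: "(\<lambda>B. f ` B) ` blocks_over S = blocks_over S'"
    by (auto simp: isomorphic_designs_def design_of_def)
  have lp: "line_preserving f" by (rule isomorphism_line_preserving[OF f im S S'])
  define g where "g x = f 0 + f x" for x
  have "line_preserving g" unfolding line_preserving_def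
  proof (intro allI)
    fix p q c
    obtain c' where "f (p + c *s (p + q)) + f p = c' *s (f p + f q)"
      using lp unfolding line_preserving_def by blast
    moreover have "g x + g y = f x + f y" for x y by (simp add: g_def ac_simps)
    ultimately show "\<exists>c'. g (p + c *s (p + q)) + g p = c' *s (g p + g q)" by auto
  qed
  moreover have "g 0 = 0" by (simp add: g_def)
  moreover have i: "inj g" using f by (auto simp: g_def bij_def inj_def)
  ultimately obtain t where t: "t \<in> auts" "semilinear t g" using line_preserving_linear by blast
  have gG: "g \<in> GammaL" using t i by (auto simp: GammaL_def bij_def finite_UNIV_inj_surj)
  have fg: "f ` B = (+) (f 0) ` (g ` B)" for B
    by (simp add: g_def image_image)
  have "(\<lambda>B. f ` B) ` blocks v = blocks (twist g v)" for v
  proof -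
    have "(\<lambda>B. f ` B) ` blocks v = (\<lambda>B. (+) (f 0) ` B) ` ((\<lambda>B. g ` B) ` blocks v)"
      unfolding fg by (simp only: image_image)
    also have "\<dots> = (\<lambda>B. (+) (f 0) ` B) ` blocks (twist g v)" by (simp only: image_blocks[OF gG])
    also have "\<dots> = blocks (twist g v)"
    proof (intro equalityI subsetI)
      fix B assume "B \<in> blocks (twist g v)"
      then show "B \<in> (\<lambda>B. (+) (f 0) ` B) ` blocks (twist g v)"
        by (intro image_eqI[of _ _ "(+) (f 0) ` B"]) (auto simp: translate_blocks_iff image_image)
    qed (auto simp: translate_blocks_iff)
    finally show ?thesis .
  qed
  then have "(\<lambda>B. f ` B) ` blocks_over S = blocks_over (twist g ` S)" unfolding blocks_over_def image_UN by simp
  then have "blocks_over S' = blocks_over (twist g ` S)" unfolding im .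
  then have "S' = twist g ` S"
    using blocks_over_inj S' transversal_image[OF twist_GammaL[OF gG] S] by blast
  then show "\<exists>h \<in> GammaL. S' = h ` S" using twist_GammaL[OF gG] by blast
next
  assume "\<exists>h \<in> GammaL. S' = h ` S"
  then obtain h where h: "h \<in> GammaL" "S' = h ` S" by blast
  obtain g where g: "g \<in> GammaL" "twist g = h" using ex_twist[OF h(1)] by blast
  have "(\<lambda>B. g ` B) ` blocks_over S = blocks_over S'"
    unfolding h(2) g(2)[symmetric] blocks_over_def image_UN by (simp add: image_blocks[OF g(1)])
  moreover have "bij g" using g by (simp add: GammaL_def)
  ultimately show "isomorphic_designs (design_of S) (design_of S')"
    by (auto simp: isomorphic_designs_def design_of_def)
qed

end

section \<open>Orbit counting and the size of the semilinear group\<close>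

text \<open>Burnside's lemma for a group of permutations that acts on sets by taking images.\<close>
lemma burnside_image:
  fixes G :: "('a \<Rightarrow> 'a) set" and X :: "'a set set"
  assumes fG: "finite G" and fX: "finite X" and bij: "\<And>g. g \<in> G \<Longrightarrow> bij g"
    and idG: "id \<in> G" and comp: "\<And>g h. g \<in> G \<Longrightarrow> h \<in> G \<Longrightarrow> g \<circ> h \<in> G"
    and invG: "\<And>g. g \<in> G \<Longrightarrow> inv g \<in> G"
    and act: "\<And>g S. g \<in> G \<Longrightarrow> S \<in> X \<Longrightarrow> g ` S \<in> X"
  defines "R \<equiv> {(S, T). S \<in> X \<and> T \<in> X \<and> (\<exists>g\<in>G. T = g ` S)}"
  shows "equiv X R" and "card (X // R) * card G = (\<Sum>g\<in>G. card {S \<in> X. g ` S = S})"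
proof -
  have inv_image: "inv g ` (g ` S) = S" if "g \<in> G" for g S
    using bij[OF that] by (simp add: bij_def image_inv_f_f)
  show eq: "equiv X R"
  proof (rule equivI)
    show "R \<subseteq> X \<times> X" by (auto simp: R_def)
    show "refl_on X R" using idG by (auto simp: refl_on_def R_def intro!: bexI[of _ id])
    show "sym R"
    proof (rule symI)
      fix S T assume "(S, T) \<in> R"
      then obtain g where g: "g \<in> G" "T = g ` S" "S \<in> X" "T \<in> X" by (auto simp: R_def)
      then have "S = inv g ` T" using inv_image by simp
      then show "(T, S) \<in> R" using g invG unfolding R_def by blast
    qed
    show "trans R"
    proof (rule transI)
      fix S T U assume "(S, T) \<in> R" "(T, U) \<in> R"
      then obtain g h where gh: "g \<in> G" "T = g ` S" "h \<in> G" "U = h ` T" "S \<in> X" "U \<in> X"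
        by (auto simp: R_def)
      then have "U = (h \<circ> g) ` S" by (simp add: image_comp)
      then show "(S, U) \<in> R" using gh comp[OF gh(3,1)] unfolding R_def by blast
    qed
  qed
  have cosets: "card {g \<in> G. g ` S = T} = card {g \<in> G. g ` T = T}" if ST: "(S, T) \<in> R" for S T
  proof -
    obtain k where k: "k \<in> G" "T = k ` S" using ST by (auto simp: R_def)
    have bk: "bij k" using bij k by blast
    have "bij_betw (\<lambda>g. g \<circ> k) {g \<in> G. g ` T = T} {g \<in> G. g ` S = T}"
    proof (rule bij_betw_byWitness[where f' = "\<lambda>g. g \<circ> inv k"])
      show "\<forall>g\<in>{g \<in> G. g ` T = T}. g \<circ> k \<circ> inv k = g"
        using bk by (auto simp: fun_eq_iff bij_def surj_f_inv_f)
      show "\<forall>g\<in>{g \<in> G. g ` S = T}. g \<circ> inv k \<circ> k = g"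
        using bk by (auto simp: fun_eq_iff bij_def)
      show "(\<lambda>g. g \<circ> k) ` {g \<in> G. g ` T = T} \<subseteq> {g \<in> G. g ` S = T}"
      proof clarify
        fix g assume "g \<in> G" "g ` T = T"
        then show "g \<circ> k \<in> G \<and> (g \<circ> k) ` S = T"
          using comp[OF _ k(1)] by (simp only: image_comp[symmetric] k(2)[symmetric] simp_thms)
      qed
      show "(\<lambda>g. g \<circ> inv k) ` {g \<in> G. g ` S = T} \<subseteq> {g \<in> G. g ` T = T}"
      proof clarify
        fix g assume g: "g \<in> G" "T = g ` S"
        have "inv k ` T = S" using inv_image[OF k(1), of S] k(2) by simp
        then show "g \<circ> inv k \<in> G \<and> (g \<circ> inv k) ` g ` S = g ` S"
          using comp[OF g(1) invG[OF k(1)]] g(2) by (simp only: image_comp[symmetric] simp_thms)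
      qed
    qed
    then show ?thesis by (simp add: bij_betw_same_card)
  qed
  have orbit: "(\<Sum>T\<in>C. card {g \<in> G. g ` T = T}) = card G" if C: "C \<in> X // R" for C
  proof -
    obtain S where S: "S \<in> X" "C = R `` {S}" using C by (auto elim: quotientE)
    have CX: "C \<subseteq> X" using S by (auto simp: R_def)
    have "(\<Sum>T\<in>C. card {g \<in> G. g ` T = T}) = (\<Sum>T\<in>C. card {g \<in> G. g ` S = T})"
      using S by (intro sum.cong refl cosets[symmetric]) auto
    also have "\<dots> = card (\<Union>T\<in>C. {g \<in> G. g ` S = T})"
      using fG finite_subset[OF CX fX] by (subst card_UN_disjoint) auto
    also have "(\<Union>T\<in>C. {g \<in> G. g ` S = T}) = G"
      using S act by (auto simp: R_def)
    finally show ?thesis .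
  qed
  have "(\<Sum>g\<in>G. card {S \<in> X. g ` S = S}) = (\<Sum>S\<in>X. card {g \<in> G. g ` S = S})"
    by (rule sum_multicount_gen[OF fG fX, where k = "\<lambda>S. card {g \<in> G. g ` S = S}"]) simp
  also have "\<dots> = (\<Sum>C\<in>X // R. \<Sum>S\<in>C. card {g \<in> G. g ` S = S})"
  proof -
    have "(\<Sum>S\<in>\<Union> (X // R). card {g \<in> G. g ` S = S}) = (\<Sum>C\<in>X // R. \<Sum>S\<in>C. card {g \<in> G. g ` S = S})"
    proof (subst sum.Union_disjoint)
      show "\<forall>A\<in>X // R. finite A"
        using in_quotient_imp_subset[OF eq] finite_subset[OF _ fX] by blast
      show "\<forall>A\<in>X // R. \<forall>B\<in>X // R. A \<noteq> B \<longrightarrow> A \<inter> B = {}"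
        using quotient_disj[OF eq] by blast
    qed simp
    then show ?thesis by (simp add: Union_quotient[OF eq])
  qed
  also have "\<dots> = card (X // R) * card G" using orbit by simp
  finally show "card (X // R) * card G = (\<Sum>g\<in>G. card {S \<in> X. g ` S = S})" ..
qed

text \<open>
  The semilinear bijections with a given field automorphism: the linear group for \<open>id\<close>, and
  its other coset in the semilinear group for \<open>frob\<close>.
\<close>
definition GammaL_over :: "('a::field \<Rightarrow> 'a) \<Rightarrow> ('a ^ 3 \<Rightarrow> 'a ^ 3) set" where
  "GammaL_over t = {g. bij g \<and> semilinear t g}"

definition num_fixed :: "('a::field ^ 3 \<Rightarrow> 'a ^ 3) \<Rightarrow> nat" where
  "num_fixed g = card {S. transversal S \<and> g ` S = S}"

definition bases :: "(('a::field ^ 3) \<times> ('a ^ 3) \<times> ('a ^ 3)) set" where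
  "bases = {(a, b, c). det3 a b c \<noteq> 0}"

definition frame :: "('a::field ^ 3) \<times> ('a ^ 3) \<times> ('a ^ 3) \<Rightarrow> 'a ^ 3 \<Rightarrow> 'a ^ 3" where
  "frame = (\<lambda>(a, b, c) x. x$1 *s a + x$2 *s b + x$3 *s c)"

text \<open>
  The map \<open>g\<close> written in the coordinates of the basis \<open>b\<close>.
\<close>
definition in_basis :: "('a::field ^ 3) \<times> ('a ^ 3) \<times> ('a ^ 3) \<Rightarrow> ('a ^ 3 \<Rightarrow> 'a ^ 3) \<Rightarrow> 'a ^ 3 \<Rightarrow> 'a ^ 3" where
  "in_basis b g = inv (frame b) \<circ> g \<circ> frame b"

definition num_cyclic :: "('a::field ^ 3 \<Rightarrow> 'a ^ 3) \<Rightarrow> nat" where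
  "num_cyclic g = card {v. det3 v (g v) (g (g v)) \<noteq> 0}"

definition num_moved :: "('a::field ^ 3 \<Rightarrow> 'a ^ 3) \<Rightarrow> nat" where
  "num_moved g = card {v. cross v (g v) \<noteq> 0}"

context gf4
begin

lemma GammaL_split: "GammaL = GammaL_over id \<union> GammaL_over (frob :: 'q \<Rightarrow> 'q)"
  by (auto simp: GammaL_def GammaL_over_def auts_def)

lemma GammaL_over_disjoint: "GammaL_over id \<inter> GammaL_over (frob :: 'q \<Rightarrow> 'q) = {}"
proof -
  have False if "g \<in> GammaL_over id" "g \<in> GammaL_over (frob :: 'q \<Rightarrow> 'q)" for g
  proof -
    have "omega *s g E1 = (omega + 1) *s g E1"
      using that semilinear_smult[of id g omega E1] semilinear_smult[of frob g omega E1] by (simp add: GammaL_over_def)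
    moreover have "g E1 \<noteq> 0"
    proof
      assume "g E1 = 0"
      then have "g E1 = g 0" using that semilinear_0 by (metis (no_types, lifting) GammaL_over_def mem_Collect_eq)
      then have "E1 = (0::'q^3)" using that by (auto simp: GammaL_over_def bij_def inj_eq)
      then show False by (simp add: vec3_eq)
    qed
    ultimately show False by (simp only: vec.scale_cancel_right) simp
  qed
  then show ?thesis by blast
qed

lemma semilinear_comp: "semilinear t g \<Longrightarrow> semilinear s h \<Longrightarrow> semilinear (t \<circ> s) (g \<circ> h)"
  by (auto simp: semilinear_def)

lemma semilinear_inv:
  assumes t: "t \<in> (auts :: ('q \<Rightarrow> 'q) set)" and g: "semilinear t g" "bij g"
  shows "semilinear t (inv g)"
  unfolding semilinear_def
proof (intro conjI allI)
  have gi: "g (inv g x) = x" for x using g(2) by (simp add: bij_def surj_f_inv_f)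
  have i: "g x = g y \<longleftrightarrow> x = y" for x y using g(2) by (simp add: bij_def inj_eq)
  fix x y :: "'q^3" and c :: 'q
  have "g (inv g (x + y)) = g (inv g x + inv g y)" by (simp only: gi semilinear_add[OF g(1)])
  then show "inv g (x + y) = inv g x + inv g y" by (simp only: i)
  have "g (inv g (c *s x)) = g (t c *s inv g x)"
    by (simp only: gi semilinear_smult[OF g(1)] auts_rules(6)[OF t])
  then show "inv g (c *s x) = t c *s inv g x" by (simp only: i)
qed

lemma frob_id_auts [simp]: "id \<in> auts" "frob \<in> auts"
  by (simp_all add: auts_def)

lemma auts_comp: "t \<in> auts \<Longrightarrow> s \<in> auts \<Longrightarrow> t \<circ> s \<in> (auts :: ('q \<Rightarrow> 'q) set)"
  by (auto simp: auts_def fun_eq_iff)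

lemma GammaL_comp: "g \<in> GammaL \<Longrightarrow> h \<in> GammaL \<Longrightarrow> g \<circ> h \<in> (GammaL :: ('q^3 \<Rightarrow> 'q^3) set)"
  unfolding GammaL_def using semilinear_comp auts_comp bij_comp by blast

lemma GammaL_inv: "g \<in> GammaL \<Longrightarrow> inv g \<in> (GammaL :: ('q^3 \<Rightarrow> 'q^3) set)"
  unfolding GammaL_def using semilinear_inv bij_imp_bij_inv by blast

lemma GammaL_id: "id \<in> (GammaL :: ('q^3 \<Rightarrow> 'q^3) set)"
  by (auto simp: GammaL_def semilinear_def auts_def)

lemma orbit_count:
  "card ({S :: ('q^3) set. transversal S} // {(S, T). transversal S \<and> transversal T \<and> (\<exists>h\<in>GammaL. T = h ` S)}) *
    card (GammaL :: ('q^3 \<Rightarrow> 'q^3) set) = (\<Sum>g\<in>(GammaL :: ('q^3 \<Rightarrow> 'q^3) set). num_fixed g)"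
  "equiv {S :: ('q^3) set. transversal S} {(S, T). transversal S \<and> transversal T \<and> (\<exists>h\<in>GammaL. T = h ` S)}"
proof -
  have *: "bij g" if "g \<in> GammaL" for g :: "'q^3 \<Rightarrow> 'q^3" using that by (simp add: GammaL_def)
  have **: "g ` S \<in> {S. transversal S}" if "g \<in> GammaL" "S \<in> {S :: ('q^3) set. transversal S}" for g S
    using transversal_image that by simp
  note b = burnside_image[OF finite finite * GammaL_id GammaL_comp GammaL_inv **]
  show "card ({S :: ('q^3) set. transversal S} // {(S, T). transversal S \<and> transversal T \<and> (\<exists>h\<in>GammaL. T = h ` S)}) *
    card (GammaL :: ('q^3 \<Rightarrow> 'q^3) set) = (\<Sum>g\<in>(GammaL :: ('q^3 \<Rightarrow> 'q^3) set). num_fixed g)"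
    using b(2) by (simp add: num_fixed_def)
  show "equiv {S :: ('q^3) set. transversal S} {(S, T). transversal S \<and> transversal T \<and> (\<exists>h\<in>GammaL. T = h ` S)}"
    using b(1) by simp
qed

lemma frame_semilinear: "semilinear id (frame (b :: ('q^3) \<times> ('q^3) \<times> ('q^3)))"
  by (cases b) (simp add: frame_def semilinear_def vec3_eq algebra_simps)

lemma frame_E [simp]: "frame (a, b, c) E1 = a" "frame (a, b, c) E2 = b" "frame (a, b, c) E3 = (c :: 'q^3)"
  by (simp_all add: frame_def)

lemma frame_det_map: "det_map (frame (a, b, c)) = det3 a b (c :: 'q^3)"
  by (simp add: det_map_def)

lemma frame_GammaL_over: "b \<in> bases \<Longrightarrow> frame b \<in> GammaL_over (id :: 'q \<Rightarrow> 'q)"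
  unfolding GammaL_over_def using frame_semilinear semilinear_bij[OF _ frame_semilinear, of b]
  by (cases b) (auto simp: bases_def frame_det_map)

lemma frame_expand: "semilinear id g \<Longrightarrow> frame (g E1, g E2, g E3) = (g :: 'q^3 \<Rightarrow> 'q^3)"
  proof (rule ext)
  fix x
  assume s: "semilinear id g"
  show "frame (g E1, g E2, g E3) x = g x"
    unfolding frame_def prod.case using semilinear_expand[OF s, of x] by (simp only: id_apply)
qed

lemma GammaL_over_frame: "bij_betw frame bases (GammaL_over (id :: 'q \<Rightarrow> 'q))"
proof (rule bij_betw_byWitness[where f' = "\<lambda>g. (g E1, g E2, g E3)"])
  show "\<forall>b\<in>bases. (frame b E1, frame b E2, frame b E3) = (b :: ('q^3) \<times> ('q^3) \<times> ('q^3))" by auto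
  show "\<forall>g\<in>GammaL_over id. frame (g E1, g E2, g E3) = (g :: 'q^3 \<Rightarrow> 'q^3)"
    by (simp add: GammaL_over_def frame_expand)
  show "frame ` bases \<subseteq> GammaL_over (id :: 'q \<Rightarrow> 'q)" using frame_GammaL_over by auto
  show "(\<lambda>g. (g E1, g E2, g E3)) ` GammaL_over (id :: 'q \<Rightarrow> 'q) \<subseteq> bases"
  proof clarify
    fix g assume "g \<in> GammaL_over (id :: 'q \<Rightarrow> 'q)"
    then have "det_map g \<noteq> 0" using GammaL_det_map[of g] GammaL_split by blast
    then show "(g E1, g E2, g E3) \<in> bases" by (simp add: bases_def det_map_def)
  qed
qed

lemma card_GammaL_over_frob: "card (GammaL_over (frob :: 'q \<Rightarrow> 'q)) = card (GammaL_over (id :: 'q \<Rightarrow> 'q))"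
proof -
  let ?s = "\<lambda>x :: 'q^3. \<chi> i. frob (x $ i)"
  have s: "semilinear frob ?s" by (simp add: semilinear_def vec3_eq frob_add frob_mult)
  have ss: "?s (?s x) = x" for x by (simp add: vec3_eq)
  then have bs: "bij ?s" by (intro o_bij[of ?s ?s]) (auto simp only: fun_eq_iff o_apply id_apply)
  have ff: "frob \<circ> frob = (id :: 'q \<Rightarrow> 'q)" by (simp add: fun_eq_iff)
  have "bij_betw (\<lambda>g. g \<circ> ?s) (GammaL_over id) (GammaL_over (frob :: 'q \<Rightarrow> 'q))"
  proof (rule bij_betw_byWitness[where f' = "\<lambda>g. g \<circ> ?s"])
    show "\<forall>g\<in>GammaL_over id. g \<circ> ?s \<circ> ?s = g" "\<forall>g\<in>GammaL_over frob. g \<circ> ?s \<circ> ?s = g"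
      using ss by (auto simp: fun_eq_iff)
    show "(\<lambda>g. g \<circ> ?s) ` GammaL_over id \<subseteq> GammaL_over frob"
      using semilinear_comp[OF _ s, of id] bij_comp[OF bs] by (auto simp: GammaL_over_def)
    show "(\<lambda>g. g \<circ> ?s) ` GammaL_over frob \<subseteq> GammaL_over id"
      using semilinear_comp[OF _ s, of frob] bij_comp[OF bs] by (auto simp: GammaL_over_def ff)
  qed
  then show ?thesis by (simp add: bij_betw_same_card)
qed

lemma card_dotp:
  assumes w: "w \<noteq> (0::'q^3)" shows "card {z. dotp z w \<noteq> 0} = 48"
proof -
  obtain y where y: "dotp y w = 1" using ex_dotp1[OF w] by blast
  have fib: "card {z. dotp z w = k} = card {z. dotp z w = 0}" for k
  proof -
    have "{z. dotp z w = k} = (+) (k *s y) ` {z. dotp z w = 0}"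
    proof (intro equalityI subsetI)
      fix z assume "z \<in> {z. dotp z w = k}"
      then show "z \<in> (+) (k *s y) ` {z. dotp z w = 0}"
        using y by (intro image_eqI[of _ _ "k *s y + z"]) (auto simp: dotp_add dotp_smult)
    qed (use y in \<open>auto simp: dotp_add dotp_smult\<close>)
    then show ?thesis by (simp add: card_image)
  qed
  have "(UNIV :: ('q^3) set) = (\<Union>k\<in>(UNIV :: 'q set). {z. dotp z w = k})" by auto
  then have "64 = card (\<Union>k\<in>(UNIV :: 'q set). {z. dotp z w = k})" using card_V by metis
  also have "\<dots> = (\<Sum>k\<in>(UNIV :: 'q set). card {z. dotp z w = k})" by (intro card_UN_disjoint) auto
  also have "\<dots> = (\<Sum>k\<in>(UNIV :: 'q set). card {z. dotp z w = 0})" by (intro sum.cong refl fib)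
  also have "\<dots> = 4 * card {z. dotp z w = 0}" by (simp add: card4)
  finally have "card {z. dotp z w = 0} = 16" by simp
  moreover have "{z. dotp z w \<noteq> 0} = - {z. dotp z w = 0}" by auto
  ultimately show ?thesis by (simp only: card_compl)
qed

lemma det3_rot: "det3 x y z = (det3 z x y :: 'q)"
  by (simp only: det3_swap(2)[of x y z] det3_swap(1)[of x z y])

lemma card_det3:
  assumes "cross x y \<noteq> (0::'q^3)" shows "card {z. det3 x y z \<noteq> 0} = 48"
proof -
  have "{z. det3 x y z \<noteq> 0} = {z. dotp z (cross x y) \<noteq> 0}" by (simp only: det3_rot[of x y]) (simp only: det3_def)
  then show ?thesis by (simp only: card_dotp[OF assms])
qed

lemma card_cross:
  assumes a: "a \<noteq> (0::'q^3)" shows "card {b. cross a b \<noteq> 0} = 60"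
proof -
  have "{b. cross a b = 0} = ray a"
    using cross_eq_0[OF _ a] by (auto simp: ray_def cross_smult)
  moreover have "card (ray a) = 4" using card_coset[OF a, of 0] by (simp add: coset_def)
  moreover have "{b. cross a b \<noteq> 0} = - {b. cross a b = 0}" by auto
  ultimately show ?thesis by (simp only: card_compl)
qed

lemma det3_ne_0: "det3 a b c \<noteq> (0::'q) \<Longrightarrow> a \<noteq> 0 \<and> cross a b \<noteq> 0"
  using det3_rot[of a b c] by (auto simp: det3_def)

lemma card_bases: "card (bases :: (('q^3) \<times> ('q^3) \<times> ('q^3)) set) = 181440"
proof -
  have "bases = (SIGMA a:{a :: 'q^3. a \<noteq> 0}. SIGMA b:{b. cross a b \<noteq> 0}. {c. det3 a b c \<noteq> 0})"
    using det3_ne_0 by (auto simp: bases_def)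
  also have "card \<dots> = (\<Sum>a\<in>{a :: 'q^3. a \<noteq> 0}. \<Sum>b\<in>{b. cross a b \<noteq> 0}. 48)"
    by (simp add: card_SigmaI card_det3)
  also have "\<dots> = (\<Sum>a\<in>{a :: 'q^3. a \<noteq> 0}. 60 * 48)"
    by (intro sum.cong refl) (simp add: card_cross)
  also have "card {a :: 'q^3. a \<noteq> 0} = 63"
  proof -
    have "{a :: 'q^3. a \<noteq> 0} = - {0}" by auto
    then show ?thesis by (simp only: card_compl) simp
  qed
  then have "(\<Sum>a\<in>{a :: 'q^3. a \<noteq> 0}. 60 * 48) = (181440::nat)" by simp
  finally show ?thesis .
qed

lemma card_GammaL_over: "t \<in> auts \<Longrightarrow> card (GammaL_over (t :: 'q \<Rightarrow> 'q)) = 181440"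
  using bij_betw_same_card[OF GammaL_over_frame] card_bases card_GammaL_over_frob by (auto simp: auts_def)

lemma card_GammaL: "card (GammaL :: ('q^3 \<Rightarrow> 'q^3) set) = 362880"
  unfolding GammaL_split using card_GammaL_over GammaL_over_disjoint by (subst card_Un_disjoint) auto

end

section \<open>Summing class functions over normal forms\<close>

text \<open>The maps that are given by a companion matrix with respect to the unit vectors.\<close>
definition companion_forms :: "('a::field \<Rightarrow> 'a) \<Rightarrow> ('a ^ 3 \<Rightarrow> 'a ^ 3) set" where
  "companion_forms t = {g \<in> GammaL_over t. g E1 = E2 \<and> g E2 = E3}"

text \<open>
  Maps without cyclic vector for which \<open>E1\<close> and its image \<open>E2\<close> span an invariant plane.
\<close>
definition planar_forms :: "('a::field \<Rightarrow> 'a) \<Rightarrow> ('a ^ 3 \<Rightarrow> 'a ^ 3) set" where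
  "planar_forms t = {g \<in> GammaL_over t. g E1 = E2 \<and> g E2 $ 3 = 0 \<and> num_cyclic g = 0}"

context gf4
begin

lemma bij_inv_simps:
  assumes "bij p" shows "inv p (p x) = x" "p (inv p x) = x" "inv p ` (p ` X) = X" "p ` (inv p ` X) = X"
  using assms by (auto simp: bij_def surj_f_inv_f image_inv_f_f image_f_inv_f)

lemma GammaL_over_bij: "g \<in> GammaL_over t \<Longrightarrow> bij g"
  by (simp add: GammaL_over_def)

lemma GammaL_over_GammaL: "t \<in> auts \<Longrightarrow> g \<in> GammaL_over t \<Longrightarrow> g \<in> (GammaL :: ('q^3 \<Rightarrow> 'q^3) set)"
  by (auto simp: GammaL_over_def GammaL_def)

lemma GammaL_over_comp: "g \<in> GammaL_over t \<Longrightarrow> h \<in> GammaL_over s \<Longrightarrow> g \<circ> h \<in> GammaL_over (t \<circ> (s :: 'q \<Rightarrow> 'q))"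
  by (auto simp: GammaL_over_def semilinear_comp bij_comp)

lemma GammaL_over_inv: "t \<in> auts \<Longrightarrow> g \<in> GammaL_over t \<Longrightarrow> inv g \<in> GammaL_over (t :: 'q \<Rightarrow> 'q)"
  by (auto simp: GammaL_over_def semilinear_inv bij_imp_bij_inv)

lemma frame_bij: "b \<in> bases \<Longrightarrow> bij (frame (b :: ('q^3) \<times> ('q^3) \<times> ('q^3)))"
  using frame_GammaL_over GammaL_over_bij by blast

lemma in_basis_GammaL_over:
  assumes "b \<in> bases" "g \<in> GammaL_over t" shows "in_basis b g \<in> GammaL_over (t :: 'q \<Rightarrow> 'q)"
proof -
  have "inv (frame b) \<circ> g \<circ> frame b \<in> GammaL_over (id \<circ> t \<circ> id)"
    using assms frame_GammaL_over by (intro GammaL_over_comp GammaL_over_inv) auto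
  then show ?thesis by (simp add: in_basis_def)
qed

lemma in_basis_bij_betw:
  assumes b: "b \<in> bases" shows "bij_betw (in_basis b) (GammaL_over t) (GammaL_over (t :: 'q \<Rightarrow> 'q))"
proof (rule bij_betw_byWitness[where f' = "\<lambda>g. frame b \<circ> g \<circ> inv (frame b)"])
  note s = bij_inv_simps[OF frame_bij[OF b]]
  show "\<forall>g\<in>GammaL_over t. frame b \<circ> in_basis b g \<circ> inv (frame b) = g"
    "\<forall>g\<in>GammaL_over t. in_basis b (frame b \<circ> g \<circ> inv (frame b)) = g"
    by (simp_all add: in_basis_def fun_eq_iff s)
  show "in_basis b ` GammaL_over t \<subseteq> GammaL_over t" using in_basis_GammaL_over[OF b] by blast
  show "(\<lambda>g. frame b \<circ> g \<circ> inv (frame b)) ` GammaL_over t \<subseteq> GammaL_over t"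
  proof clarify
    fix g :: "'q^3 \<Rightarrow> 'q^3" assume g: "g \<in> GammaL_over t"
    have "frame b \<circ> g \<circ> inv (frame b) \<in> GammaL_over (id \<circ> t \<circ> id)"
      using g b frame_GammaL_over by (intro GammaL_over_comp GammaL_over_inv) auto
    then show "frame b \<circ> g \<circ> inv (frame b) \<in> GammaL_over t" by simp
  qed
qed

lemma frame_in_basis: "b \<in> bases \<Longrightarrow> frame b (in_basis b g x) = g (frame (b :: ('q^3) \<times> ('q^3) \<times> ('q^3)) x)"
  by (simp add: in_basis_def bij_inv_simps[OF frame_bij])

lemma frame_det3:
  "det3 (frame b x) (frame b y) (frame b z) = det_map (frame b) * det3 x y (z :: 'q^3)"
  using semilinear_det[OF frame_semilinear] by simp

lemma frame_det_map_ne: "b \<in> bases \<Longrightarrow> det_map (frame (b :: ('q^3) \<times> ('q^3) \<times> ('q^3))) \<noteq> 0"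
  by (cases b) (simp add: frame_det_map bases_def)

lemma frame_cross:
  assumes b: "b \<in> bases" shows "cross (frame b x) (frame b y) = 0 \<longleftrightarrow> cross x (y :: 'q^3) = 0"
proof
  assume 0: "cross x y = 0"
  show "cross (frame b x) (frame b y) = 0"
  proof (rule ccontr)
    assume "cross (frame b x) (frame b y) \<noteq> 0"
    then obtain z where "det3 z (frame b x) (frame b y) = 1" using ex_cross_dotp1 by blast
    then have "det3 (frame b (inv (frame b) z)) (frame b x) (frame b y) = 1"
      by (simp add: bij_inv_simps[OF frame_bij[OF b]])
    then show False using 0 unfolding frame_det3 by (simp add: det3_def)
  qed
next
  assume 0: "cross (frame b x) (frame b y) = 0"
  show "cross x y = 0"
  proof (rule ccontr)
    assume "cross x y \<noteq> 0"
    then obtain z where "det3 z x y = 1" using ex_cross_dotp1 by blast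
    then have "det3 (frame b z) (frame b x) (frame b y) \<noteq> 0"
      unfolding frame_det3 using frame_det_map_ne[OF b] by simp
    then show False using 0 by (simp add: det3_def)
  qed
qed

lemma card_frame_image:
  assumes b: "b \<in> bases" and PQ: "\<And>v. P (frame b v) \<longleftrightarrow> Q v"
  shows "card {v. P v} = card {v :: 'q^3. Q v}"
proof -
  have "{v. P v} = frame b ` {v. Q v}"
  proof (intro equalityI subsetI)
    fix v assume "v \<in> {v. P v}"
    then have "Q (inv (frame b) v)"
      using PQ[of "inv (frame b) v"] by (simp add: bij_inv_simps[OF frame_bij[OF b]])
    then show "v \<in> frame b ` {v. Q v}"
      by (intro image_eqI[of _ _ "inv (frame b) v"]) (simp_all add: bij_inv_simps[OF frame_bij[OF b]])
  qed (auto simp: PQ)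
  then show ?thesis using frame_bij[OF b] by (metis bij_def card_image inj_on_subset subset_UNIV)
qed

lemma num_cyclic_in_basis: "b \<in> bases \<Longrightarrow> num_cyclic (in_basis b g) = num_cyclic (g :: 'q^3 \<Rightarrow> 'q^3)"
  unfolding num_cyclic_def
  by (rule card_frame_image[symmetric], assumption)
    (simp add: frame_in_basis[of b g, symmetric] frame_det3 frame_det_map_ne)

lemma num_moved_in_basis: "b \<in> bases \<Longrightarrow> num_moved (in_basis b g) = num_moved (g :: 'q^3 \<Rightarrow> 'q^3)"
  unfolding num_moved_def
  by (rule card_frame_image[symmetric], assumption) (simp add: frame_in_basis[of b g, symmetric] frame_cross)

lemma num_fixed_in_basis:
  assumes b: "b \<in> bases" shows "num_fixed (in_basis b g) = num_fixed (g :: 'q^3 \<Rightarrow> 'q^3)"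
proof -
  note s = bij_inv_simps[OF frame_bij[OF b]]
  have p: "frame b \<in> GammaL" using frame_GammaL_over[OF b] GammaL_over_GammaL frob_id_auts by blast
  have "bij_betw (\<lambda>S. frame b ` S) {S. transversal S \<and> in_basis b g ` S = S} {S. transversal S \<and> g ` S = S}"
  proof (rule bij_betw_byWitness[where f' = "\<lambda>S. inv (frame b) ` S"])
    show "\<forall>S\<in>{S. transversal S \<and> in_basis b g ` S = S}. inv (frame b) ` frame b ` S = S"
      "\<forall>S\<in>{S. transversal S \<and> g ` S = S}. frame b ` inv (frame b) ` S = S" by (simp_all only: s ball_triv simp_thms)
    show "(\<lambda>S. frame b ` S) ` {S. transversal S \<and> in_basis b g ` S = S} \<subseteq> {S. transversal S \<and> g ` S = S}"
    proof clarify
      fix S :: "('q^3) set" assume S: "transversal S" "in_basis b g ` S = S"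
      have "g ` frame b ` S = frame b ` in_basis b g ` S" by (simp add: image_image frame_in_basis[OF b])
      then show "transversal (frame b ` S) \<and> g ` frame b ` S = frame b ` S"
        using S transversal_image[OF p] by simp
    qed
    show "(\<lambda>S. inv (frame b) ` S) ` {S. transversal S \<and> g ` S = S} \<subseteq> {S. transversal S \<and> in_basis b g ` S = S}"
    proof clarify
      fix S :: "('q^3) set" assume S: "transversal S" "g ` S = S"
      have "in_basis b g ` inv (frame b) ` S = inv (frame b) ` g ` S"
        by (simp add: image_image in_basis_def s)
      then show "transversal (inv (frame b) ` S) \<and> in_basis b g ` inv (frame b) ` S = inv (frame b) ` S"
        using S transversal_image[OF GammaL_inv[OF p]] by simp
    qed
  qed
  then show ?thesis unfolding num_fixed_def by (rule bij_betw_same_card)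
qed

text \<open>
  Double counting: sum \<open>H g\<close> over all pairs of a map \<open>g\<close> and a basis in which \<open>g\<close> has a normal
  form in \<open>N\<close>. Each basis contributes the same, because \<open>g \<mapsto> in_basis b g\<close> is a bijection.
\<close>
lemma normal_form_sum:
  fixes H :: "('q^3 \<Rightarrow> 'q^3) \<Rightarrow> real"
  assumes N: "N \<subseteq> GammaL_over t" and H: "\<And>b g. b \<in> bases \<Longrightarrow> H (in_basis b g) = H g"
  shows "(\<Sum>g\<in>GammaL_over t. H g * real (card {b \<in> bases. in_basis b g \<in> N})) = 181440 * (\<Sum>g\<in>N. H g)"
proof -
  have "(\<Sum>g\<in>GammaL_over t. H g * real (card {b \<in> bases. in_basis b g \<in> N})) =
      (\<Sum>g\<in>GammaL_over t. \<Sum>b\<in>bases. if in_basis b g \<in> N then H g else 0)"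
    by (intro sum.cong refl) (simp add: sum.If_cases Int_def mult.commute)
  also have "\<dots> = (\<Sum>b\<in>bases. \<Sum>g\<in>GammaL_over t. if in_basis b g \<in> N then H (in_basis b g) else 0)"
    by (subst sum.swap) (auto intro!: sum.cong simp: H)
  also have "\<dots> = (\<Sum>b\<in>(bases :: (('q^3) \<times> ('q^3) \<times> ('q^3)) set). \<Sum>g\<in>GammaL_over t. if g \<in> N then H g else 0)"
    by (intro sum.cong refl sum.reindex_bij_betw[OF in_basis_bij_betw, where g="\<lambda>g. if g \<in> N then H g else 0"])
  also have "(\<Sum>g\<in>GammaL_over t. if g \<in> N then H g else 0) = (\<Sum>g\<in>N. H g)"
  proof -
    have "GammaL_over t \<inter> {g. g \<in> N} = N" using N by auto
    then show ?thesis by (simp add: sum.If_cases)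
  qed
  finally show ?thesis by (simp add: card_bases)
qed

lemma in_basis_E:
  assumes b: "(a, b, c) \<in> bases"
  shows "in_basis (a, b, c) g E1 = E2 \<longleftrightarrow> g a = (b :: 'q^3)" "in_basis (a, b, c) g E2 = E3 \<longleftrightarrow> g b = c"
    "in_basis (a, b, c) g E2 $ 3 = 0 \<longleftrightarrow> det3 a b (g b) = 0"
proof -
  have i: "frame (a, b, c) x = frame (a, b, c) y \<longleftrightarrow> x = y" for x y
    using frame_bij[OF b] by (simp add: bij_def inj_eq)
  show "in_basis (a, b, c) g E1 = E2 \<longleftrightarrow> g a = b" "in_basis (a, b, c) g E2 = E3 \<longleftrightarrow> g b = c"
    using i[of "in_basis (a, b, c) g E1" E2] i[of "in_basis (a, b, c) g E2" E3] by (simp_all add: frame_in_basis[OF b])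
  have "det3 a b (g b) = det_map (frame (a, b, c)) * det3 E1 E2 (in_basis (a, b, c) g E2)"
    using frame_det3[of "(a, b, c)" E1 E2 "in_basis (a, b, c) g E2"] by (simp add: frame_in_basis[OF b])
  moreover have "det3 E1 E2 x = x $ 3" for x :: "'q^3" by (simp add: det3_def dotp_def)
  ultimately show "in_basis (a, b, c) g E2 $ 3 = 0 \<longleftrightarrow> det3 a b (g b) = 0"
    using frame_det_map_ne[OF b] by simp
qed

text \<open>
  The bases in which \<open>g\<close> is a companion matrix are \<open>(v, g v, g (g v))\<close>, one for every cyclic
  vector \<open>v\<close>.
\<close>
lemma sum_cyclic:
  "(\<Sum>g\<in>GammaL_over t. if num_cyclic g \<noteq> 0 then real (num_fixed g) else 0) =
    181440 * (\<Sum>g\<in>companion_forms (t :: 'q \<Rightarrow> 'q). real (num_fixed g) / real (num_cyclic g))"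
proof -
  have "card {b \<in> bases. in_basis b g \<in> companion_forms t} = num_cyclic g" if g: "g \<in> GammaL_over t" for g :: "'q^3 \<Rightarrow> 'q^3"
  proof -
    have "{b \<in> bases. in_basis b g \<in> companion_forms t} = (\<lambda>v. (v, g v, g (g v))) ` {v. det3 v (g v) (g (g v)) \<noteq> 0}"
    proof (intro equalityI subsetI)
      fix x assume x: "x \<in> {b \<in> bases. in_basis b g \<in> companion_forms t}"
      obtain a b c where abc: "x = (a, b, c)" by (cases x)
      with x have B: "(a, b, c) \<in> bases" and "in_basis (a, b, c) g \<in> companion_forms t" by auto
      then have "b = g a" "c = g b" by (auto simp: companion_forms_def in_basis_E[OF B])
      then show "x \<in> (\<lambda>v. (v, g v, g (g v))) ` {v. det3 v (g v) (g (g v)) \<noteq> 0}"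
        using B by (auto simp: abc bases_def)
    next
      fix x assume "x \<in> (\<lambda>v. (v, g v, g (g v))) ` {v. det3 v (g v) (g (g v)) \<noteq> 0}"
      then obtain v where x: "x = (v, g v, g (g v))" and B: "(v, g v, g (g v)) \<in> bases"
        by (auto simp: bases_def)
      show "x \<in> {b \<in> bases. in_basis b g \<in> companion_forms t}"
        using in_basis_GammaL_over[OF B g] by (simp add: x B companion_forms_def in_basis_E[OF B])
    qed
    then show ?thesis by (simp add: num_cyclic_def card_image inj_on_def)
  qed
  then have "(\<Sum>g\<in>GammaL_over t. if num_cyclic g \<noteq> 0 then real (num_fixed g) else 0) =
      (\<Sum>g\<in>GammaL_over t. real (num_fixed g) / real (num_cyclic g) * real (card {b \<in> bases. in_basis b g \<in> companion_forms t}))"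
    by (intro sum.cong) auto
  then show ?thesis
    using normal_form_sum[of "companion_forms t" t "\<lambda>g. real (num_fixed g) / real (num_cyclic g)"]
    by (simp add: num_fixed_in_basis num_cyclic_in_basis) (auto simp: companion_forms_def)
qed

text \<open>
  Without cyclic vectors, \<open>g\<close> has a planar form in the bases \<open>(v, g v, u)\<close>; every \<open>v\<close> that is no
  eigenvector admits 48 choices of \<open>u\<close>.
\<close>
lemma sum_planar:
  "(\<Sum>g\<in>GammaL_over t. if num_cyclic g = 0 \<and> num_moved g \<noteq> 0 then real (num_fixed g) else 0) =
    181440 * (\<Sum>g\<in>planar_forms (t :: 'q \<Rightarrow> 'q). real (num_fixed g) / real (48 * num_moved g))"
proof -
  let ?H = "\<lambda>g. if num_cyclic g = 0 then real (num_fixed g) / real (48 * num_moved g) else 0"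
  have W: "card {b \<in> bases. in_basis b g \<in> planar_forms t} = 48 * num_moved g" if g: "g \<in> GammaL_over t" and 0: "num_cyclic g = 0"
    for g :: "'q^3 \<Rightarrow> 'q^3"
  proof -
    have zero: "det3 v (g v) (g (g v)) = 0" for v using 0 by (simp add: num_cyclic_def)
    have "{b \<in> bases. in_basis b g \<in> planar_forms t} = {(v, w, u). w = g v \<and> det3 v (g v) u \<noteq> 0}"
    proof (intro equalityI subsetI)
      fix x assume x: "x \<in> {b \<in> bases. in_basis b g \<in> planar_forms t}"
      obtain a b c where abc: "x = (a, b, c)" by (cases x)
      with x have B: "(a, b, c) \<in> bases" and "in_basis (a, b, c) g \<in> planar_forms t" by auto
      then have "b = g a" by (auto simp: planar_forms_def in_basis_E[OF B])
      then show "x \<in> {(v, w, u). w = g v \<and> det3 v (g v) u \<noteq> 0}"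
        using B by (auto simp: abc bases_def)
    next
      fix x assume "x \<in> {(v, w, u). w = g v \<and> det3 v (g v) u \<noteq> 0}"
      then obtain v u where x: "x = (v, g v, u)" and B: "(v, g v, u) \<in> bases"
        by (auto simp: bases_def)
      show "x \<in> {b \<in> bases. in_basis b g \<in> planar_forms t}"
        using in_basis_GammaL_over[OF B g] 0 by (simp add: x B planar_forms_def in_basis_E[OF B] num_cyclic_in_basis[OF B] zero)
    qed
    also have "\<dots> = (\<lambda>(v, u). (v, g v, u)) ` (SIGMA v:{v. cross v (g v) \<noteq> 0}. {u. det3 v (g v) u \<noteq> 0})"
      using det3_ne_0 by auto
    also have "card \<dots> = card (SIGMA v:{v. cross v (g v) \<noteq> 0}. {u. det3 v (g v) u \<noteq> 0})"
      by (intro card_image inj_onI) auto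
    also have "\<dots> = (\<Sum>v\<in>{v. cross v (g v) \<noteq> 0}. 48)"
      by (simp add: card_SigmaI card_det3)
    finally show ?thesis by (simp add: num_moved_def)
  qed
  have "(\<Sum>g\<in>GammaL_over t. if num_cyclic g = 0 \<and> num_moved g \<noteq> 0 then real (num_fixed g) else 0) =
      (\<Sum>g\<in>GammaL_over t. ?H g * real (card {b \<in> bases. in_basis b g \<in> planar_forms t}))"
    by (intro sum.cong refl) (auto simp: W)
  also have "\<dots> = 181440 * (\<Sum>g\<in>planar_forms t. ?H g)"
    by (rule normal_form_sum) (auto simp: planar_forms_def num_fixed_in_basis num_moved_in_basis num_cyclic_in_basis)
  also have "(\<Sum>g\<in>planar_forms t. ?H g) = (\<Sum>g\<in>planar_forms t. real (num_fixed g) / real (48 * num_moved g))"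
    by (intro sum.cong) (auto simp: planar_forms_def)
  finally show ?thesis .
qed

text \<open>
  All vectors are eigenvectors. A vector \<open>v\<close> of an invariant transversal is fixed, because \<open>g v\<close>
  is the vector chosen on the same subspace.
\<close>
lemma homothety_fixed:
  assumes g: "g \<in> GammaL" and 0: "num_moved g = 0" and F: "num_fixed g \<noteq> 0"
  shows "g = (id :: 'q^3 \<Rightarrow> 'q^3)"
proof -
  obtain t where t: "t \<in> auts" "semilinear t g" and b: "bij g" using g by (auto simp: GammaL_def)
  have "{S. transversal S \<and> g ` S = S} \<noteq> {}" using F by (auto simp: num_fixed_def)
  then obtain S where S: "transversal S" "g ` S = S" by blast
  have cr0: "cross v (g v) = 0" for v using 0 by (simp add: num_moved_def)
  have fixS: "g v = v" if v: "v \<in> S" for v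
  proof -
    have v0: "v \<noteq> 0" using v S by (auto simp: transversal_def)
    obtain k where k: "g v = k *s v" using cross_eq_0[OF cr0 v0] by blast
    have "g v \<in> S" using S v by blast
    then have "g v \<noteq> 0" using S by (auto simp: transversal_def)
    then have "k \<noteq> 0" using k by auto
    moreover have "k *s v \<in> S" "1 *s v \<in> S" using \<open>g v \<in> S\<close> k v by simp_all
    ultimately have "k = 1" using transversalE[OF S(1) v0] by (metis one_neq_zero)
    then show ?thesis using k by simp
  qed
  have tid: "t = id"
  proof (rule ccontr)
    assume "t \<noteq> id"
    then have tf: "t = frob" using t by (simp add: auts_def)
    have E: "E1 \<noteq> (0 :: 'q^3)" "E2 \<noteq> (0 :: 'q^3)" "E1 + E2 \<noteq> (0 :: 'q^3)" "E1 + omega *s E2 \<noteq> (0 :: 'q^3)"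
      by (simp_all add: vec3_eq)
    \<comment> \<open>For \<open>frob\<close>, eigenvectors \<open>E1\<close>, \<open>E2\<close>, \<open>E1 + E2\<close> and \<open>E1 + omega *s E2\<close> contradict each other.\<close>
    obtain k l m n where kl: "g E1 = k *s E1" "g E2 = l *s E2" "g (E1 + E2) = m *s (E1 + E2)"
      "g (E1 + omega *s E2) = n *s (E1 + omega *s E2)"
      using cross_eq_0[OF cr0] E by metis
    have "k *s E1 + l *s E2 = m *s (E1 + (E2 :: 'q^3))"
      using kl(1-3) semilinear_add[OF t(2), of E1 E2] by simp
    then have 1: "k = m" "l = m" by (simp_all add: vec3_eq)
    have "k *s E1 + (omega + 1) *s (l *s E2) = n *s (E1 + omega *s (E2 :: 'q^3))"
      using kl(1,2,4) semilinear_add[OF t(2), of E1 "omega *s E2"] semilinear_smult[OF t(2), of omega E2]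
      by (simp only: tf frob_simps)
    then have 2: "k = n" "(omega + 1) * l = n * omega" by (simp_all add: vec3_eq)
    then have "l = 0" using 1 by (simp add: algebra_simps)
    then have "g E2 = g 0" using kl(2) semilinear_0[OF t(2)] by simp
    then have "E2 = (0 :: 'q^3)" using b by (simp add: bij_def inj_eq)
    then show False using E by simp
  qed
  have "g x = x" for x
  proof (cases "x = 0")
    case True then show ?thesis using semilinear_0[OF t(2)] by simp
  next
    case False
    obtain c where c: "c \<noteq> 0" "c *s x \<in> S" by (rule transversalE[OF S(1) False])
    have "c *s g x = c *s x" using fixS[OF c(2)] semilinear_smult[OF t(2), of c x] tid by simp
    then show ?thesis using c(1) by (simp only: vec.scale_cancel_left) simp
  qed
  then show ?thesis by auto
qed

lemma num_fixed_total:
  "real (\<Sum>g\<in>(GammaL :: ('q^3 \<Rightarrow> 'q^3) set). num_fixed g) = real (num_fixed (id :: 'q^3 \<Rightarrow> 'q^3)) +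
    181440 * (\<Sum>t\<in>auts. (\<Sum>g\<in>companion_forms (t :: 'q \<Rightarrow> 'q). real (num_fixed g) / real (num_cyclic g)) +
      (\<Sum>g\<in>planar_forms t. real (num_fixed g) / real (48 * num_moved g)))"
proof -
  have nc: "num_cyclic g = 0" if "num_moved g = 0" for g :: "'q^3 \<Rightarrow> 'q^3"
    using that det3_ne_0 by (auto simp: num_moved_def num_cyclic_def)
  have nid: "num_moved (id :: 'q^3 \<Rightarrow> 'q^3) = 0" by (simp add: num_moved_def)
  \<comment> \<open>Homotheties other than the identity contribute nothing, and homotheties have no cyclic vectors.\<close>
  have split: "real (num_fixed g) = (if g = id then real (num_fixed g) else 0) + (if num_cyclic g \<noteq> 0 then real (num_fixed g) else 0) +
      (if num_cyclic g = 0 \<and> num_moved g \<noteq> 0 then real (num_fixed g) else 0)" if "g \<in> GammaL" for g :: "'q^3 \<Rightarrow> 'q^3"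
    using homothety_fixed[OF that] nc[of g] nc[OF nid] nid by auto
  have tau_sum: "(\<Sum>g\<in>(GammaL :: ('q^3 \<Rightarrow> 'q^3) set). f g) = (\<Sum>t\<in>auts. \<Sum>g\<in>GammaL_over t. f g)"
    for f :: "('q^3 \<Rightarrow> 'q^3) \<Rightarrow> real"
  proof -
    have ne: "(id :: 'q \<Rightarrow> 'q) \<noteq> frob"
    proof
      assume "(id :: 'q \<Rightarrow> 'q) = frob"
      then have "id omega = (frob omega :: 'q)" by simp
      then show False by simp
    qed
    show ?thesis unfolding GammaL_split auts_def using GammaL_over_disjoint ne by (simp add: sum.union_disjoint)
  qed
  have "real (\<Sum>g\<in>(GammaL :: ('q^3 \<Rightarrow> 'q^3) set). num_fixed g) =
      (\<Sum>g\<in>(GammaL :: ('q^3 \<Rightarrow> 'q^3) set). if g = id then real (num_fixed g) else 0) +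
      (\<Sum>g\<in>(GammaL :: ('q^3 \<Rightarrow> 'q^3) set). if num_cyclic g \<noteq> 0 then real (num_fixed g) else 0) +
      (\<Sum>g\<in>(GammaL :: ('q^3 \<Rightarrow> 'q^3) set). if num_cyclic g = 0 \<and> num_moved g \<noteq> 0 then real (num_fixed g) else 0)"
    unfolding of_nat_sum by (subst sum.cong[OF refl split], assumption) (simp only: sum.distrib)
  also have "(\<Sum>g\<in>(GammaL :: ('q^3 \<Rightarrow> 'q^3) set). if g = id then real (num_fixed g) else 0) = real (num_fixed (id :: 'q^3 \<Rightarrow> 'q^3))"
    using GammaL_id by simp
  finally show ?thesis
    unfolding tau_sum sum_cyclic sum_planar
    by (simp only: sum.distrib sum_distrib_left distrib_left add.assoc)
qed

end

section \<open>Transversals fixed by a semilinear map\<close>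

definition scalings :: "('a::field ^ 3) set \<Rightarrow> ('a ^ 3) set" where
  "scalings X = {c *s y | c y. c \<noteq> 0 \<and> y \<in> X}"

definition orbit :: "('a \<Rightarrow> 'a) \<Rightarrow> 'a \<Rightarrow> 'a set" where
  "orbit g u = range (\<lambda>n. (g ^^ n) u)"

text \<open>
  The \<open>g\<close>-invariant partial transversals that cover exactly the one-dimensional subspaces
  inside of \<open>R\<close>.
\<close>
definition fixed_on :: "('a::field ^ 3 \<Rightarrow> 'a ^ 3) \<Rightarrow> ('a ^ 3) set \<Rightarrow> ('a ^ 3) set set" where
  "fixed_on g R = {S. S \<subseteq> R \<and> g ` S = S \<and> (\<forall>x\<in>R. \<exists>!c. c \<noteq> 0 \<and> c *s x \<in> S)}"

text \<open>
  No power of \<open>g\<close> maps \<open>u\<close> to a proper multiple of \<open>u\<close>. Only then can the orbit of \<open>u\<close> be part of a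
  transversal.
\<close>
definition tame :: "('a::field ^ 3 \<Rightarrow> 'a ^ 3) \<Rightarrow> 'a ^ 3 \<Rightarrow> bool" where
  "tame g u \<longleftrightarrow> (\<forall>d. d \<noteq> 0 \<longrightarrow> d *s u \<in> orbit g u \<longrightarrow> d = 1)"

lemma orbit_self: "u \<in> orbit g u"
  unfolding orbit_def by (rule range_eqI[of _ _ 0]) simp

lemma orbit_step: "y \<in> orbit g u \<Longrightarrow> g y \<in> orbit g u"
  unfolding orbit_def by (auto intro: range_eqI[of _ _ "Suc _"])

lemma orbit_subset:
  assumes "u \<in> S" "\<And>x. x \<in> S \<Longrightarrow> g x \<in> S" shows "orbit g u \<subseteq> S"
proof -
  have "(g ^^ n) u \<in> S" for n by (induction n) (auto simp: assms)
  then show ?thesis by (auto simp: orbit_def)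
qed

text \<open>Orbits of a permutation of a finite set are cycles.\<close>
lemma orbit_back:
  fixes g :: "'a::finite \<Rightarrow> 'a"
  assumes "inj g" "z \<in> orbit g u" shows "u \<in> orbit g z"
proof -
  obtain n where n: "z = (g ^^ n) u" using assms(2) by (auto simp: orbit_def)
  obtain N where N: "N > 0" "(g ^^ N) u = u" using funpow_inj_finite[OF assms(1), of u] by auto
  have rep: "(g ^^ (n * N)) u = u"
  proof (induction n)
    case (Suc n)
    have "(g ^^ (Suc n * N)) u = (g ^^ N) ((g ^^ (n * N)) u)" by (simp add: funpow_add)
    then show ?case using Suc N by simp
  qed simp
  \<comment> \<open>Rotating \<open>n * N - n\<close> steps further from \<open>z\<close> completes \<open>n\<close> full periods.\<close>
  have "n \<le> n * N" using N by simp
  then have "(g ^^ (n * N - n)) z = (g ^^ (n * N - n + n)) u" unfolding n by (simp only: funpow_add o_apply)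
  also have "\<dots> = u" using rep \<open>n \<le> n * N\<close> by simp
  finally have "u = (g ^^ (n * N - n)) z" by simp
  then show ?thesis unfolding orbit_def by (rule range_eqI)
qed

lemma image_closed_eq:
  assumes "inj g" "finite S" "g ` S \<subseteq> S" shows "g ` S = S"
  using assms by (intro card_subset_eq) (auto simp: card_image inj_on_subset[OF _ subset_UNIV])

context gf4
begin

lemma funpow_semilinear:
  assumes t: "t \<in> auts" "semilinear t g"
  shows "\<exists>s \<in> (auts :: ('q \<Rightarrow> 'q) set). semilinear s (g ^^ n)"
proof (induction n)
  case 0
  then show ?case by (intro bexI[of _ id]) (auto simp: semilinear_def)
next
  case (Suc n)
  then obtain s where "s \<in> auts" "semilinear s (g ^^ n)" by blast
  then show ?case using auts_comp[OF t(1)] semilinear_comp[OF t(2)]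
    by (intro bexI[of _ "t \<circ> s"]) (simp_all only: funpow.simps)
qed

lemma scalings_smult: "y \<in> scalings X \<Longrightarrow> c \<noteq> 0 \<Longrightarrow> c *s y \<in> scalings (X :: ('q^3) set)"
  unfolding scalings_def by clarsimp (metis mult_eq_0_iff)

lemma scalings_smult_iff: "c \<noteq> 0 \<Longrightarrow> c *s y \<in> scalings X \<longleftrightarrow> y \<in> scalings (X :: ('q^3) set)"
proof
  assume c: "c \<noteq> 0" "c *s y \<in> scalings X"
  then have "inverse c *s (c *s y) \<in> scalings X" by (intro scalings_smult[OF c(2)]) simp
  then show "y \<in> scalings X"
    using c(1) by (simp only: vec.scale_scale left_inverse vec.scale_one not_False_eq_True)
qed (rule scalings_smult)

lemma scalings_sup: "X \<subseteq> scalings (X :: ('q^3) set)"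
  unfolding scalings_def by clarify (metis vec.scale_one one_neq_zero)

lemma scalings_orbit_smult:
  assumes g: "g \<in> GammaL" and c: "c \<noteq> 0"
  shows "scalings (orbit g (c *s u)) \<subseteq> scalings (orbit g (u :: 'q^3))"
proof
  obtain t where t: "t \<in> auts" "semilinear t g" using g by (auto simp: GammaL_def)
  fix y assume "y \<in> scalings (orbit g (c *s u))"
  then obtain e n where e: "e \<noteq> 0" "y = e *s (g ^^ n) (c *s u)" by (auto simp: scalings_def orbit_def)
  obtain s where s: "s \<in> auts" "semilinear s (g ^^ n)" using funpow_semilinear[OF t] by blast
  have "y = (e * s c) *s (g ^^ n) u" by (simp add: e semilinear_smult[OF s(2)])
  moreover have "e * s c \<noteq> 0" using e c auts_rules(7)[OF s(1)] by simp
  ultimately show "y \<in> scalings (orbit g u)" unfolding scalings_def orbit_def by blast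
qed

lemma scalings_orbit_eq:
  assumes g: "g \<in> GammaL" and c: "c \<noteq> 0"
  shows "scalings (orbit g (c *s u)) = scalings (orbit g (u :: 'q^3))"
proof
  have "scalings (orbit g (inverse c *s (c *s u))) \<subseteq> scalings (orbit g (c *s u))"
    using c by (intro scalings_orbit_smult[OF g]) auto
  then show "scalings (orbit g u) \<subseteq> scalings (orbit g (c *s u))" using c by simp
qed (rule scalings_orbit_smult[OF assms])

text \<open>
  An invariant transversal contains one of the three multiples \<open>c *s p\<close> and with it the orbit
  of \<open>c *s p\<close>, and this settles all subspaces that \<open>g\<close> reaches from \<open>p\<close>. The rest is an arbitrary
  invariant transversal of \<open>R - Q\<close>.
\<close>
lemma fixed_on_split:
  assumes g: "g \<in> GammaL" and R: "g ` R = R" "0 \<notin> R" "scalings R \<subseteq> R" and p: "p \<in> R"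
  defines "Q \<equiv> scalings (orbit g (p :: 'q^3))"
  shows "g ` (R - Q) = R - Q" "scalings (R - Q) \<subseteq> R - Q"
    "card (fixed_on g R) = card {c. c \<noteq> 0 \<and> tame g (c *s p)} * card (fixed_on g (R - Q))"
proof -
  obtain t where t: "t \<in> auts" "semilinear t g" and b: "bij g" using g by (auto simp: GammaL_def)
  have i: "inj g" using b by (simp add: bij_def)
  have gR: "x \<in> R \<Longrightarrow> g x \<in> R" for x using R by blast
  have sR: "x \<in> R \<Longrightarrow> c \<noteq> 0 \<Longrightarrow> c *s x \<in> R" for c x using R(3) by (auto simp: scalings_def)
  have OR: "u \<in> R \<Longrightarrow> orbit g u \<subseteq> R" for u by (erule orbit_subset) (erule gR)
  have QR: "Q \<subseteq> R" using OR[OF p] sR by (auto simp: Q_def scalings_def)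
  have "g ` Q \<subseteq> Q"
  proof clarify
    fix y assume "y \<in> Q"
    then obtain c z where "y = c *s z" "c \<noteq> 0" "z \<in> orbit g p" by (auto simp: Q_def scalings_def)
    then have "g y = t c *s g z" "t c \<noteq> 0" "g z \<in> orbit g p"
      using auts_rules(7)[OF t(1)] by (simp_all add: semilinear_smult[OF t(2)] orbit_step)
    then show "g y \<in> Q" unfolding Q_def scalings_def by blast
  qed
  then have gQ: "g ` Q = Q" by (rule image_closed_eq[OF i finite])
  show gD: "g ` (R - Q) = R - Q" by (simp add: image_set_diff[OF i] R gQ)
  have cQ: "c \<noteq> 0 \<Longrightarrow> c *s x \<in> Q \<longleftrightarrow> x \<in> Q" for c x unfolding Q_def by (rule scalings_smult_iff)
  show "scalings (R - Q) \<subseteq> R - Q"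
    using sR cQ by (auto simp: scalings_def)
  have gO: "g ` orbit g u = orbit g u" for u
    by (rule image_closed_eq[OF i finite]) (auto intro: orbit_step)
  have OQ: "orbit g (c *s p) \<subseteq> Q" if "c \<noteq> 0" for c
    using scalings_sup scalings_orbit_eq[OF g that] unfolding Q_def by blast
  have QO: "\<exists>e z. e \<noteq> 0 \<and> z \<in> orbit g (c *s p) \<and> y = e *s z" if "c \<noteq> 0" "y \<in> Q" for c y
    using that scalings_orbit_eq[OF g that(1), of p] unfolding Q_def scalings_def by blast
  have tame_unique: "d = 1" if tm: "tame g (c *s p)" and z: "z \<in> orbit g (c *s p)"
      and d: "d \<noteq> 0" "d *s z \<in> orbit g (c *s p)" for c d z
  proof -
    have "c *s p \<in> orbit g z" by (rule orbit_back[OF i z])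
    then obtain k where k: "c *s p = (g ^^ k) z" by (auto simp: orbit_def)
    obtain s where s: "s \<in> auts" "semilinear s (g ^^ k)" using funpow_semilinear[OF t] by blast
    have "(g ^^ k) (d *s z) \<in> orbit g (c *s p)"
      by (induction k) (auto simp: d orbit_step)
    then have "s d *s (c *s p) \<in> orbit g (c *s p)" by (simp only: semilinear_smult[OF s(2)] k[symmetric])
    then have "s d = 1" using tm d auts_rules(7)[OF s(1)] by (auto simp: tame_def)
    then show "d = 1" by (metis auts_rules(4,6)[OF s(1)])
  qed
  define start where "start S = (THE c. c \<noteq> 0 \<and> c *s p \<in> S)" for S :: "('q^3) set"
  let ?K = "{c. c \<noteq> 0 \<and> tame g (c *s p)}"
  have st: "start S \<noteq> 0" "start S *s p \<in> S" "\<And>c. c \<noteq> 0 \<Longrightarrow> c *s p \<in> S \<Longrightarrow> start S = c"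
    if "\<exists>!c. c \<noteq> 0 \<and> c *s p \<in> S" for S
  proof -
    have "start S \<noteq> 0 \<and> start S *s p \<in> S" unfolding start_def by (rule theI'[OF that])
    then show "start S \<noteq> 0" "start S *s p \<in> S" by simp_all
    show "start S = c" if "c \<noteq> 0" "c *s p \<in> S" for c
      unfolding start_def by (rule the1_equality[OF \<open>\<exists>!c. c \<noteq> 0 \<and> c *s p \<in> S\<close>]) (use that in blast)
  qed
  have A: "start S \<in> ?K \<and> S - Q \<in> fixed_on g (R - Q) \<and> (S - Q) \<union> orbit g (start S *s p) = S"
    if S: "S \<in> fixed_on g R" for S
  proof -
    have SR: "S \<subseteq> R" and gS: "g ` S = S" and uS: "\<And>x. x \<in> R \<Longrightarrow> \<exists>!c. c \<noteq> 0 \<and> c *s x \<in> S"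
      using S by (auto simp: fixed_on_def)
    have u1: "d = 1" if "x \<in> S" "d \<noteq> 0" "d *s x \<in> S" for x d
    proof -
      have "\<exists>!c. c \<noteq> 0 \<and> c *s x \<in> S" by (rule uS) (use that(1) SR in blast)
      moreover have "1 *s x \<in> S" using that by simp
      ultimately show ?thesis using that by (metis one_neq_zero)
    qed
    note sS = st[OF uS[OF p]]
    have OS: "orbit g (start S *s p) \<subseteq> S"
      using sS(2) gS by (intro orbit_subset) auto
    have "tame g (start S *s p)"
      unfolding tame_def
    proof (intro allI impI)
      fix d assume "d \<noteq> 0" "d *s (start S *s p) \<in> orbit g (start S *s p)"
      then show "d = 1" using u1[OF sS(2), of d] OS by (meson subsetD)
    qed
    moreover have "S - Q \<in> fixed_on g (R - Q)"
      unfolding fixed_on_def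
    proof (intro CollectI conjI ballI)
      show "S - Q \<subseteq> R - Q" using SR by blast
      show "g ` (S - Q) = S - Q" by (simp add: image_set_diff[OF i] gS gQ)
      fix x assume x: "x \<in> R - Q"
      then have xR: "x \<in> R" "x \<notin> Q" by auto
      have eq: "c \<noteq> 0 \<and> c *s x \<in> S - Q \<longleftrightarrow> c \<noteq> 0 \<and> c *s x \<in> S" for c
        using xR cQ[of c x] by blast
      show "\<exists>!c. c \<noteq> 0 \<and> c *s x \<in> S - Q" unfolding eq by (rule uS[OF xR(1)])
    qed
    moreover have "S \<inter> Q \<subseteq> orbit g (start S *s p)"
    proof
      fix y assume y: "y \<in> S \<inter> Q"
      then obtain e z where ez: "e \<noteq> 0" "z \<in> orbit g (start S *s p)" "y = e *s z"
        using QO[OF sS(1)] by blast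
      then have "e = 1" using u1[of z e] OS y by blast
      then show "y \<in> orbit g (start S *s p)" using ez by simp
    qed
    ultimately show ?thesis using sS(1) OS by blast
  qed
  have B: "S' \<union> orbit g (c *s p) \<in> fixed_on g R \<and> start (S' \<union> orbit g (c *s p)) = c \<and>
      (S' \<union> orbit g (c *s p)) - Q = S'"
    if c: "c \<in> ?K" and S': "S' \<in> fixed_on g (R - Q)" for c S'
  proof -
    let ?S = "S' \<union> orbit g (c *s p)"
    have c0: "c \<noteq> 0" and tm: "tame g (c *s p)" using c by auto
    have SR: "S' \<subseteq> R - Q" and gS: "g ` S' = S'"
      and uS: "\<And>x. x \<in> R - Q \<Longrightarrow> \<exists>!c. c \<noteq> 0 \<and> c *s x \<in> S'"
      using S' by (auto simp: fixed_on_def)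
    have Su: "\<exists>!d. d \<noteq> 0 \<and> d *s x \<in> ?S" if x: "x \<in> R" for x
    proof (cases "x \<in> Q")
      case False
      then have eq: "d \<noteq> 0 \<and> d *s x \<in> ?S \<longleftrightarrow> d \<noteq> 0 \<and> d *s x \<in> S'" for d
        using cQ[of d x] OQ[OF c0] by blast
      show ?thesis unfolding eq by (rule uS) (simp add: x False)
    next
      case True
      then obtain e z where ez: "e \<noteq> 0" "z \<in> orbit g (c *s p)" "x = e *s z"
        using QO[OF c0] by blast
      have *: "d \<noteq> 0 \<and> d *s x \<in> ?S \<longleftrightarrow> d \<noteq> 0 \<and> d *s x \<in> orbit g (c *s p)" for d
        using True cQ[of d x] SR by blast
      show ?thesis
        unfolding *
      proof (intro ex1I[of _ "inverse e"] conjI)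
        show "inverse e \<noteq> 0" "inverse e *s x \<in> orbit g (c *s p)" using ez by simp_all
        fix d assume d: "d \<noteq> 0 \<and> d *s x \<in> orbit g (c *s p)"
        then have "d * e = 1" using tame_unique[OF tm ez(2), of "d * e"] ez by simp
        then show "d = inverse e" using ez(1) by (simp add: field_simps)
      qed
    qed
    have "?S \<in> fixed_on g R"
      unfolding fixed_on_def
    proof (intro CollectI conjI ballI Su)
      show "?S \<subseteq> R" using SR OQ[OF c0] QR by blast
      show "g ` ?S = ?S" by (simp add: image_Un gS gO)
    qed
    moreover have "start ?S = c" by (rule st(3)[OF Su[OF p] c0]) (simp add: orbit_self)
    moreover have "?S - Q = S'" using SR OQ[OF c0] by blast
    ultimately show ?thesis by blast
  qed
  have "bij_betw (\<lambda>(c, S'). S' \<union> orbit g (c *s p)) (?K \<times> fixed_on g (R - Q)) (fixed_on g R)"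
    by (rule bij_betw_byWitness[where f' = "\<lambda>S. (start S, S - Q)"]) (use A B in \<open>auto split: prod.splits\<close>)
  then show "card (fixed_on g R) = card ?K * card (fixed_on g (R - Q))"
    by (simp add: bij_betw_same_card[symmetric] card_cartesian_product)
qed

lemma num_fixed_fixed_on: "num_fixed g = card (fixed_on g (- {0 :: 'q^3}))"
proof -
  have "{S. transversal S \<and> g ` S = S} = fixed_on g (- {0})" by (auto simp: transversal_def fixed_on_def)
  then show ?thesis by (simp add: num_fixed_def)
qed

end

section \<open>Evaluation in coordinates\<close>

text \<open>
  A copy of the field whose elements are constructors, for evaluation by rewriting: \<open>F2\<close> and
  \<open>F3\<close> stand for \<open>omega\<close> and \<open>omega + 1\<close>.
\<close>
datatype gf = F0 | F1 | F2 | F3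

fun gadd :: "gf \<Rightarrow> gf \<Rightarrow> gf" where
  "gadd F0 y = y"
| "gadd F1 F0 = F1" | "gadd F1 F1 = F0" | "gadd F1 F2 = F3" | "gadd F1 F3 = F2"
| "gadd F2 F0 = F2" | "gadd F2 F1 = F3" | "gadd F2 F2 = F0" | "gadd F2 F3 = F1"
| "gadd F3 F0 = F3" | "gadd F3 F1 = F2" | "gadd F3 F2 = F1" | "gadd F3 F3 = F0"

fun gmul :: "gf \<Rightarrow> gf \<Rightarrow> gf" where
  "gmul F0 y = F0" | "gmul F1 y = y"
| "gmul F2 F0 = F0" | "gmul F2 F1 = F2" | "gmul F2 F2 = F3" | "gmul F2 F3 = F1"
| "gmul F3 F0 = F0" | "gmul F3 F1 = F3" | "gmul F3 F2 = F1" | "gmul F3 F3 = F2"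

text \<open>The flag selects between the identity and \<open>frob\<close>.\<close>
fun gtau :: "bool \<Rightarrow> gf \<Rightarrow> gf" where
  "gtau False x = x"
| "gtau True F0 = F0" | "gtau True F1 = F1" | "gtau True F2 = F3" | "gtau True F3 = F2"

datatype gv = V gf gf gf

fun vadd :: "gv \<Rightarrow> gv \<Rightarrow> gv" where
  "vadd (V a b c) (V x y z) = V (gadd a x) (gadd b y) (gadd c z)"

fun vsm :: "gf \<Rightarrow> gv \<Rightarrow> gv" where
  "vsm k (V a b c) = V (gmul k a) (gmul k b) (gmul k c)"

fun vdet :: "gv \<Rightarrow> gv \<Rightarrow> gv \<Rightarrow> gf" where
  "vdet (V a b c) (V p q r) (V x y z) =
    gadd (gmul a (gadd (gmul q z) (gmul r y)))
      (gadd (gmul b (gadd (gmul r x) (gmul p z))) (gmul c (gadd (gmul p y) (gmul q x))))"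

fun vmap :: "bool \<Rightarrow> gv \<times> gv \<times> gv \<Rightarrow> gv \<Rightarrow> gv" where
  "vmap t (m1, m2, m3) (V a b c) =
    vadd (vsm (gtau t a) m1) (vadd (vsm (gtau t b) m2) (vsm (gtau t c) m3))"

definition gfs :: "gf list" where "gfs = [F0, F1, F2, F3]"

definition units :: "gf list" where "units = [F1, F2, F3]"

definition allv :: "gv list" where
  "allv = map (\<lambda>(a, b, c). V a b c) (List.product gfs (List.product gfs gfs))"

definition nzv :: "gv list" where
  "nzv = tl allv"

primrec vmem :: "gv \<Rightarrow> gv list \<Rightarrow> bool" where
  "vmem x [] = False"
| "vmem x (y # ys) = (if x = y then True else vmem x ys)"

primrec vdel :: "gv list \<Rightarrow> gv list \<Rightarrow> gv list" where
  "vdel [] N = []"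
| "vdel (p # ps) N = (if vmem p N then vdel ps N else p # vdel ps N)"

text \<open>
  The cycle of \<open>u\<close>, continued from \<open>x\<close>. The first list only bounds the number of steps.
\<close>
primrec orbit_list :: "gv list \<Rightarrow> (gv \<Rightarrow> gv) \<Rightarrow> gv \<Rightarrow> gv \<Rightarrow> gv list" where
  "orbit_list [] h u x = []"
| "orbit_list (f # fs) h u x = x # (if h x = u then [] else orbit_list fs h u (h x))"

definition scal_list :: "gv list \<Rightarrow> gv list" where
  "scal_list C = C @ (map (vsm F2) C @ map (vsm F3) C)"

text \<open>
  The list \<open>C\<close> is meant to be the cycle of \<open>u\<close>; the value is 1 if \<open>u\<close> is tame and 0 otherwise.
  Integers, unlike natural numbers, are evaluated in binary.
\<close>
definition tame_count :: "gv \<Rightarrow> gv list \<Rightarrow> int" where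
  "tame_count u C = (if vmem (vsm F2 u) C then 0 else if vmem (vsm F3 u) C then 0 else 1)"

text \<open>
  The number of multiples of \<open>p\<close> from which an invariant transversal can start.
\<close>
definition starts :: "(gv \<Rightarrow> gv) \<Rightarrow> gv \<Rightarrow> int" where
  "starts h p = tame_count p (orbit_list allv h p p) + (tame_count (vsm F2 p) (orbit_list allv h (vsm F2 p) (vsm F2 p)) +
    tame_count (vsm F3 p) (orbit_list allv h (vsm F3 p) (vsm F3 p)))"

text \<open>
  The recursion of \<open>fixed_on_split\<close>: \<open>R\<close> holds the vectors not yet settled, the first list the
  candidates for the next start.
\<close>
primrec fixed_count :: "(gv \<Rightarrow> gv) \<Rightarrow> gv list \<Rightarrow> gv list \<Rightarrow> int" where
  "fixed_count h [] R = 1"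
| "fixed_count h (p # ps) R =
    (if vmem p R then
       if starts h p = 0 then 0
       else starts h p * fixed_count h ps (vdel R (scal_list (orbit_list allv h p p)))
     else fixed_count h ps R)"

primrec cyclic_count :: "(gv \<Rightarrow> gv) \<Rightarrow> gv list \<Rightarrow> int" where
  "cyclic_count h [] = 0"
| "cyclic_count h (v # vs) = (if vdet v (h v) (h (h v)) = F0 then cyclic_count h vs else 1 + cyclic_count h vs)"

primrec has_cyclic :: "(gv \<Rightarrow> gv) \<Rightarrow> gv list \<Rightarrow> bool" where
  "has_cyclic h [] = False"
| "has_cyclic h (v # vs) = (if vdet v (h v) (h (h v)) = F0 then has_cyclic h vs else True)"

primrec moved_count :: "(gv \<Rightarrow> gv) \<Rightarrow> gv list \<Rightarrow> int" where
  "moved_count h [] = 0"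
| "moved_count h (v # vs) = (if vmem (h v) (scal_list [v]) then moved_count h vs else 1 + moved_count h vs)"

definition companion_list :: "(gv \<times> gv \<times> gv) list" where
  "companion_list = map (\<lambda>(a, b, c). (V F0 F1 F0, V F0 F0 F1, V a b c))
    (List.product units (List.product gfs gfs))"

definition planar_list :: "(gv \<times> gv \<times> gv) list" where
  "planar_list = map (\<lambda>(a, b, x, y, z). (V F0 F1 F0, V a b F0, V x y z))
    (List.product units (List.product gfs (List.product gfs (List.product gfs units))))"

text \<open>
  One row for each companion matrix that fixes a transversal: the number of fixed
  transversals and the number of cyclic vectors.
\<close>
primrec companion_rows :: "bool \<Rightarrow> (gv \<times> gv \<times> gv) list \<Rightarrow> (int \<times> int) list" where
  "companion_rows t [] = []"
| "companion_rows t (m # ms) = (if fixed_count (vmap t m) nzv nzv = 0 then companion_rows t ms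
     else (fixed_count (vmap t m) nzv nzv, cyclic_count (vmap t m) nzv) # companion_rows t ms)"

text \<open>
  One row for each planar form that fixes a transversal: the number of fixed transversals
  and the number of vectors that are no eigenvectors.
\<close>
primrec planar_rows :: "bool \<Rightarrow> (gv \<times> gv \<times> gv) list \<Rightarrow> (int \<times> int) list" where
  "planar_rows t [] = []"
| "planar_rows t (m # ms) = (if has_cyclic (vmap t m) nzv then planar_rows t ms
     else if fixed_count (vmap t m) nzv nzv = 0 then planar_rows t ms
     else (fixed_count (vmap t m) nzv nzv, moved_count (vmap t m) nzv) # planar_rows t ms)"

definition fval :: "gf \<Rightarrow> 'a::field" where
  "fval a = (case a of F0 \<Rightarrow> 0 | F1 \<Rightarrow> 1 | F2 \<Rightarrow> omega | F3 \<Rightarrow> omega + 1)"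

definition vval :: "gv \<Rightarrow> 'a::field ^ 3" where
  "vval v = (case v of V a b c \<Rightarrow> vector [fval a, fval b, fval c])"

definition semimap :: "('a \<Rightarrow> 'a) \<Rightarrow> ('a::field ^ 3) \<times> ('a ^ 3) \<times> ('a ^ 3) \<Rightarrow> 'a ^ 3 \<Rightarrow> 'a ^ 3" where
  "semimap t = (\<lambda>(a, b, c) x. t (x$1) *s a + t (x$2) *s b + t (x$3) *s c)"

definition mval :: "gv \<times> gv \<times> gv \<Rightarrow> ('a::field ^ 3) \<times> ('a ^ 3) \<times> ('a ^ 3)" where
  "mval = (\<lambda>(a, b, c). (vval a, vval b, vval c))"

definition aut :: "bool \<Rightarrow> 'a::field \<Rightarrow> 'a" where
  "aut b = (if b then frob else id)"

definition quot_sum :: "(int \<times> int) list \<Rightarrow> real" where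
  "quot_sum rs = (\<Sum>(n, k)\<leftarrow>rs. real_of_int n / real_of_int k)"

lemma vmem_iff [simp]: "vmem x ys \<longleftrightarrow> x \<in> set ys"
  by (induction ys) auto

lemma set_vdel [simp]: "set (vdel ps N) = set ps - set N"
  by (induction ps) auto

lemma set_gfs: "set gfs = UNIV"
proof -
  have "x \<in> set gfs" for x by (cases x) (simp_all add: gfs_def)
  then show ?thesis by blast
qed

lemma set_units: "set units = - {F0}"
proof -
  have "x \<in> set units \<longleftrightarrow> x \<noteq> F0" for x by (cases x) (simp_all add: units_def)
  then show ?thesis by blast
qed

lemma distinct_gfs: "distinct gfs" "distinct units"
  by (simp_all add: gfs_def units_def)

lemma allv_nzv: "allv = V F0 F0 F0 # nzv"
  by (simp add: nzv_def allv_def gfs_def)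

lemma allv: "distinct allv" "set allv = UNIV" "length allv = 64"
proof -
  show "distinct allv" unfolding allv_def
    by (simp add: distinct_map distinct_product distinct_gfs inj_on_def)
  have "V a b c \<in> set allv" for a b c
    unfolding allv_def by (simp add: set_gfs image_iff)
  then show "set allv = UNIV" by (metis UNIV_eq_I gv.exhaust)
  show "length allv = 64" by (simp add: allv_def length_product gfs_def)
qed

lemma nzv: "distinct nzv" "set nzv = - {V F0 F0 F0}"
  using allv(1,2) unfolding allv_nzv by auto

lemma distinct_lists: "distinct companion_list" "distinct planar_list"
  unfolding companion_list_def planar_list_def
  by (auto simp: distinct_map distinct_product distinct_gfs inj_on_def)

lemma set_companion_list: "set companion_list = {(V F0 F1 F0, V F0 F0 F1, V a b c) | a b c. a \<noteq> F0}"
  unfolding companion_list_def by (auto simp: set_gfs set_units image_iff)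

lemma set_planar_list: "set planar_list = {(V F0 F1 F0, V a b F0, V x y z) | a b x y z. a \<noteq> F0 \<and> z \<noteq> F0}"
  unfolding planar_list_def by (auto simp: set_gfs set_units image_iff)

lemma set_orbit_list_subset: "set (orbit_list fs h u x) \<subseteq> orbit h x"
proof (induction fs arbitrary: x)
  case (Cons f fs)
  have "orbit h (h x) \<subseteq> orbit h x"
    by (rule orbit_subset) (auto intro: orbit_self orbit_step)
  then show ?case using Cons[of "h x"] by (auto simp: orbit_self)
qed simp

text \<open>
  Here \<open>n\<close> is the period of \<open>u\<close>; the first list is long enough if it has at least as many
  elements as the cycle has left.
\<close>
lemma orbit_list_complete:
  assumes "(h ^^ n) u = u" "\<And>k. 0 < k \<Longrightarrow> k < n \<Longrightarrow> (h ^^ k) u \<noteq> u"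
    and "i \<le> j" "j < n" "n - i \<le> length fs"
  shows "(h ^^ j) u \<in> set (orbit_list fs h u ((h ^^ i) u))"
  using assms(3-5)
proof (induction fs arbitrary: i)
  case (Cons f fs)
  show ?case
  proof (cases "i = j")
    case False
    have "h ((h ^^ i) u) = (h ^^ Suc i) u" by simp
    moreover have "(h ^^ Suc i) u \<noteq> u" using assms(2)[of "Suc i"] Cons.prems False by simp
    ultimately show ?thesis using Cons.IH[of "Suc i"] Cons.prems False by simp
  qed simp
qed simp

text \<open>
  The period is at most 64, the number of vectors, because up to the period the iterates are
  distinct.
\<close>
lemma set_orbit_list:
  assumes h: "inj h" shows "set (orbit_list allv h u u) = orbit h u"
proof
  have fin: "finite (UNIV :: gv set)" using allv(2) by (metis List.finite_set)
  have card: "card (UNIV :: gv set) = 64" using allv by (metis distinct_card)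
  obtain N where N: "N > 0" "(h ^^ N) u = u"
    using funpow_inj_finite[OF h, of u] finite_subset[OF subset_UNIV fin] by metis
  define n where "n = (LEAST n. 0 < n \<and> (h ^^ n) u = u)"
  have n: "0 < n" "(h ^^ n) u = u"
    using LeastI[of "\<lambda>n. 0 < n \<and> (h ^^ n) u = u" N] N by (simp_all add: n_def)
  have min: "(h ^^ k) u \<noteq> u" if "0 < k" "k < n" for k
    using not_less_Least[of k "\<lambda>n. 0 < n \<and> (h ^^ n) u = u"] that by (auto simp: n_def)
  have "inj_on (\<lambda>k. (h ^^ k) u) {..<n}"
  proof (rule linorder_inj_onI)
    fix i j assume ij: "i < j" "j \<in> {..<n}"
    show "(h ^^ i) u \<noteq> (h ^^ j) u"
    proof
      assume "(h ^^ i) u = (h ^^ j) u"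
      also have "\<dots> = (h ^^ (i + (j - i))) u" using ij by simp
      also have "\<dots> = (h ^^ i) ((h ^^ (j - i)) u)" by (simp only: funpow_add o_apply)
      finally have "(h ^^ (j - i)) u = u" using inj_fn[OF h] by (metis injD)
      then show False using min[of "j - i"] ij by (simp add: less_imp_diff_less)
    qed
  qed auto
  then have "n \<le> 64" using card_inj_on_le[of _ "{..<n}" UNIV] fin card by fastforce
  then have "(h ^^ j) u \<in> set (orbit_list allv h u u)" if "j < n" for j
    using orbit_list_complete[OF n(2) min, of 0 j allv] that by (simp add: allv(3))
  moreover have "(h ^^ k) u = (h ^^ (k mod n)) u" for k
    using n by (simp add: funpow_mod_eq)
  ultimately show "orbit h u \<subseteq> set (orbit_list allv h u u)"
    using n(1) by (auto simp: orbit_def) (metis mod_less_divisor)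
qed (rule set_orbit_list_subset)

context gf4
begin

lemma fval_simps [simp]: "fval F0 = (0::'q)" "fval F1 = (1::'q)" "fval F2 = (omega::'q)" "fval F3 = (omega + 1::'q)"
  by (simp_all add: fval_def)

lemma fval_add: "fval (gadd a b) = fval a + (fval b :: 'q)"
  by (cases a; cases b) (simp_all add: add.assoc add.left_commute[of omega])

lemma fval_mul: "fval (gmul a b) = fval a * (fval b :: 'q)"
  by (cases a; cases b) (simp_all add: distrib_left distrib_right add.assoc)

lemma fval_tau: "fval (gtau b a) = (aut b (fval a) :: 'q)"
  by (cases b; cases a) (simp_all add: aut_def)

lemma fval_inj: "fval a = (fval b :: 'q) \<longleftrightarrow> a = b"
proof -
  have "(omega :: 'q) \<noteq> omega + 1" "(1 :: 'q) \<noteq> omega + 1" "(0 :: 'q) \<noteq> omega + 1"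
    using omega_ne_simps by metis+
  then show ?thesis by (cases a; cases b) simp_all
qed

lemma fval_0: "fval a = (0 :: 'q) \<longleftrightarrow> a = F0"
  using fval_inj[of a F0] by simp

lemma fval_surj: "\<exists>a. fval a = (x :: 'q)"
  using cases4[of x] fval_simps by metis

lemma vval_nth [simp]: "vval (V a b c) $ 1 = fval a" "vval (V a b c) $ 2 = fval b" "vval (V a b c) $ 3 = (fval c :: 'q)"
  by (simp_all add: vval_def)

lemma vval_add: "vval (vadd x y) = vval x + (vval y :: 'q^3)"
  by (cases x; cases y) (simp add: vec3_eq fval_add)

lemma vval_sm: "vval (vsm k x) = fval k *s (vval x :: 'q^3)"
  by (cases x) (simp add: vec3_eq fval_mul)

lemma fval_det: "fval (vdet x y z) = (det3 (vval x) (vval y) (vval z) :: 'q)"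
  by (cases x; cases y; cases z) (simp add: det3_def dotp_def fval_add fval_mul)

lemma vval_inj: "vval x = (vval y :: 'q^3) \<longleftrightarrow> x = y"
  by (cases x; cases y) (simp add: vec3_eq fval_inj)

lemma vval_bij: "bij (vval :: gv \<Rightarrow> 'q^3)"
proof -
  have "\<exists>v. x = vval v" for x :: "'q^3"
  proof -
    obtain a b c where "fval a = x$1" "fval b = x$2" "fval c = x$3" using fval_surj by metis
    then have "x = vval (V a b c)" by (simp add: vec3_eq)
    then show ?thesis ..
  qed
  then show ?thesis by (auto simp: bij_def inj_def vval_inj surj_def)
qed

lemma vval_0: "vval x = (0 :: 'q^3) \<longleftrightarrow> x = V F0 F0 F0"
  by (cases x) (simp add: vec3_eq fval_0)

lemma vval_nzv: "vval ` set nzv = - {0 :: 'q^3}"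
proof -
  have "vval ` (- {V F0 F0 F0}) = - (vval ` {V F0 F0 F0} :: ('q^3) set)"
    using vval_bij by (rule bij_image_Compl_eq)
  then show ?thesis using vval_0[of "V F0 F0 F0"] by (simp add: nzv)
qed

lemma aut_auts: "aut b \<in> (auts :: ('q \<Rightarrow> 'q) set)"
  by (simp add: aut_def)

lemma semimap_semilinear:
  assumes "t \<in> (auts :: ('q \<Rightarrow> 'q) set)" shows "semilinear t (semimap t m)"
  by (cases m) (simp add: semimap_def semilinear_def vec3_eq auts_rules[OF assms] algebra_simps)

lemma semimap_E [simp]:
  assumes "t \<in> (auts :: ('q \<Rightarrow> 'q) set)"
  shows "semimap t (a, b, c) E1 = a" "semimap t (a, b, c) E2 = b" "semimap t (a, b, c) E3 = c"
  by (simp_all add: semimap_def auts_rules[OF assms])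

lemma semimap_GammaL_over_iff:
  assumes t: "t \<in> (auts :: ('q \<Rightarrow> 'q) set)"
  shows "semimap t (a, b, c) \<in> GammaL_over t \<longleftrightarrow> det3 a b c \<noteq> 0"
proof -
  have d: "det_map (semimap t (a, b, c)) = det3 a b c" by (simp add: det_map_def semimap_E[OF t])
  show ?thesis
    using semilinear_bij[OF t semimap_semilinear[OF t], of "(a, b, c)"] GammaL_det_map[OF GammaL_over_GammaL[OF t]] d
      semimap_semilinear[OF t] by (auto simp: GammaL_over_def)
qed

lemma semimap_expand:
  assumes "g \<in> GammaL_over t" shows "g = semimap t (g E1, g E2, (g E3 :: 'q^3))"
proof
  fix x show "g x = semimap t (g E1, g E2, g E3) x"
    unfolding semimap_def prod.case using assms by (intro semilinear_expand) (simp add: GammaL_over_def)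
qed

lemma vval_vmap: "vval (vmap b m x) = semimap (aut b) (mval m) (vval x :: 'q^3)"
  by (cases m; cases x) (simp add: vval_add vval_sm fval_tau semimap_def mval_def add.assoc)

lemma vval_E: "vval (V F1 F0 F0) = (E1 :: 'q^3)" "vval (V F0 F1 F0) = (E2 :: 'q^3)" "vval (V F0 F0 F1) = (E3 :: 'q^3)"
  by (simp_all add: vec3_eq)

lemma orbit_vval:
  assumes h: "\<And>x. vval (h x) = g (vval x :: 'q^3)"
  shows "vval ` orbit h u = orbit g (vval u)"
proof -
  have "vval ((h ^^ n) u) = (g ^^ n) (vval u)" for n by (induction n) (simp_all add: h)
  then show ?thesis by (simp add: orbit_def image_image)
qed

lemma set_scal_list: "vval ` set (scal_list C) = scalings (vval ` set C :: ('q^3) set)"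
proof -
  have "vval ` set (scal_list C) = vval ` set C \<union> (\<lambda>y. omega *s y) ` vval ` set C \<union> (\<lambda>y. (omega + 1) *s y) ` (vval ` set C :: ('q^3) set)"
    by (simp add: scal_list_def image_Un image_image vval_sm Un_assoc)
  moreover have "scalings X = X \<union> (\<lambda>y. omega *s y) ` X \<union> (\<lambda>y. (omega + 1) *s y) ` X" for X :: "('q^3) set"
  proof -
    have "z \<in> scalings X \<longleftrightarrow> (\<exists>c. c \<noteq> 0 \<and> (\<exists>y\<in>X. z = c *s y))" for z by (auto simp: scalings_def)
    then show ?thesis unfolding ex4 by (auto simp: image_iff)
  qed
  ultimately show ?thesis by simp
qed

lemma induced_inj:
  assumes h: "\<And>x. vval (h x) = g (vval x :: 'q^3)" and g: "g \<in> GammaL"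
  shows "inj h"
proof (rule injI)
  fix x y assume "h x = h y"
  then have "g (vval x) = g (vval y)" by (metis h)
  moreover have "inj g" using g by (simp add: GammaL_def bij_def)
  ultimately show "x = y" by (simp add: inj_eq vval_inj)
qed

lemma tame_count_tame:
  assumes h: "\<And>x. vval (h x) = g (vval x :: 'q^3)" and g: "g \<in> GammaL"
  shows "tame_count u (orbit_list allv h u u) = (if tame g (vval u) then 1 else 0)"
proof -
  have O: "vval x \<in> orbit g (vval u) \<longleftrightarrow> x \<in> orbit h u" for x
    unfolding orbit_vval[of h g, OF h, symmetric] by (auto simp: vval_inj)
  have "tame g (vval u) \<longleftrightarrow> vsm F2 u \<notin> orbit h u \<and> vsm F3 u \<notin> orbit h u"
    unfolding tame_def all4 O[symmetric] by (simp add: vval_sm)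
  then show ?thesis by (simp add: tame_count_def set_orbit_list[OF induced_inj[OF h g]])
qed

lemma starts_card:
  assumes h: "\<And>x. vval (h x) = g (vval x :: 'q^3)" and g: "g \<in> GammaL"
  shows "starts h p = int (card {c. c \<noteq> 0 \<and> tame g (c *s vval p)})"
proof -
  have "int (card {c :: 'q. P c}) = (\<Sum>c\<in>UNIV. if P c then 1 else 0)" for P
    by (simp add: sum.If_cases)
  then have "int (card {c. c \<noteq> 0 \<and> tame g (c *s vval p)}) =
      (if tame g (1 *s vval p) then 1 else 0) + ((if tame g (omega *s vval p) then 1 else 0) +
      (if tame g ((omega + 1) *s vval p) then 1 else 0))"
    by (simp add: sum4)
  also have "\<dots> = starts h p"
    unfolding starts_def tame_count_tame[OF h g] vval_sm by simp
  finally show ?thesis ..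
qed

text \<open>
  The assumption on \<open>h\<close> says that \<open>h\<close> computes \<open>g\<close> on the copy of the vector space.
\<close>
lemma fixed_count_fixed_on:
  assumes h: "\<And>x. vval (h x) = g (vval x :: 'q^3)" and g: "g \<in> GammaL"
    and "set R \<subseteq> set ps" "g ` vval ` set R = vval ` set R" "0 \<notin> (vval ` set R :: ('q^3) set)"
      "scalings (vval ` set R) \<subseteq> (vval ` set R :: ('q^3) set)"
  shows "fixed_count h ps R = int (card (fixed_on g (vval ` set R)))"
  using assms(3-)
proof (induction ps arbitrary: R)
  case Nil
  then have "fixed_on g (vval ` set R) = {{}}" by (auto simp: fixed_on_def)
  then show ?case by simp
next
  case (Cons p ps)
  show ?case
  proof (cases "p \<in> set R")
    case False
    then have "set R \<subseteq> set ps" using Cons.prems(1) by auto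
    then show ?thesis using Cons.IH[of R] Cons.prems False by simp
  next
    case True
    let ?Q = "scalings (orbit g (vval p))" and ?N = "scal_list (orbit_list allv h p p)"
    have Q: "vval ` set ?N = ?Q"
      by (simp add: set_scal_list set_orbit_list[OF induced_inj[OF h g]] orbit_vval[of h g, OF h])
    have D: "vval ` set (vdel R ?N) = vval ` set R - ?Q"
      using vval_bij by (simp add: bij_def image_set_diff Q)
    note split = fixed_on_split[OF g Cons.prems(2-4) imageI[OF True, of vval], folded D]
    have "p \<in> set (orbit_list allv h p p)" by (simp add: set_orbit_list[OF induced_inj[OF h g]] orbit_self)
    then have "p \<in> set ?N" by (simp add: scal_list_def)
    then have "set (vdel R ?N) \<subseteq> set ps" using Cons.prems(1) by auto
    then have "fixed_count h ps (vdel R ?N) = int (card (fixed_on g (vval ` set (vdel R ?N))))"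
      using split(1,2) Cons.prems(3) D by (intro Cons.IH) auto
    then show ?thesis using True split(3) by (simp add: starts_card[OF h g])
  qed
qed

lemma fixed_count_num_fixed:
  assumes h: "\<And>x. vval (h x) = g (vval x :: 'q^3)" and g: "g \<in> GammaL"
  shows "fixed_count h nzv nzv = int (num_fixed g)"
proof -
  obtain t where t: "t \<in> auts" "semilinear t g" and b: "bij g" using g by (auto simp: GammaL_def)
  have "g ` (- {0}) = - (g ` {0})" using b by (rule bij_image_Compl_eq)
  then have "g ` (- {0}) = - {0}" by (simp add: semilinear_0[OF t(2)])
  moreover have "scalings (- {0}) \<subseteq> - {0 :: 'q^3}" by (auto simp: scalings_def)
  ultimately show ?thesis
    unfolding num_fixed_fixed_on by (intro fixed_count_fixed_on[OF h g, of nzv nzv, unfolded vval_nzv]) simp_all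
qed

lemma count_nonzero_vectors:
  assumes f: "f [] = (0::int)" "\<And>v vs. f (v # vs) = (if P v then f vs else 1 + f vs)"
    and Q: "\<And>v. v \<noteq> V F0 F0 F0 \<Longrightarrow> P v \<longleftrightarrow> \<not> Q (vval v :: 'q^3)" and Q0: "\<not> Q 0"
  shows "f nzv = int (card {v. Q v})"
proof -
  have "f vs = int (length (filter (\<lambda>v. \<not> P v) vs))" for vs by (induction vs) (simp_all add: f)
  also have "length (filter (\<lambda>v. \<not> P v) nzv) = card (set (filter (\<lambda>v. \<not> P v) nzv))"
    using nzv(1) by (intro distinct_card[symmetric]) simp
  also have "\<dots> = card (vval ` set (filter (\<lambda>v. \<not> P v) nzv) :: ('q^3) set)"
    by (intro card_image[symmetric] inj_onI) (simp add: vval_inj)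
  also have "vval ` set (filter (\<lambda>v. \<not> P v) nzv) = {v \<in> vval ` set nzv. Q (v :: 'q^3)}"
    using Q by (auto simp: nzv)
  also have "\<dots> = {v. Q v}" unfolding vval_nzv using Q0 by auto
  finally show ?thesis .
qed

lemma cyclic_count_num_cyclic:
  assumes h: "\<And>x. vval (h x) = g (vval x :: 'q^3)"
  shows "cyclic_count h nzv = int (num_cyclic g)"
  unfolding num_cyclic_def
  by (rule count_nonzero_vectors[where P = "\<lambda>v. vdet v (h v) (h (h v)) = F0"])
    (simp_all add: h fval_0[symmetric] fval_det)

lemma has_cyclic_num_cyclic:
  assumes h: "\<And>x. vval (h x) = g (vval x :: 'q^3)"
  shows "has_cyclic h nzv \<longleftrightarrow> num_cyclic g \<noteq> 0"
proof -
  have nn: "cyclic_count h vs \<ge> 0" for vs by (induction vs) auto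
  have "has_cyclic h vs \<longleftrightarrow> cyclic_count h vs \<noteq> 0" for vs
  proof (induction vs)
    case (Cons v vs) then show ?case using nn[of vs] by simp
  qed simp
  then show ?thesis by (simp add: cyclic_count_num_cyclic[of h g, OF h])
qed

lemma moved_count_num_moved:
  assumes h: "\<And>x. vval (h x) = g (vval x :: 'q^3)" and g: "g \<in> GammaL"
  shows "moved_count h nzv = int (num_moved g)"
  unfolding num_moved_def
proof (rule count_nonzero_vectors[where P = "\<lambda>v. vmem (h v) (scal_list [v])"])
  obtain t where t: "semilinear t g" and b: "inj g" using g by (auto simp: GammaL_def bij_def)
  fix v assume v: "v \<noteq> V F0 F0 F0"
  then have vval: "vval v \<noteq> (0 :: 'q^3)" by (simp add: vval_0)
  have gv: "g (vval v) \<noteq> 0"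
  proof
    assume "g (vval v) = 0"
    then have "g (vval v) = g 0" using semilinear_0[OF t] by simp
    then show False using b vval by (simp add: inj_eq)
  qed
  have "h v \<in> set (scal_list [v]) \<longleftrightarrow> vval (h v) \<in> (vval ` set (scal_list [v]) :: ('q^3) set)"
    by (auto simp: vval_inj)
  also have "\<dots> \<longleftrightarrow> (\<exists>c. c \<noteq> 0 \<and> g (vval v) = c *s vval v)"
    unfolding set_scal_list h by (auto simp: scalings_def)
  also have "\<dots> \<longleftrightarrow> cross (vval v) (g (vval v)) = 0"
  proof
    assume "\<exists>c. c \<noteq> 0 \<and> g (vval v) = c *s vval v"
    then obtain c where "g (vval v) = c *s vval v" by blast
    then show "cross (vval v) (g (vval v)) = 0" by (simp only: cross_smult cross_self vec.scale_zero_right)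
  next
    assume "cross (vval v) (g (vval v)) = 0"
    then obtain c where c: "g (vval v) = c *s vval v" using cross_eq_0 vval by blast
    then have "c \<noteq> 0" using gv by auto
    then show "\<exists>c. c \<noteq> 0 \<and> g (vval v) = c *s vval v" using c by blast
  qed
  finally show "vmem (h v) (scal_list [v]) \<longleftrightarrow> \<not> cross (vval v) (g (vval v)) \<noteq> 0" by simp
qed simp_all

lemma det3_E2E3: "det3 E2 E3 u = (u $ 1 :: 'q)" "w $ 3 = 0 \<Longrightarrow> det3 E2 w u = (w $ 1 * u $ 3 :: 'q)"
  by (simp_all add: det3_def dotp_def)

lemma mval_inj: "inj (mval :: gv \<times> gv \<times> gv \<Rightarrow> ('q^3) \<times> ('q^3) \<times> ('q^3))"
  by (auto intro!: injI simp: mval_def vval_inj)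

lemma semimap_inj: "t \<in> auts \<Longrightarrow> inj (semimap (t :: 'q \<Rightarrow> 'q))"
proof (rule injI)
  fix m m' :: "('q^3) \<times> ('q^3) \<times> ('q^3)"
  assume t: "t \<in> auts" and e: "semimap t m = semimap t m'"
  show "m = m'"
    using fun_cong[OF e, of E1] fun_cong[OF e, of E2] fun_cong[OF e, of E3]
    by (cases m; cases m') (simp add: t)
qed

lemma vval_V_ex: "\<exists>a b c. x = vval (V a b c) \<and> fval a = x $ 1 \<and> fval b = x $ 2 \<and> fval c = (x $ 3 :: 'q)"
proof -
  obtain v where "x = vval v" using vval_bij by (metis bij_def surjD)
  then show ?thesis by (cases v) auto
qed

lemma companion_forms_list: "companion_forms (aut b) = (\<lambda>m. semimap (aut b) (mval m :: ('q^3) \<times> ('q^3) \<times> ('q^3))) ` set companion_list"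
proof (intro equalityI subsetI)
  fix g :: "'q^3 \<Rightarrow> 'q^3" assume g: "g \<in> companion_forms (aut b)"
  then have G: "g \<in> GammaL_over (aut b)" and e: "g E1 = E2" "g E2 = E3" by (auto simp: companion_forms_def)
  have "g = semimap (aut b) (E2, E3, g E3)" using semimap_expand[OF G] unfolding e .
  then obtain u where gu: "g = semimap (aut b) (E2, E3, u)" by blast
  then have "det3 E2 E3 u \<noteq> 0" using G semimap_GammaL_over_iff[OF aut_auts] by simp
  then have "u $ 1 \<noteq> 0" by (simp add: det3_E2E3)
  moreover obtain x y z where u: "u = vval (V x y z)" using vval_V_ex[of u] by blast
  ultimately have "x \<noteq> F0" using fval_0 by auto
  then have "(V F0 F1 F0, V F0 F0 F1, V x y z) \<in> set companion_list" by (simp add: set_companion_list)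
  moreover have "g = semimap (aut b) (mval (V F0 F1 F0, V F0 F0 F1, V x y z))"
    unfolding gu u by (simp add: mval_def vval_E)
  ultimately show "g \<in> (\<lambda>m. semimap (aut b) (mval m)) ` set companion_list" by blast
next
  fix g :: "'q^3 \<Rightarrow> 'q^3" assume "g \<in> (\<lambda>m. semimap (aut b) (mval m)) ` set companion_list"
  then obtain x y z where "x \<noteq> F0" "g = semimap (aut b) (E2, E3, vval (V x y z))"
    by (auto simp: set_companion_list mval_def vval_E)
  then show "g \<in> companion_forms (aut b)"
    by (simp add: companion_forms_def aut_auts semimap_GammaL_over_iff det3_E2E3 fval_0)
qed

lemma planar_forms_list:
  "planar_forms (aut b) = {g \<in> (\<lambda>m. semimap (aut b) (mval m :: ('q^3) \<times> ('q^3) \<times> ('q^3))) ` set planar_list. num_cyclic g = 0}"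
proof (intro equalityI subsetI)
  fix g :: "'q^3 \<Rightarrow> 'q^3" assume g: "g \<in> planar_forms (aut b)"
  then have G: "g \<in> GammaL_over (aut b)" and e: "g E1 = E2" "g E2 $ 3 = 0" "num_cyclic g = 0" by (auto simp: planar_forms_def)
  have "g = semimap (aut b) (E2, g E2, g E3)" using semimap_expand[OF G] unfolding e(1) .
  then obtain w u where gu: "g = semimap (aut b) (E2, w, u)" by blast
  have w3: "w $ 3 = 0" using e(2) unfolding gu by (simp add: aut_auts)
  have "det3 E2 w u \<noteq> 0" using G semimap_GammaL_over_iff[OF aut_auts] by (simp add: gu)
  then have nz: "w $ 1 \<noteq> 0" "u $ 3 \<noteq> 0" using w3 by (auto simp: det3_E2E3)
  obtain x y z where u: "u = vval (V x y z)" using vval_V_ex[of u] by blast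
  obtain a c d where w: "w = vval (V a c d)" using vval_V_ex[of w] by blast
  have "a \<noteq> F0" "d = F0" "z \<noteq> F0" using nz w3 unfolding u w by (auto simp: fval_0)
  then have "(V F0 F1 F0, V a c d, V x y z) \<in> set planar_list" by (simp add: set_planar_list)
  moreover have "g = semimap (aut b) (mval (V F0 F1 F0, V a c d, V x y z))"
    unfolding gu u w by (simp add: mval_def vval_E)
  ultimately show "g \<in> {g \<in> (\<lambda>m. semimap (aut b) (mval m)) ` set planar_list. num_cyclic g = 0}" using e(3) by blast
next
  fix g :: "'q^3 \<Rightarrow> 'q^3" assume "g \<in> {g \<in> (\<lambda>m. semimap (aut b) (mval m)) ` set planar_list. num_cyclic g = 0}"
  then obtain a c x y z where "a \<noteq> F0" "z \<noteq> F0" "num_cyclic g = 0"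
    "g = semimap (aut b) (E2, vval (V a c F0), vval (V x y z))"
    by (auto simp: set_planar_list mval_def vval_E)
  then show "g \<in> planar_forms (aut b)"
    by (simp add: planar_forms_def aut_auts semimap_GammaL_over_iff det3_E2E3 fval_0)
qed

lemma companion_list_GammaL: "m \<in> set companion_list \<Longrightarrow> semimap (aut b) (mval m :: ('q^3) \<times> ('q^3) \<times> ('q^3)) \<in> GammaL"
  using companion_forms_list[of b] GammaL_over_GammaL[OF aut_auts, of _ b] by (auto simp: companion_forms_def)

lemma planar_list_GammaL: "m \<in> set planar_list \<Longrightarrow> semimap (aut b) (mval m :: ('q^3) \<times> ('q^3) \<times> ('q^3)) \<in> GammaL"
  using GammaL_over_GammaL[OF aut_auts, of _ b]
  by (auto simp: set_planar_list mval_def vval_E aut_auts semimap_GammaL_over_iff det3_E2E3 fval_0)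

lemma sum_companion_forms:
  "(\<Sum>g\<in>companion_forms (aut b :: 'q \<Rightarrow> 'q). real (num_fixed g) / real (num_cyclic g)) = quot_sum (companion_rows b companion_list)"
proof -
  let ?g = "\<lambda>m. semimap (aut b) (mval m :: ('q^3) \<times> ('q^3) \<times> ('q^3))"
  have inj: "inj ?g" using inj_compose[OF semimap_inj[OF aut_auts[of b]] mval_inj] by (simp add: o_def)
  have "(\<Sum>g\<in>companion_forms (aut b :: 'q \<Rightarrow> 'q). real (num_fixed g) / real (num_cyclic g)) = (\<Sum>m\<leftarrow>companion_list. real (num_fixed (?g m)) / real (num_cyclic (?g m)))"
    unfolding companion_forms_list
    by (subst sum.reindex[OF inj_on_subset[OF inj subset_UNIV]])
      (simp add: sum_list_distinct_conv_sum_set distinct_lists)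
  also have "set ms \<subseteq> set companion_list \<Longrightarrow>
      (\<Sum>m\<leftarrow>ms. real (num_fixed (?g m)) / real (num_cyclic (?g m))) = quot_sum (companion_rows b ms)" for ms
  proof (induction ms)
    case (Cons m ms)
    have c: "fixed_count (vmap b m) nzv nzv = int (num_fixed (?g m))" "cyclic_count (vmap b m) nzv = int (num_cyclic (?g m))"
    proof -
      have G: "?g m \<in> GammaL" using Cons.prems by (intro companion_list_GammaL) simp
      show "fixed_count (vmap b m) nzv nzv = int (num_fixed (?g m))" "cyclic_count (vmap b m) nzv = int (num_cyclic (?g m))"
        by (rule fixed_count_num_fixed[of "vmap b m" "?g m", OF vval_vmap G], rule cyclic_count_num_cyclic[of "vmap b m" "?g m", OF vval_vmap])
    qed
    show ?case using Cons by (simp add: c quot_sum_def)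
  qed (simp add: quot_sum_def)
  finally show ?thesis by simp
qed

lemma sum_planar_forms:
  "(\<Sum>g\<in>planar_forms (aut b :: 'q \<Rightarrow> 'q). real (num_fixed g) / (48 * real (num_moved g))) = quot_sum (planar_rows b planar_list) / 48"
proof -
  let ?g = "\<lambda>m. semimap (aut b) (mval m :: ('q^3) \<times> ('q^3) \<times> ('q^3))"
  let ?f = "\<lambda>g. if num_cyclic g = 0 then real (num_fixed g) / (48 * real (num_moved g)) else 0"
  have inj: "inj ?g" using inj_compose[OF semimap_inj[OF aut_auts[of b]] mval_inj] by (simp add: o_def)
  have "(\<Sum>g\<in>planar_forms (aut b :: 'q \<Rightarrow> 'q). real (num_fixed g) / (48 * real (num_moved g))) = (\<Sum>g\<in>?g ` set planar_list. ?f g)"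
    unfolding planar_forms_list by (simp add: sum.inter_filter)
  also have "\<dots> = (\<Sum>m\<leftarrow>planar_list. ?f (?g m))"
    by (subst sum.reindex[OF inj_on_subset[OF inj subset_UNIV]])
      (simp add: sum_list_distinct_conv_sum_set distinct_lists)
  also have "set ms \<subseteq> set planar_list \<Longrightarrow> (\<Sum>m\<leftarrow>ms. ?f (?g m)) = quot_sum (planar_rows b ms) / 48" for ms
  proof (induction ms)
    case (Cons m ms)
    have c: "fixed_count (vmap b m) nzv nzv = int (num_fixed (?g m))" "moved_count (vmap b m) nzv = int (num_moved (?g m))"
      "has_cyclic (vmap b m) nzv \<longleftrightarrow> num_cyclic (?g m) \<noteq> 0"
    proof -
      have G: "?g m \<in> GammaL" using Cons.prems by (intro planar_list_GammaL) simp
      show "fixed_count (vmap b m) nzv nzv = int (num_fixed (?g m))" "moved_count (vmap b m) nzv = int (num_moved (?g m))"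
        "has_cyclic (vmap b m) nzv \<longleftrightarrow> num_cyclic (?g m) \<noteq> 0"
        by (rule fixed_count_num_fixed[of "vmap b m" "?g m", OF vval_vmap G], rule moved_count_num_moved[of "vmap b m" "?g m", OF vval_vmap G],
            rule has_cyclic_num_cyclic[of "vmap b m" "?g m", OF vval_vmap])
    qed
    show ?case using Cons by (simp add: c quot_sum_def add_divide_distrib mult.commute)
  qed (simp add: quot_sum_def)
  finally show ?thesis by simp
qed

end

text \<open>
  The rows belong to the maps of order 7 (twice), to a unipotent map of order 4, and to the
  maps of order 5 (twice).
\<close>
lemma companion_rows_linear: "companion_rows False companion_list = [(27, 63), (27, 63), (2187, 48), (243, 45), (243, 45)]"
  by code_simp

text \<open>
  The rows with 3, 27 and 243 fixed transversals belong to maps of order 14, 8 and 4.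
\<close>
lemma companion_rows_semilinear: "companion_rows True companion_list =
  [(3, 63), (27, 48), (27, 48), (3, 63), (243, 24), (3, 63), (3, 63), (27, 48), (3, 63), (27, 48),
   (3, 63), (27, 48), (3, 63), (27, 48), (3, 63), (3, 63), (243, 24), (3, 63), (27, 48), (3, 63),
   (27, 48), (3, 63), (27, 48), (27, 48), (3, 63), (3, 63), (3, 63), (3, 63), (243, 24), (27, 48),
   (3, 63), (27, 48), (3, 63)]"
  by code_simp

text \<open>These are the transvections.\<close>
lemma planar_rows_linear: "planar_rows False planar_list = replicate 4 (1594323, 48)"
  by code_simp

text \<open>
  These are the semilinear involutions, each of which fixes a three-dimensional space over
  the prime field.
\<close>
lemma planar_rows_semilinear: "planar_rows True planar_list = replicate 12 (2187, 42)"
  by code_simp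

lemma fixed_count_id: "fixed_count id nzv nzv = 3 ^ 21"
  by code_simp

context gf4
begin

text \<open>
  The identity and the tables combine to \<open>30264 * 362880\<close> fixed pairs, and 362880 is the order
  of the group.
\<close>
lemma orbits_30264:
  "card ({S :: ('q^3) set. transversal S} // {(S, T). transversal S \<and> transversal T \<and> (\<exists>h\<in>GammaL. T = h ` S)}) = 30264"
proof -
  have F1: "num_fixed (id :: 'q^3 \<Rightarrow> 'q^3) = 3 ^ 21"
    using fixed_count_num_fixed[of id "id :: 'q^3 \<Rightarrow> 'q^3"] GammaL_id fixed_count_id by simp
  have auts: "(auts :: ('q \<Rightarrow> 'q) set) = {aut False, aut True}" by (auto simp: auts_def aut_def)
  have "(aut False :: 'q \<Rightarrow> 'q) omega \<noteq> aut True omega" by (simp add: aut_def)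
  then have ne: "(aut False :: 'q \<Rightarrow> 'q) \<noteq> aut True" by metis
  have "real (\<Sum>g\<in>(GammaL :: ('q^3 \<Rightarrow> 'q^3) set). num_fixed g) = 30264 * 362880"
    unfolding num_fixed_total auts using ne
    by (simp add: sum_companion_forms sum_planar_forms F1 companion_rows_linear companion_rows_semilinear planar_rows_linear planar_rows_semilinear
        quot_sum_def sum_list_replicate)
  then have "(\<Sum>g\<in>(GammaL :: ('q^3 \<Rightarrow> 'q^3) set). num_fixed g) = 30264 * 362880" by linarith
  then show ?thesis using orbit_count(1) by (simp add: card_GammaL)
qed

end

section \<open>Isomorphism classes\<close>

text \<open>
  Equivalence classes are transported along an injective relabelling, here \<open>design_of\<close>.
\<close>
lemma equiv_image:
  assumes eq: "equiv X R" and f: "inj_on f X"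
  shows "equiv (f ` X) (map_prod f f ` R)" and "card ((f ` X) // (map_prod f f ` R)) = card (X // R)"
proof -
  have RX: "R \<subseteq> X \<times> X" using eq by (auto simp: equiv_def refl_on_def)
  have mem: "(f x, f y) \<in> map_prod f f ` R \<longleftrightarrow> (x, y) \<in> R" if "x \<in> X" "y \<in> X" for x y
  proof
    assume "(f x, f y) \<in> map_prod f f ` R"
    then obtain x' y' where xy: "(x', y') \<in> R" "f x = f x'" "f y = f y'" by auto
    then have "x = x'" "y = y'" using RX that f by (auto dest: inj_onD)
    then show "(x, y) \<in> R" using xy by simp
  qed force
  show "equiv (f ` X) (map_prod f f ` R)"
  proof (rule equivI)
    show "map_prod f f ` R \<subseteq> f ` X \<times> f ` X" using RX by auto
    show "refl_on (f ` X) (map_prod f f ` R)"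
      using eq RX by (auto simp: refl_on_def equiv_def mem)
    show "sym (map_prod f f ` R)"
      using eq by (auto simp: equiv_def sym_def)
    show "trans (map_prod f f ` R)"
    proof (rule transI)
      fix a b c assume a: "(a, b) \<in> map_prod f f ` R" "(b, c) \<in> map_prod f f ` R"
      then obtain x y z where xyz: "a = f x" "b = f y" "c = f z" "x \<in> X" "y \<in> X" "z \<in> X"
        using RX by (auto 4 3)
      then have "(x, y) \<in> R" "(y, z) \<in> R" using a by (simp_all add: mem)
      then have "(x, z) \<in> R" using eq by (meson equivE transD)
      then show "(a, c) \<in> map_prod f f ` R" using xyz by (simp add: mem)
    qed
  qed
  have cls: "(map_prod f f ` R) `` {f x} = f ` (R `` {x})" if "x \<in> X" for x
  proof (intro equalityI subsetI)
    fix b assume b: "b \<in> (map_prod f f ` R) `` {f x}"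
    then obtain y where y: "b = f y" "y \<in> X" using RX by auto
    then show "b \<in> f ` (R `` {x})" using b mem[OF that y(2)] by auto
  qed force
  have "(f ` X) // (map_prod f f ` R) = (\<lambda>C. f ` C) ` (X // R)"
    unfolding quotient_def using cls by auto
  moreover have "inj_on (\<lambda>C. f ` C) (X // R)"
    using in_quotient_imp_subset[OF eq] f by (auto intro!: inj_onI simp: inj_on_image_eq_iff)
  ultimately show "card ((f ` X) // (map_prod f f ` R)) = card (X // R)" by (simp add: card_image)
qed

lemma ex_inequivalent_set:
  assumes eq: "equiv A r" and fin: "finite (A // r)"
  shows "\<exists>S \<subseteq> A. finite S \<and> pairwise (\<lambda>x y. (x, y) \<notin> r) S \<and> card S = card (A // r)"
proof -
  have "\<exists>x. x \<in> C" if "C \<in> A // r" for C using in_quotient_imp_non_empty[OF eq that] by blast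
  then obtain f where f: "\<And>C. C \<in> A // r \<Longrightarrow> f C \<in> C" by metis
  have fA: "f ` (A // r) \<subseteq> A" using f in_quotient_imp_subset[OF eq] by blast
  have fr: "C = D" if "C \<in> A // r" "D \<in> A // r" "(f C, f D) \<in> r" for C D
    using quotient_eqI[OF eq that(1,2) f[OF that(1)] f[OF that(2)] that(3)] .
  have "inj_on f (A // r)"
  proof (rule inj_onI)
    fix C D assume CD: "C \<in> A // r" "D \<in> A // r" "f C = f D"
    have "(f C, f C) \<in> r" using fA CD(1) eq by (auto simp: equiv_def refl_on_def)
    then show "C = D" using fr CD by simp
  qed
  then show ?thesis
    using fA fin fr by (intro exI[of _ "f ` (A // r)"]) (auto simp: card_image pairwise_def)
qed

lemma inequivalent_set_bound:
  assumes eq: "equiv A r" and fin: "finite (A // r)" and S: "S \<subseteq> A" "pairwise (\<lambda>x y. (x, y) \<notin> r) S"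
  shows "finite S \<and> card S \<le> card (A // r)"
proof -
  have inj: "inj_on (\<lambda>x. r `` {x}) S"
  proof (rule inj_onI)
    fix x y assume xy: "x \<in> S" "y \<in> S" "r `` {x} = r `` {y}"
    then have "(x, y) \<in> r" using S(1) eq_equiv_class_iff[OF eq] by blast
    then show "x = y" using S(2) xy by (auto simp: pairwise_def)
  qed
  have im: "(\<lambda>x. r `` {x}) ` S \<subseteq> A // r" using S(1) by (auto intro: quotientI)
  show ?thesis using inj_on_finite[OF inj im fin] card_inj_on_le[OF inj im fin] by blast
qed

lemma (in gf4) bh_isomorphism_eq:
  "(bh_isomorphism :: ('q^3) design rel) =
    map_prod design_of design_of ` {(S, T). transversal S \<and> transversal T \<and> (\<exists>h\<in>GammaL. T = h ` S)}"
proof (intro equalityI subrelI)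
  fix D E :: "('q^3) design" assume "(D, E) \<in> bh_isomorphism"
  then obtain S T :: "('q^3) set" where "D = design_of S" "E = design_of T" "transversal S" "transversal T"
    "isomorphic_designs (design_of S) (design_of T)"
    by (auto simp: bh_isomorphism_def bh_designs_eq)
  then show "(D, E) \<in> map_prod design_of design_of ` {(S, T). transversal S \<and> transversal T \<and> (\<exists>h\<in>GammaL. T = h ` S)}"
    using isomorphic_design_of_iff by (auto intro!: image_eqI[of _ _ "(S, T)"])
next
  fix D E :: "('q^3) design"
  assume "(D, E) \<in> map_prod design_of design_of ` {(S, T). transversal S \<and> transversal T \<and> (\<exists>h\<in>GammaL. T = h ` S)}"
  then obtain S T :: "('q^3) set" where "D = design_of S" "E = design_of T" "transversal S" "transversal T"
    "\<exists>h\<in>GammaL. T = h ` S" by auto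
  then show "(D, E) \<in> bh_isomorphism"
    using isomorphic_design_of_iff by (auto simp: bh_isomorphism_def bh_designs_eq)
qed

theorem theorem2:
  assumes "CARD('q::{field,finite}) = 4"
  shows "card ((bh_designs :: ('q ^ 3) design set) // bh_isomorphism) = 30264 \<and>
    (\<exists>S \<subseteq> (bh_designs :: ('q ^ 3) design set).
        finite S \<and> pairwise (\<lambda>D E. \<not> isomorphic_designs D E) S \<and> card S = 30264) \<and>
    (\<forall>S \<subseteq> (bh_designs :: ('q ^ 3) design set).
        pairwise (\<lambda>D E. \<not> isomorphic_designs D E) S \<longrightarrow> finite S \<and> card S \<le> 30264)"
proof -
  interpret gf4 "TYPE('q)" by unfold_locales (rule assms)
  let ?B = "bh_designs :: ('q ^ 3) design set"
  have eq: "equiv ?B bh_isomorphism" and card: "card (?B // bh_isomorphism) = 30264"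
    using equiv_image[OF orbit_count(2) design_of_inj] orbits_30264
    unfolding bh_isomorphism_eq bh_designs_eq by simp_all
  then have fin: "finite (?B // bh_isomorphism)" by (intro card_ge_0_finite) simp
  have iso: "pairwise (\<lambda>D E. \<not> isomorphic_designs D E) S \<longleftrightarrow> pairwise (\<lambda>D E. (D, E) \<notin> bh_isomorphism) S"
    if "S \<subseteq> ?B" for S
    using that unfolding pairwise_def bh_isomorphism_def by blast
  show ?thesis
    using card ex_inequivalent_set[OF eq fin] inequivalent_set_bound[OF eq fin] iso by auto
qed

end
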